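(* Let $[T]_\varphi$ be the image of the minimal Ghys–Sergiescu action of Thompson's group $T$ on the circle associated to the map $\varphi$ (defined in the context). Then the set $\mathrm{NE}([T]_\varphi)$ of non-expandable points consists of a single point, and this point is an isolated fixed point of some element of $[T]_\varphi$. (Therefore this action satisfies property $(\star)$.) On the other hand, the Lyapunov expansion exponent of the action is zero, i.e. $\lambda_{exp}(x;\mathcal F)=0$ for Lebesgue-almost every $x\in S^1$, where $\mathcal F$ is a finite set generating $[T]_\varphi$ as a semigroup.
   Context: $S^1=\mathbb R/\mathbb Z$ with its standard metric; $g'(x)$ is the usual derivative. Thompson's group $T$ is the group of orientation-preserving circle homeomorphisms which are piecewise linear, whose break points and their images are dyadic rationals, and which induce a bijection of the set of dyadic rationals (so slopes are integer powers of $2$). It is finitely generated. Let $\varphi_0(x)=2x \bmod 1$; then $T$ is the set of homeomorphisms obtained by gluing, at dyadic rationals, finitely many maps of the form $\varphi_0^{-k}\circ\varphi_0^{l}$ (any branches). Let $\varphi:S^1\to S^1$ be a smooth (of class $C^r$ with $2\le r\le\infty$), orientation-preserving, monotone map of degree two with $\varphi(0)=0$, tangent to the identity at $0$ to order $r$ (i.e. $\varphi'(0)=1$ and $\varphi^{(j)}(0)=0$ for $2\le j\le r$), and such that $\varphi'(x)>1$ for all $x\ne0$. Then $\varphi$ is topologically conjugate to $\varphi_0$: there is an orientation-preserving homeomorphism $h$ with $h(0)=0$ and $h\circ\varphi_0=\varphi\circ h$. For $f\in T$ let $[f]_\varphi=h\circ f\circ h^{-1}$; equivalently, $[f]_\varphi$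 is obtained from $f$ by replacing the branches $\varphi_0^{-k}\circ\varphi_0^l$ by the corresponding branches $\varphi^{-k}\circ\varphi^l$ glued at the corresponding points of the $\varphi$-preorbit of $0$. Each $[f]_\varphi$ is a $C^r$ diffeomorphism, and $f\mapsto[f]_\varphi$ is an action of $T$ on the circle which is minimal (all orbits are dense); this is the minimal Ghys–Sergiescu action, and $[T]_\varphi=\{[f]_\varphi: f\in T\}$. For a group $G$ of circle diffeomorphisms, $x$ is non-expandable if $g'(x)\le1$ for all $g\in G$, and $\mathrm{NE}(G)$ is the set of such points. Property $(\star)$: $G$ acts minimally and for every $x\in\mathrm{NE}(G)$ there are $g_+,g_-\in G$ fixing $x$ such that, for some $\varepsilon>0$, $g_+$ has no other fixed point in $(x,x+\varepsilon)$ and $g_-$ none in $(x-\varepsilon,x)$. If $\mathcal F$ is a finite set generating $G$ as a semigroup and $\|\cdot\|_{\mathcal F}$ is the word length, the Lyapunov expansion exponent at $x$ is $\lambda_{exp}(x;\mathcal F)=\limsup_{n\to\infty}\max_{\|g\|_{\mathcal F}\le n}\frac1n\log g'(x)$. Whether it is zero or positive does not depend on the choice of $\mathcal F$. *)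

theory Defs
  imports "HOL-Analysis.Analysis"
begin

section \<open>The circle \<open>\<real>/\<int>\<close>\<close>

quotient_type circle = real / "\<lambda>s t :: real. s - t \<in> \<int>"
  morphisms rep_circle circ
proof (rule equivpI)
  show "reflp (\<lambda>s t :: real. s - t \<in> \<int>)"
    by (simp add: reflp_def)
  show "symp (\<lambda>s t :: real. s - t \<in> \<int>)"
    by (auto simp: symp_def) (metis Ints_minus minus_diff_eq)
  show "transp (\<lambda>s t :: real. s - t \<in> \<int>)"
    by (auto simp: transp_def) (metis Ints_add diff_add_cancel add_diff_eq)
qed

lemma circ_eq_iff: "circ s = circ t \<longleftrightarrow> s - t \<in> \<int>"
  by (simp add: circle.abs_eq_iff)

lemma circ_surj: "\<exists>t. x = circ t"
  by (metis Quotient3_abs_rep Quotient3_circle)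

instantiation circle :: ab_group_add
begin

lift_definition zero_circle :: circle is 0 .

lift_definition plus_circle :: "circle \<Rightarrow> circle \<Rightarrow> circle" is "(+)"
  by (metis Ints_add add_diff_add)

lift_definition uminus_circle :: "circle \<Rightarrow> circle" is uminus
  by (metis Ints_minus minus_diff_minus)

lift_definition minus_circle :: "circle \<Rightarrow> circle \<Rightarrow> circle" is "(-)"
  by (metis Ints_diff diff_diff_eq2 diff_add_eq diff_diff_eq add.commute)

instance
  by standard (transfer; simp)+

end

lemma infdist_Ints_le:
  fixes a :: real
  assumes "b - a \<in> \<int>"
  shows "infdist a \<int> \<le> infdist b \<int>"
proof -
  have "infdist a \<int> \<le> dist b n" if "n \<in> \<int>" for n :: real
  proof -
    have "n - (b - a) \<in> \<int>"
      using that assms by (rule Ints_diff)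
    then have "infdist a \<int> \<le> dist a (n - (b - a))"
      by (rule infdist_le)
    then show ?thesis by (simp add: dist_real_def algebra_simps)
  qed
  then have "infdist a \<int> \<le> (INF n\<in>\<int>. dist b n)"
    by (intro cINF_greatest) auto
  then show ?thesis
    by (metis Ints_0 empty_iff infdist_notempty)
qed

lemma infdist_Ints_cong:
  fixes a :: real
  assumes "b - a \<in> \<int>"
  shows "infdist a \<int> = infdist b \<int>"
  using infdist_Ints_le[OF assms] infdist_Ints_le[of a b] Ints_minus[OF assms]
  by (simp add: order_antisym)

lemma infdist_Ints_attained: "\<exists>n\<in>\<int>. infdist (a::real) \<int> = \<bar>a - n\<bar>"
proof -
  have "(\<int> :: real set) \<noteq> {}" using Ints_0 by blast
  with infdist_attains_inf[OF closed_Ints, of a] show ?thesis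
    by (metis dist_real_def)
qed

instantiation circle :: metric_space
begin

text \<open>The distance of two classes is the distance of the difference of any two
  representatives to the nearest integer.\<close>

lift_definition dist_circle :: "circle \<Rightarrow> circle \<Rightarrow> real" is "\<lambda>s t. infdist (s - t) \<int>"
proof -
  fix s s' t t' :: real
  assume "s - s' \<in> \<int>" "t - t' \<in> \<int>"
  then have "(s - s') - (t - t') \<in> \<int>" by (rule Ints_diff)
  then have "(s - t) - (s' - t') \<in> \<int>" by (simp add: algebra_simps)
  then show "infdist (s - t) \<int> = infdist (s' - t') \<int>"
    by (rule infdist_Ints_cong[symmetric])
qed

definition uniformity_circle :: "(circle \<times> circle) filter" where
  "uniformity_circle = (INF e\<in>{0 <..}. principal {(x, y). dist x y < e})"

definition open_circle :: "circle set \<Rightarrow> bool" where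
  "open_circle U = (\<forall>x\<in>U. eventually (\<lambda>(x', y). x' = x \<longrightarrow> y \<in> U) uniformity)"

instance
proof
  fix x y z :: circle
  show "(dist x y = 0) = (x = y)"
  proof transfer
    fix s t :: real
    show "(infdist (s - t) \<int> = 0) = (s - t \<in> \<int>)"
      using in_closed_iff_infdist_zero[of "\<int> :: real set" "s - t"] closed_Ints
      by (metis Ints_0 empty_iff)
  qed
  show "dist x y \<le> dist x z + dist y z"
  proof transfer
    fix s t u :: real
    obtain m n where "m \<in> \<int>" "n \<in> \<int>" and
      d: "infdist (s - u) \<int> = \<bar>s - u - m\<bar>" "infdist (t - u) \<int> = \<bar>t - u - n\<bar>"
      using infdist_Ints_attained by meson
    then have "infdist (s - t) \<int> \<le> dist (s - t) (m - n)"
      by (intro infdist_le Ints_diff)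
    also have "\<dots> \<le> \<bar>s - u - m\<bar> + \<bar>t - u - n\<bar>"
      by (simp add: dist_real_def)
    finally show "infdist (s - t) \<int> \<le> infdist (s - u) \<int> + infdist (t - u) \<int>"
      by (simp add: d)
  qed
qed (simp_all add: uniformity_circle_def open_circle_def)

end

lemma dist_circ: "dist (circ s) (circ t) = infdist (s - t) \<int>"
  by (rule dist_circle.abs_eq)

lemma dist_circ_le: "dist (circ s) (circ t) \<le> dist s t"
  using infdist_le[of 0 \<int> "s - t"] by (simp add: dist_circ dist_real_def)

lemma continuous_circ: "continuous_on S circ"
  unfolding continuous_on_iff by (meson dist_circ_le le_less_trans)

lemma measurable_circ [measurable]: "circ \<in> borel_measurable borel"
  by (rule borel_measurable_continuous_onI[OF continuous_circ])

definition circle_lborel :: "circle measure" where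
  "circle_lborel = distr (restrict_space lborel {0..<1}) borel circ"


section \<open>Circle maps, lifts and derivatives\<close>

definition is_lift :: "(real \<Rightarrow> real) \<Rightarrow> (circle \<Rightarrow> circle) \<Rightarrow> bool" where
  "is_lift F g \<longleftrightarrow> continuous_on UNIV F \<and> (\<forall>t. g (circ t) = circ (F t))"

definition orientation_preserving_homeo :: "(circle \<Rightarrow> circle) \<Rightarrow> bool" where
  "orientation_preserving_homeo g \<longleftrightarrow>
     (\<exists>g'. homeomorphism UNIV UNIV g g') \<and> (\<exists>F. is_lift F g \<and> strict_mono F)"

definition circle_deriv :: "(circle \<Rightarrow> circle) \<Rightarrow> circle \<Rightarrow> real" where
  "circle_deriv g x =
     (THE D. \<exists>F t. is_lift F g \<and> circ t = x \<and> (F has_real_derivative D) (at t))"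

text \<open>The derivative does not depend on the choice of the lift and of the representative.\<close>

lemma is_lift_shift_const:
  assumes "is_lift F g" "is_lift G g" "n \<in> \<int>"
  shows "\<exists>c. \<forall>t. G (t + n) = F t + c"
proof -
  define d where "d t = G (t + n) - F t" for t
  have "continuous_on UNIV (\<lambda>t. G (t + n))"
    using assms(2) unfolding is_lift_def
    by (intro continuous_on_compose2[of UNIV G UNIV "\<lambda>t. t + n"] continuous_intros) auto
  then have cont: "continuous_on UNIV d"
    using assms(1) unfolding d_def is_lift_def by (intro continuous_intros) auto
  have "circ (t + n) = circ t" for t
    using assms(3) by (simp add: circ_eq_iff)
  then have int: "d t \<in> \<int>" for t
    using assms(1,2) unfolding is_lift_def d_def by (metis circ_eq_iff)
  have "d constant_on UNIV"
  proof (rule continuous_discrete_range_constant[OF connected_UNIV cont])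
    fix x :: real
    have "1 \<le> norm (d y - d x)" if "d y \<noteq> d x" for y
      using Ints_nonzero_abs_ge1[OF Ints_diff[OF int int]] that by simp
    then show "\<exists>e>0. \<forall>y. y \<in> UNIV \<and> d y \<noteq> d x \<longrightarrow> e \<le> norm (d y - d x)"
      by (intro exI[of _ 1]) auto
  qed
  then obtain c where "\<And>t. d t = c"
    by (auto simp: constant_on_def)
  then have "G (t + n) = F t + c" for t
    by (metis d_def add.commute diff_add_cancel)
  then show ?thesis by blast
qed

lemma circle_deriv_circ:
  assumes F: "is_lift F g" "(F has_real_derivative D) (at t)"
  shows "circle_deriv g (circ t) = D"
  unfolding circle_deriv_def
proof (rule the_equality)
  show "\<exists>F' t'. is_lift F' g \<and> circ t' = circ t \<and> (F' has_real_derivative D) (at t')"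
    using F by blast
next
  fix E
  assume "\<exists>G t'. is_lift G g \<and> circ t' = circ t \<and> (G has_real_derivative E) (at t')"
  then obtain G t' where G: "is_lift G g" "t' - t \<in> \<int>" "(G has_real_derivative E) (at t')"
    by (auto simp: circ_eq_iff)
  obtain c where c: "\<And>s. G (s + (t' - t)) = F s + c"
    using is_lift_shift_const[OF F(1) G(1,2)] by blast
  have "((\<lambda>s. G (s + (t' - t))) has_real_derivative E) (at t)"
    using G(3) DERIV_shift[of G E t "t' - t"] by simp
  moreover have "((\<lambda>s. G (s + (t' - t))) has_real_derivative D) (at t)"
    unfolding c using F(2) by (auto intro!: derivative_eq_intros)
  ultimately show "E = D" by (rule DERIV_unique)
qed

definition C_diff :: "enat \<Rightarrow> (real \<Rightarrow> real) \<Rightarrow> bool" where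
  "C_diff r F \<longleftrightarrow>
     (\<forall>j. enat j < r \<longrightarrow> (\<forall>t. (deriv ^^ j) F field_differentiable (at t))) \<and>
     (\<forall>j. enat j \<le> r \<longrightarrow> continuous_on UNIV ((deriv ^^ j) F))"


section \<open>Thompson's group \<open>T\<close>\<close>

definition dyadic :: "circle set" where
  "dyadic = {circ (of_int m / 2 ^ k) | (m::int) (k::nat). True}"

definition break_points :: "(circle \<Rightarrow> circle) \<Rightarrow> circle set" where
  "break_points f =
     {x. \<not> (\<exists>a. \<exists>\<epsilon>>0. \<forall>s. \<bar>s\<bar> < \<epsilon> \<longrightarrow> f (x + circ s) = f x + circ (a * s))}"

text \<open>A homeomorphism is piecewise linear iff it has finitely many break points.\<close>

definition thompson_T :: "(circle \<Rightarrow> circle) set" where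
  "thompson_T =
     {f. orientation_preserving_homeo f \<and> finite (break_points f) \<and>
         break_points f \<subseteq> dyadic \<and> f ` break_points f \<subseteq> dyadic \<and> bij_betw f dyadic dyadic}"


section \<open>The Ghys--Sergiescu action\<close>

definition doubling :: "circle \<Rightarrow> circle" where
  "doubling x = x + x"

text \<open>The lift \<open>\<Phi>\<close> is normalized by \<open>\<Phi> 0 = 0\<close>, so it is unique.\<close>

definition ghys_sergiescu_map :: "enat \<Rightarrow> (circle \<Rightarrow> circle) \<Rightarrow> bool" where
  "ghys_sergiescu_map r \<phi> \<longleftrightarrow>
     \<phi> 0 = 0 \<and>
     (\<exists>\<Phi>. is_lift \<Phi> \<phi> \<and> \<Phi> 0 = 0 \<and> mono \<Phi> \<and> (\<forall>t. \<Phi> (t + 1) = \<Phi> t + 2) \<and>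
          C_diff r \<Phi> \<and> (\<forall>j\<ge>2. enat j \<le> r \<longrightarrow> (deriv ^^ j) \<Phi> 0 = 0)) \<and>
     circle_deriv \<phi> 0 = 1 \<and>
     (\<forall>x. x \<noteq> 0 \<longrightarrow> circle_deriv \<phi> x > 1)"

text \<open>Such a conjugacy exists and is unique for every map as above.\<close>

definition doubling_conjugacy :: "(circle \<Rightarrow> circle) \<Rightarrow> circle \<Rightarrow> circle" where
  "doubling_conjugacy \<phi> =
     (SOME h. orientation_preserving_homeo h \<and> h 0 = 0 \<and> h \<circ> doubling = \<phi> \<circ> h)"

definition gs_action :: "(circle \<Rightarrow> circle) \<Rightarrow> (circle \<Rightarrow> circle) \<Rightarrow> circle \<Rightarrow> circle" where
  "gs_action \<phi> f = doubling_conjugacy \<phi> \<circ> f \<circ> inv (doubling_conjugacy \<phi>)"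

definition gs_group :: "(circle \<Rightarrow> circle) \<Rightarrow> (circle \<Rightarrow> circle) set" where
  "gs_group \<phi> = gs_action \<phi> ` thompson_T"


section \<open>Non-expandable points, property \<open>(\<star>)\<close>, Lyapunov expansion exponent\<close>

definition NE :: "(circle \<Rightarrow> circle) set \<Rightarrow> circle set" where
  "NE G = {x. \<forall>g\<in>G. circle_deriv g x \<le> 1}"

definition acts_minimally :: "(circle \<Rightarrow> circle) set \<Rightarrow> bool" where
  "acts_minimally G \<longleftrightarrow> (\<forall>x. closure ((\<lambda>g. g x) ` G) = UNIV)"

definition property_star :: "(circle \<Rightarrow> circle) set \<Rightarrow> bool" where
  "property_star G \<longleftrightarrow> acts_minimally G \<and>
     (\<forall>x\<in>NE G. \<exists>gp\<in>G. \<exists>gm\<in>G. gp x = x \<and> gm x = x \<and>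
        (\<exists>\<epsilon>>0. \<forall>s. 0 < s \<and> s < \<epsilon> \<longrightarrow>
           gp (x + circ s) \<noteq> x + circ s \<and> gm (x - circ s) \<noteq> x - circ s))"

definition word :: "(circle \<Rightarrow> circle) list \<Rightarrow> circle \<Rightarrow> circle" where
  "word ws = foldr (\<circ>) ws id"

definition semigroup_generated :: "(circle \<Rightarrow> circle) set \<Rightarrow> (circle \<Rightarrow> circle) set" where
  "semigroup_generated F = {word ws | ws. ws \<noteq> [] \<and> set ws \<subseteq> F}"

text \<open>The identity is assigned length zero.\<close>

definition word_length :: "(circle \<Rightarrow> circle) set \<Rightarrow> (circle \<Rightarrow> circle) \<Rightarrow> nat" where
  "word_length F g = (LEAST n. \<exists>ws. length ws = n \<and> set ws \<subseteq> F \<and> g = word ws)"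

definition lyapunov_exp :: "(circle \<Rightarrow> circle) set \<Rightarrow> circle \<Rightarrow> ereal" where
  "lyapunov_exp F x =
     limsup (\<lambda>n. ereal (Max {1 / real n * ln (circle_deriv g x) | g.
       g \<in> semigroup_generated F \<and> word_length F g \<le> n}))"

end

theory Submission
  imports Defs
begin

text \<open>
  The point \<open>0\<close> is non-expandable because near \<open>0\<close> every element is a composition
  \<open>\<phi>\<^sup>-\<^sup>k \<circ> \<phi>\<^sup>l\<close>, where \<open>\<phi>\<^sup>l\<close> has derivative \<open>1\<close> at \<open>0\<close> and \<open>\<phi>\<close> never contracts; at any other point
  some element coincides locally with \<open>\<phi>\<close>, which expands there, while at \<open>0\<close> this element has an
  isolated fixed point.

  A word of length \<open>n\<close> in given generators is locally \<open>\<phi>\<^sup>-\<^sup>k \<circ> \<phi>\<^sup>l\<close> with \<open>l \<le> C n\<close>, so the exponent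
  vanishes as soon as \<open>ln (\<phi>\<^sup>n)' = o(n)\<close> almost everywhere. Since \<open>ln \<phi>'\<close> is small near \<open>0\<close>, it
  suffices that the binary digits of the orbit (with respect to the two branches of \<open>\<phi>\<close>) change with
  frequency \<open>0\<close>. The inverse branches that complete a block of equal digits have uniformly bounded
  distortion, so given the past the next block is longer than \<open>k\<close> with probability at least a
  constant times the length of \<open>\<phi>\<^sup>-\<^sup>k [0,1]\<close> for the branch fixing \<open>0\<close>, which is of order at least
  \<open>1/k\<close> because \<open>\<phi>\<close> is \<open>C\<^sup>2\<close>. Hence blocks have infinite conditional mean length, and a Chernoff bound
  with the Borel--Cantelli lemma gives the claim.
\<close>

section \<open>Circle maps and lifts\<close>

text \<open>The obstacle is that no expansion rate is uniform: \<open>\<Phi>' = 1\<close> at the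
  integers, so nothing can be summed as a geometric series over digits. There are three substitutes.
  Inside a block the images of a fundamental domain are disjoint, which bounds their total length.
  From one block to the next the branch acts away from its fixed point and contracts by a fixed
  factor. For the conjugacy, every interval of at least a given length gains a fixed additive
  amount.

  The Chernoff parameter must not depend on the past, so the estimate on block lengths is made for
  all tails with a common harmonic lower bound.

  Group elements are never written with inverse branches. They are described by relations:
  \<open>2 ^ k * F t - 2 ^ l * t \<in> \<int>\<close> on the line, and equality of
  \<open>\<phi> ^^ k\<close> after \<open>g\<close> with \<open>\<phi> ^^ l\<close> on the circle.
  No branch has to be named, and exponents add under composition. Only \<open>l\<close> needs
  control, because the inverse part can only lower the derivative; the lower bound 0 for the
  exponent comes from the identity.\<close>

lemma circ_0 [simp]: "circ 0 = 0"
  by (simp add: zero_circle.abs_eq)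

lemma circ_add: "circ (s + t) = circ s + circ t"
  by (simp add: plus_circle.abs_eq)

lemma circ_diff: "circ (s - t) = circ s - circ t"
  by (simp add: minus_circle.abs_eq)

lemma circ_uminus: "circ (- t) = - circ t"
  by (simp add: uminus_circle.abs_eq)

lemma circ_eq_0_iff: "circ t = 0 \<longleftrightarrow> t \<in> \<int>"
  by (metis circ_0 circ_eq_iff diff_zero)

lemma circ_Ints [simp]: "t \<in> \<int> \<Longrightarrow> circ t = 0"
  by (simp add: circ_eq_0_iff)

lemma circ_eqE:
  assumes "circ s = circ t"
  obtains n :: int where "s = t + n"
  using assms by (metis Ints_cases circ_eq_iff add.commute diff_add_cancel)

lemma circ_representative: "\<exists>t\<in>{0..<1}. x = circ t"
proof -
  obtain t where t: "x = circ t" using circ_surj by blast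
  then have "x = circ (frac t)" by (simp add: circ_eq_iff frac_def)
  then show ?thesis
    by (metis atLeastLessThan_iff frac_ge_0 frac_lt_1)
qed

text \<open>The distance to the nearest integer is attained, so a class near \<open>circ t\<close>
  has a representative equally near \<open>t\<close>. Local statements pass between circle and line
  through this identity.\<close>

lemma nhds_circ: "nhds (circ t) = filtermap circ (nhds t)"
proof (rule antisym)
  show "filtermap circ (nhds t) \<le> nhds (circ t)"
    using continuous_circ[of UNIV]
    by (metis UNIV_I filterlim_def continuous_on_eq_continuous_within isCont_def tendsto_at_iff_tendsto_nhds)
  show "nhds (circ t) \<le> filtermap circ (nhds t)"
  proof (rule filter_leI)
    fix P assume "eventually P (filtermap circ (nhds t))"
    then obtain e where e: "e > 0" "\<And>s. dist s t < e \<Longrightarrow> P (circ s)"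
      by (auto simp: eventually_filtermap eventually_nhds_metric)
    have "P x" if "dist x (circ t) < e" for x
    proof -
      obtain s where s: "x = circ s" using circ_surj by blast
      obtain n where n: "n \<in> \<int>" "infdist (s - t) \<int> = \<bar>s - t - n\<bar>"
        using infdist_Ints_attained by blast
      have "circ s = circ (s - n)" using n by (simp add: circ_eq_iff)
      moreover have "dist (s - n) t < e"
        using that n s by (simp add: dist_circ dist_real_def algebra_simps)
      ultimately show ?thesis using e(2) s by metis
    qed
    then show "eventually P (nhds (circ t))"
      using e(1) unfolding eventually_nhds_metric by blast
  qed
qed

lemma continuous_circle_iff:
  fixes f :: "circle \<Rightarrow> 'a::topological_space"
  shows "continuous_on UNIV f \<longleftrightarrow> continuous_on UNIV (\<lambda>t. f (circ t))"
proof -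
  have "continuous_on UNIV f \<longleftrightarrow> (\<forall>t. isCont f (circ t))"
    by (metis UNIV_I circ_surj continuous_on_eq_continuous_at open_UNIV)
  also have "\<dots> \<longleftrightarrow> (\<forall>t. isCont (\<lambda>t. f (circ t)) t)"
    by (simp add: isCont_def tendsto_at_iff_tendsto_nhds nhds_circ filterlim_filtermap
        tendsto_at_iff_tendsto_nhds[of "\<lambda>t. f (circ t)"])
  finally show ?thesis by (simp add: continuous_on_eq_continuous_at)
qed

section \<open>Circle maps given by equivariant lifts\<close>

definition circle_map :: "(real \<Rightarrow> real) \<Rightarrow> circle \<Rightarrow> circle" where
  "circle_map F x = circ (F (rep_circle x))"

text \<open>The increment \<open>c\<close> is general: 0 for periodic derivatives, 1 for lifts of
  homeomorphisms, 2 for the degree-two lift.\<close>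

lemma equivariant_of_int:
  fixes F :: "real \<Rightarrow> real"
  assumes "\<And>t. F (t + 1) = F t + c"
  shows "F (t + of_int n) = F t + c * of_int n"
proof -
  have nat: "F (t + of_nat n) = F t + c * of_nat n" for t n
  proof (induction n)
    case (Suc n)
    have "F (t + of_nat (Suc n)) = F ((t + of_nat n) + 1)" by (simp add: add_ac)
    then show ?case using Suc by (simp add: assms distrib_left)
  qed simp
  show ?thesis
  proof (cases "n \<ge> 0")
    case True
    then show ?thesis using nat[of t "nat n"] by simp
  next
    case False
    then show ?thesis using nat[of "t + of_int n" "nat (- n)"] by (simp add: algebra_simps)
  qed
qed

text \<open>Equivariance makes the value independent of the representative that
  \<open>rep_circle\<close> happens to pick.\<close>

lemma circle_map_circ:
  assumes "\<And>t. F (t + 1) = F t + 1"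
  shows "circle_map F (circ t) = circ (F t)"
proof -
  obtain n :: int where "rep_circle (circ t) = t + n"
    by (metis Quotient3_abs_rep Quotient3_circle circ_eqE)
  then show ?thesis
    using equivariant_of_int[of F 1 t n] assms
    by (simp add: circle_map_def circ_add)
qed

lemma continuous_strict_mono_surj:
  fixes F :: "real \<Rightarrow> real"
  assumes "strict_mono F" "surj F"
  shows "continuous_on UNIV F"
  using assms by (intro continuous_onI_mono) (auto simp: strict_mono_mono monoD)

lemma circle_map_homeo:
  assumes "strict_mono F" "surj F" and F1: "\<And>t. F (t + 1) = F t + 1"
  shows "orientation_preserving_homeo (circle_map F)" "is_lift F (circle_map F)"
proof -
  have inj: "inj F" using assms(1) by (rule strict_mono_imp_inj_on)
  define G where "G = inv F"
  have FG: "F (G t) = t" "G (F t) = t" for t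
    using assms(2) inj by (simp_all add: G_def surj_f_inv_f inv_f_f)
  have "strict_mono G"
    using assms(1) FG by (metis strict_mono_less strict_monoI)
  moreover have "surj G" by (metis FG(2) surjI)
  ultimately have cG: "continuous_on UNIV G" by (rule continuous_strict_mono_surj)
  have G1: "G (t + 1) = G t + 1" for t by (metis F1 FG)
  have cF: "continuous_on UNIV F" using assms(1,2) by (rule continuous_strict_mono_surj)
  show lift: "is_lift F (circle_map F)"
    using cF circle_map_circ[of F, OF F1] by (simp add: is_lift_def)
  have cm: "circle_map F (circ t) = circ (F t)" "circle_map G (circ t) = circ (G t)" for t
    using circle_map_circ[of F, OF F1] circle_map_circ[of G, OF G1] by blast+
  have "continuous_on UNIV (\<lambda>t. circ (F t))" "continuous_on UNIV (\<lambda>t. circ (G t))"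
    using cF cG continuous_on_compose2[OF continuous_circ[of UNIV]] by blast+
  then have "continuous_on UNIV (circle_map F)" "continuous_on UNIV (circle_map G)"
    by (simp_all add: continuous_circle_iff cm)
  moreover have "circle_map G (circle_map F x) = x" "circle_map F (circle_map G x) = x" for x
    using circ_surj[of x] by (auto simp: cm FG)
  ultimately have "homeomorphism UNIV UNIV (circle_map F) (circle_map G)"
    by (intro homeomorphismI) simp_all
  then show "orientation_preserving_homeo (circle_map F)"
    using lift assms(1) unfolding orientation_preserving_homeo_def by blast
qed

lemma homeo_lift_shift:
  assumes "orientation_preserving_homeo g" "is_lift F g" "strict_mono F"
  shows "F (t + 1) = F t + 1"
proof -
  obtain c where c: "\<And>t. F (t + 1) = F t + c"
    using is_lift_shift_const[OF assms(2) assms(2), of 1] by auto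
  have inj: "inj g"
    using assms(1) by (metis orientation_preserving_homeo_def homeomorphism_apply1 UNIV_I inj_onI)
  have lift: "g (circ t) = circ (F t)" for t using assms(2) by (simp add: is_lift_def)
  have "circ (F 1) = circ (F 0)"
    by (metis lift Ints_1 circ_0 circ_Ints)
  then have "c \<in> \<int>" using c[of 0] by (simp add: circ_eq_iff)
  have "c > 0" using c[of 0] assms(3) by (metis add.commute add_0 less_add_same_cancel1 strict_mono_less zero_less_one)
  \<comment> \<open>With degree above 1 the intermediate value theorem gives an interior point of
    the period with the same image on the circle as 0, against injectivity.\<close>
  moreover have "\<not> c > 1"
  proof
    assume "c > 1"
    moreover have "continuous_on {0..1} F"
      using assms(2) continuous_on_subset by (auto simp: is_lift_def)
    ultimately obtain t where t: "0 \<le> t" "t \<le> 1" "F t = F 0 + 1"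
      using IVT'[of F 0 "F 0 + 1" 1] c[of 0] by auto
    then have "circ t = circ 0"
      using lift[of t] lift[of 0] inj by (metis circ_add circ_Ints Ints_1 add.right_neutral injD)
    then have "t \<in> \<int>" by (simp add: circ_eq_0_iff)
    with t have "t = 0 \<or> t = 1" by (elim Ints_cases) auto
    then show False using t(3) c[of 0] \<open>c > 1\<close> by auto
  qed
  ultimately have "c = 1"
    using \<open>c \<in> \<int>\<close> by (elim Ints_cases) (auto simp flip: of_int_less_iff)
  then show ?thesis using c by simp
qed

lemma surj_equivariant:
  fixes F :: "real \<Rightarrow> real"
  assumes cont: "continuous_on UNIV F" and F1: "\<And>t. F (t + 1) = F t + c" and "c > 0"
  shows "surj F"
proof -
  have "\<exists>t. F t = y" for y
  proof -
    obtain n :: nat where n: "\<bar>y - F 0\<bar> / c < real n" using reals_Archimedean2 by blast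
    then have "\<bar>y - F 0\<bar> < c * n" using \<open>c > 0\<close> by (simp add: field_simps)
    moreover have "F (real n) = F 0 + c * n" "F (- real n) = F 0 - c * n"
      using equivariant_of_int[of F c 0 "int n"] equivariant_of_int[of F c 0 "- int n"] F1 by auto
    ultimately have "F (- real n) \<le> y" "y \<le> F (real n)" by linarith+
    then show ?thesis
      using IVT'[of F "- real n" y "real n"] continuous_on_subset[OF cont, of "{- real n..real n}"]
      by auto
  qed
  then show ?thesis by (metis surjI)
qed

section \<open>Degree-two expanding maps with a parabolic fixed point\<close>

text \<open>The C^2 hypothesis enters as the Lipschitz bound on \<open>ln \<Phi>'\<close>. The
  axioms are closed under the reflection of the line in 0, so the two ends of the unit interval can
  share their estimates.\<close>

locale expanding_lift =
  fixes \<Phi> \<Phi>' :: "real \<Rightarrow> real" and L :: real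
  assumes deriv: "(\<Phi> has_real_derivative \<Phi>' t) (at t)"
    and zero: "\<Phi> 0 = 0"
    and shift: "\<Phi> (t + 1) = \<Phi> t + 2"
    and deriv_0: "\<Phi>' 0 = 1"
    and deriv_gt: "t \<notin> \<int> \<Longrightarrow> 1 < \<Phi>' t"
    and lip: "\<bar>ln (\<Phi>' s) - ln (\<Phi>' t)\<bar> \<le> L * \<bar>s - t\<bar>"
begin

lemma L_nonneg: "0 \<le> L"
  using lip[of 1 0] by simp

lemma deriv_shift: "\<Phi>' (t + 1) = \<Phi>' t"
proof -
  have "((\<lambda>s. \<Phi> (s + 1)) has_real_derivative \<Phi>' (t + 1)) (at t)"
    using deriv[of "t + 1"] by (simp add: DERIV_shift)
  moreover have "((\<lambda>s. \<Phi> (s + 1)) has_real_derivative \<Phi>' t) (at t)"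
    unfolding shift using deriv[of t] by (auto intro!: derivative_eq_intros)
  ultimately show ?thesis by (rule DERIV_unique)
qed

lemma shift_Ints: "n \<in> \<int> \<Longrightarrow> \<Phi> (t + n) = \<Phi> t + 2 * n"
  using equivariant_of_int[of \<Phi> 2] shift by (elim Ints_cases) auto

lemma deriv_shift_Ints: "n \<in> \<int> \<Longrightarrow> \<Phi>' (t + n) = \<Phi>' t"
  using equivariant_of_int[of \<Phi>' 0] deriv_shift by (elim Ints_cases) auto

lemma deriv_Ints: "n \<in> \<int> \<Longrightarrow> \<Phi>' n = 1"
  using deriv_shift_Ints[of n 0] deriv_0 by simp

lemma deriv_ge: "1 \<le> \<Phi>' t"
  using deriv_gt[of t] deriv_Ints[of t] by fastforce

lemma continuous: "continuous_on X \<Phi>"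
  using deriv by (meson DERIV_isCont continuous_at_imp_continuous_on)

lemma continuous_ln_deriv: "continuous_on X (\<lambda>t. ln (\<Phi>' t))"
proof (rule lipschitz_on_continuous_on)
  show "L-lipschitz_on X (\<lambda>t. ln (\<Phi>' t))"
    using lip L_nonneg by (intro lipschitz_onI) (auto simp: dist_real_def)
qed

lemma continuous_deriv: "continuous_on X \<Phi>'"
proof -
  have "continuous_on X (\<lambda>t. exp (ln (\<Phi>' t)))"
    by (intro continuous_intros continuous_ln_deriv)
  moreover have "exp (ln (\<Phi>' t)) = \<Phi>' t" for t
    using deriv_ge[of t] by simp
  ultimately show ?thesis by simp
qed

lemma MVT_lift:
  assumes "s < t"
  obtains \<xi> where "s < \<xi>" "\<xi> < t" "\<Phi> t - \<Phi> s = (t - s) * \<Phi>' \<xi>"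
  using MVT2[OF assms, of \<Phi> \<Phi>'] deriv by blast

lemma nonexpanding_set: "s \<le> t \<Longrightarrow> t - s \<le> \<Phi> t - \<Phi> s"
proof (cases "s = t")
  case False
  moreover assume "s \<le> t"
  ultimately obtain \<xi> where "\<Phi> t - \<Phi> s = (t - s) * \<Phi>' \<xi>"
    using MVT_lift[of s t] by (metis order_less_le)
  then show ?thesis
    using deriv_ge[of \<xi>] \<open>s \<le> t\<close> mult_left_mono[of 1 "\<Phi>' \<xi>" "t - s"] by simp
qed simp

lemma strict: "strict_mono \<Phi>"
proof (rule strict_monoI)
  fix s t :: real assume "s < t"
  then show "\<Phi> s < \<Phi> t" using nonexpanding_set[of s t] by simp
qed

text \<open>The mean value theorem gives strictness only if its intermediate point is not an
  integer. It is therefore applied on a subinterval free of integers, and the rest of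
  \<open>[s, t]\<close> is covered by \<open>nonexpanding_set\<close>.\<close>

lemma expands:
  assumes "s < t"
  shows "t - s < \<Phi> t - \<Phi> s"
proof -
  obtain u where u: "s < u" "u < t" "u \<notin> \<int>"
  proof -
    define w where "w = min t (s + 1)"
    define u where "u = (s + w) / 2"
    define v where "v = (s + u) / 2"
    have "s < w" "w \<le> t" "w \<le> s + 1" using assms by (auto simp: w_def)
    then have "s < v" "v < u" "u < t" "u - v < 1" by (auto simp: u_def v_def field_simps)
    \<comment> \<open>Distinct integers are at least 1 apart, so one of the two points will
      do.\<close>
    moreover have "\<not> (u \<in> \<int> \<and> v \<in> \<int>)"
    proof
      assume "u \<in> \<int> \<and> v \<in> \<int>"
      then have "1 \<le> \<bar>u - v\<bar>"
        using \<open>v < u\<close> by (intro Ints_nonzero_abs_ge1) auto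
      then show False using \<open>v < u\<close> \<open>u - v < 1\<close> by simp
    qed
    ultimately show ?thesis using that by (meson order.strict_trans)
  qed
  \<comment> \<open>No integer lies strictly between \<open>a\<close> and \<open>u\<close>.\<close>
  define a where "a = max s (of_int \<lfloor>u\<rfloor>)"
  have "of_int \<lfloor>u\<rfloor> < u" using u(3) by (metis Ints_of_int floor_le_iff floor_correct order_le_less of_int_floor_le)
  then have a: "s \<le> a" "a < u" "of_int \<lfloor>u\<rfloor> \<le> a" using u by (auto simp: a_def)
  obtain \<xi> where \<xi>: "a < \<xi>" "\<xi> < u" "\<Phi> u - \<Phi> a = (u - a) * \<Phi>' \<xi>"
    using MVT_lift[OF a(2)] by blast
  have "\<xi> \<notin> \<int>"
  proof
    assume "\<xi> \<in> \<int>"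
    then obtain k where "\<xi> = of_int k" by (elim Ints_cases)
    moreover have "of_int \<lfloor>u\<rfloor> < \<xi>" "\<xi> < of_int (\<lfloor>u\<rfloor> + 1)"
      using \<xi>(1,2) a by linarith+
    ultimately show False by (simp only: of_int_less_iff)
  qed
  then have "u - a < \<Phi> u - \<Phi> a"
    using \<xi>(3) a(2) deriv_gt[of \<xi>] by simp
  then show ?thesis using nonexpanding_set[of s a] nonexpanding_set[of u t] a u by simp
qed

lemma surj_lift: "surj \<Phi>"
  using surj_equivariant[OF continuous, of 2] shift by simp

section \<open>The inverse lift\<close>

definition \<Psi> where "\<Psi> = inv \<Phi>"

lemma inverse [simp]: "\<Phi> (\<Psi> t) = t" "\<Psi> (\<Phi> t) = t"
  using surj_lift strict by (simp_all add: \<Psi>_def surj_f_inv_f inv_f_f strict_mono_imp_inj_on)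

lemma strict_inverse: "strict_mono \<Psi>"
  using strict by (metis inverse(1) strict_mono_less strict_monoI)

lemma inverse_shift: "n \<in> \<int> \<Longrightarrow> \<Psi> (t + 2 * n) = \<Psi> t + n"
  by (metis inverse shift_Ints)

lemma inverse_0 [simp]: "\<Psi> 0 = 0"
  by (metis zero inverse(2))

lemma inverse_2 [simp]: "\<Psi> 2 = 1"
  using inverse_shift[of 1 0] by simp

lemma inverse_less_iff [simp]: "\<Psi> s < \<Psi> t \<longleftrightarrow> s < t" "\<Psi> s \<le> \<Psi> t \<longleftrightarrow> s \<le> t"
  using strict_inverse by (simp_all add: strict_mono_less strict_mono_less_eq)

lemma surj_inverse: "surj \<Psi>"
  by (metis inverse(2) surjI)

lemma continuous_inverse: "continuous_on X \<Psi>"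
  using continuous_strict_mono_surj[OF strict_inverse surj_inverse] continuous_on_subset by blast

text \<open>The exponential form turns the chain rule into addition of logarithms, the quantities
  that the distortion estimates compare.\<close>

lemma deriv_inverse: "(\<Psi> has_real_derivative exp (- ln (\<Phi>' (\<Psi> t)))) (at t)"
proof -
  have "(\<Psi> has_real_derivative inverse (\<Phi>' (\<Psi> t))) (at t)"
  proof (rule DERIV_inverse_function[where f = \<Phi> and a = "t - 1" and b = "t + 1"])
    show "(\<Phi> has_real_derivative \<Phi>' (\<Psi> t)) (at (\<Psi> t))" by (rule deriv)
    show "\<Phi>' (\<Psi> t) \<noteq> 0" using deriv_ge[of "\<Psi> t"] by simp
    show "isCont \<Psi> t" using continuous_inverse[of UNIV] by (simp add: continuous_on_eq_continuous_at)
  qed auto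
  then show ?thesis using deriv_ge[of "\<Psi> t"] by (simp add: exp_minus)
qed

lemma nonexpanding_inverse: "\<bar>\<Psi> s - \<Psi> t\<bar> \<le> \<bar>s - t\<bar>"
proof -
  have "\<bar>\<Psi> s - \<Psi> t\<bar> \<le> \<bar>s - t\<bar>" if "t \<le> s" for s t
    using nonexpanding_set[of "\<Psi> t" "\<Psi> s"] that by simp
  then show ?thesis by (metis abs_minus_commute linear)
qed

text \<open>The common endpoint of the domains of the two branches. The interval
  \<open>{mid..1}\<close> is a fundamental domain for \<open>\<Psi>\<close> at its fixed point
  0.\<close>

abbreviation "mid \<equiv> \<Psi> 1"

lemma mid: "0 < mid" "mid < 1"
  using inverse_less_iff(1)[of 0 1] inverse_less_iff(1)[of 1 2] by simp_all

text \<open>Exchanges the two sides of the parabolic point, so estimates for the branch fixing 0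
  carry over to the branch fixing 1.\<close>

lemma reflect: "expanding_lift (\<lambda>t. - \<Phi> (- t)) (\<lambda>t. \<Phi>' (- t)) L"
proof
  fix s t :: real
  show "((\<lambda>t. - \<Phi> (- t)) has_real_derivative \<Phi>' (- t)) (at t)"
    using DERIV_minus[OF deriv[of "- t", unfolded DERIV_mirror]] by simp
  show "- \<Phi> (- (t + 1)) = - \<Phi> (- t) + 2"
    using shift[of "- t - 1"] by simp
  show "1 < \<Phi>' (- t)" if "t \<notin> \<int>" using that by (simp add: deriv_gt)
  show "\<bar>ln (\<Phi>' (- s)) - ln (\<Phi>' (- t))\<bar> \<le> L * \<bar>s - t\<bar>"
    using lip[of "- s" "- t"] by (simp add: abs_minus_commute)
qed (simp_all add: zero deriv_0)

section \<open>Iterates of the branch fixing 0\<close>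

lemma iterate_bounds: "x \<in> {0..1} \<Longrightarrow> (\<Psi> ^^ k) x \<in> {0..1}"
proof (induction k)
  case (Suc k)
  then show ?case
    using inverse_less_iff(2)[of 0] inverse_less_iff(2)[of _ 2] by fastforce
qed simp

lemma iterate_strict_mono: "strict_mono (\<Psi> ^^ k)"
  by (induction k) (auto simp: strict_mono_def)

lemma iterate_fix_0 [simp]: "(\<Psi> ^^ k) 0 = 0"
  by (induction k) auto

lemma deriv_iterate:
  "((\<Psi> ^^ k) has_real_derivative exp (- (\<Sum>j=1..k. ln (\<Phi>' ((\<Psi> ^^ j) x))))) (at x)"
proof (induction k)
  case (Suc k)
  show ?case
    using DERIV_chain2[OF deriv_inverse Suc]
    by (simp add: exp_add[symmetric] add_ac)
qed (simp add: id_def)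

text \<open>The cylinder of \<open>k\<close> digits 0 is \<open>{0..u k}\<close>, so
  \<open>u k\<close> is its length.\<close>

abbreviation "u k \<equiv> (\<Psi> ^^ k) 1"

lemma u_pos: "0 < u k"
  using iterate_strict_mono[of k] by (metis iterate_fix_0 strict_mono_less zero_less_one)

lemma u_Suc: "u (Suc k) = (\<Psi> ^^ k) mid"
  by (simp add: funpow_swap1)

lemma u_decreasing: "u (Suc k) < u k"
  using mid iterate_strict_mono[of k] by (metis u_Suc strict_mono_less)

text \<open>From \<open>\<Phi> s \<le> s e\<^sup>L\<^sup>s\<close> the reciprocals \<open>1 / u k\<close> grow at most linearly. This is where the
  Lipschitz condition on the derivative enters: the lengths \<open>u k\<close> are not summable.\<close>

lemma u_lower: "1 / (1 + L * k) \<le> u k"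
proof -
  have "1 / u k \<le> 1 + L * k"
  proof (induction k)
    case (Suc k)
    define s where "s = u (Suc k)"
    have s: "0 < s" "\<Phi> s = u k" using u_pos[of "Suc k"] by (simp_all add: s_def)
    obtain \<xi> where \<xi>: "0 < \<xi>" "\<xi> < s" "\<Phi> s = s * \<Phi>' \<xi>"
      using MVT_lift[OF s(1)] by (auto simp: zero)
    have "ln (\<Phi>' \<xi>) \<le> L * s"
      using lip[of \<xi> 0] \<xi> L_nonneg mult_left_mono[of \<xi> s L] by (simp add: deriv_0)
    moreover have "\<Phi>' \<xi> > 0" using deriv_ge[of \<xi>] by simp
    moreover have "1 - inverse (\<Phi>' \<xi>) \<le> ln (\<Phi>' \<xi>)"
      using ln_le_minus_one[of "inverse (\<Phi>' \<xi>)"] \<open>\<Phi>' \<xi> > 0\<close> by (simp add: ln_inverse)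
    ultimately have "1 / \<Phi>' \<xi> \<ge> 1 - L * s" by (simp add: inverse_eq_divide)
    then have "1 / u k \<ge> (1 - L * s) / s"
      using s \<xi>(3) by (metis divide_divide_eq_left divide_right_mono less_imp_le mult.commute)
    then have "1 / s \<le> 1 / u k + L" using s(1) by (simp add: field_simps)
    then show ?case using Suc by (simp add: s_def distrib_left)
  qed simp
  then show ?thesis using u_pos[of k] L_nonneg by (simp add: field_simps add_pos_nonneg)
qed

text \<open>The limit of this decreasing sequence is fixed by \<open>\<Psi>\<close>, hence by
  \<open>\<Phi>\<close>, and strict expansion from 0 excludes a positive fixed point.\<close>

lemma u_tendsto_0: "u \<longlonglongrightarrow> 0"
proof -
  have "decseq u" using u_decreasing by (intro decseq_SucI less_imp_le)
  then obtain a where a: "u \<longlonglongrightarrow> a" "0 \<le> a"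
    using decseq_convergent[of u 0] u_pos by (metis LIMSEQ_le_const less_imp_le)
  have "(\<lambda>k. \<Psi> (u k)) \<longlonglongrightarrow> \<Psi> a"
    using continuous_inverse[of UNIV] a(1) by (metis UNIV_I continuous_on_eq_continuous_at open_UNIV isCont_tendsto_compose)
  then have "(\<lambda>k. u (Suc k)) \<longlonglongrightarrow> \<Psi> a" by simp
  then have "\<Psi> a = a" using LIMSEQ_unique LIMSEQ_Suc[OF a(1)] by blast
  then have "\<Phi> a = a" by (metis inverse(1))
  then have "a = 0" using expands[of 0 a] a(2) zero by fastforce
  then show ?thesis using a(1) by simp
qed

lemma iterate_MVT:
  assumes "x < y"
  obtains \<xi> where "x < \<xi>" "\<xi> < y"
    "(\<Psi> ^^ k) y - (\<Psi> ^^ k) x = (y - x) * exp (- (\<Sum>j=1..k. ln (\<Phi>' ((\<Psi> ^^ j) \<xi>))))"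
proof -
  have "\<exists>z>x. z < y \<and> (\<Psi> ^^ k) y - (\<Psi> ^^ k) x = (y - x) * exp (- (\<Sum>j=1..k. ln (\<Phi>' ((\<Psi> ^^ j) z))))"
    by (rule MVT2[OF assms]) (rule deriv_iterate)
  then show ?thesis using that by blast
qed

lemma fundamental_domain_le:
  assumes "x \<in> {mid..1}" "y \<in> {mid..1}"
  shows "\<bar>(\<Psi> ^^ k) x - (\<Psi> ^^ k) y\<bar> \<le> u k - u (Suc k)"
proof -
  have m: "mono (\<Psi> ^^ k)" by (simp add: iterate_strict_mono strict_mono_mono)
  have "(\<Psi> ^^ k) z \<in> {u (Suc k)..u k}" if "z \<in> {mid..1}" for z
    using that monoD[OF m, of mid z] monoD[OF m, of z 1] unfolding u_Suc by simp
  from this[OF assms(1)] this[OF assms(2)] show ?thesis by (auto simp del: funpow.simps)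
qed

text \<open>The images of the fundamental domain \<open>{mid..1}\<close> are disjoint, so their total length is at most
  1; this bounds the distortion of each iterate, which in turn gives the bound by \<open>\<bar>x - y\<bar>\<close>.\<close>

lemma fundamental_domain_sum:
  assumes "x \<in> {mid..1}" "y \<in> {mid..1}"
  shows "(\<Sum>j=1..k. \<bar>(\<Psi> ^^ j) x - (\<Psi> ^^ j) y\<bar>) \<le> exp L / (1 - mid) * \<bar>x - y\<bar>"
proof -
  define Q where "Q k x = (\<Sum>j=1..k. ln (\<Phi>' ((\<Psi> ^^ j) x)))" for k x
  have tele: "(\<Sum>j=1..k. u j - u (Suc j)) \<le> 1" for k
  proof -
    have "(\<Sum>j=1..k. u j - u (Suc j)) = u 1 - u (Suc k)"
      by (induction k) simp_all
    then show ?thesis using u_pos[of "Suc k"] u_decreasing[of 0] by simp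
  qed
  have Q: "Q k x - Q k y \<le> L" if "x \<in> {mid..1}" "y \<in> {mid..1}" for k x y
  proof -
    have "Q k x - Q k y = (\<Sum>j=1..k. ln (\<Phi>' ((\<Psi> ^^ j) x)) - ln (\<Phi>' ((\<Psi> ^^ j) y)))"
      by (simp add: Q_def sum_subtractf)
    also have "\<dots> \<le> (\<Sum>j=1..k. L * (u j - u (Suc j)))"
    proof (rule sum_mono)
      fix j
      show "ln (\<Phi>' ((\<Psi> ^^ j) x)) - ln (\<Phi>' ((\<Psi> ^^ j) y)) \<le> L * (u j - u (Suc j))"
        using lip[of "(\<Psi> ^^ j) x" "(\<Psi> ^^ j) y"] fundamental_domain_le[OF that, of j] L_nonneg
          mult_left_mono by (smt (verit))
    qed
    also have "\<dots> = L * (\<Sum>j=1..k. u j - u (Suc j))" by (simp add: sum_distrib_left)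
    also have "\<dots> \<le> L" using tele[of k] L_nonneg mult_left_mono[of _ 1 L] by fastforce
    finally show ?thesis .
  qed
  \<comment> \<open>The image of all of \<open>{mid..1}\<close> has length
    \<open>u j - u (Suc j)\<close>. By bounded distortion the image of \<open>[x, y]\<close> takes
    up a proportional share of it.\<close>
  have step: "(\<Psi> ^^ j) y - (\<Psi> ^^ j) x \<le> exp L / (1 - mid) * (y - x) * (u j - u (Suc j))"
    if xy: "x \<in> {mid..1}" "y \<in> {mid..1}" "x < y" for j x y
  proof -
    obtain \<xi> where \<xi>: "x < \<xi>" "\<xi> < y" "(\<Psi> ^^ j) y - (\<Psi> ^^ j) x = (y - x) * exp (- Q j \<xi>)"
      using iterate_MVT[OF xy(3)] unfolding Q_def by blast
    obtain \<eta> where \<eta>: "mid < \<eta>" "\<eta> < 1" "u j - u (Suc j) = (1 - mid) * exp (- Q j \<eta>)"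
      using iterate_MVT[OF mid(2)] unfolding Q_def u_Suc by blast
    have "exp (- Q j \<xi>) \<le> exp L * exp (- Q j \<eta>)"
      using Q[of \<eta> \<xi> j] \<xi> \<eta> xy by (simp flip: exp_add)
    then have "(y - x) * exp (- Q j \<xi>) \<le> (y - x) * (exp L * exp (- Q j \<eta>))"
      using xy by (intro mult_left_mono) auto
    then show ?thesis unfolding \<xi>(3) \<eta>(3) using mid(2) by (simp add: mult_ac)
  qed
  have abs_step: "\<bar>(\<Psi> ^^ j) x - (\<Psi> ^^ j) y\<bar> \<le> exp L / (1 - mid) * \<bar>x - y\<bar> * (u j - u (Suc j))" for j
  proof -
    consider "x < y" | "y < x" | "x = y" by linarith
    then show ?thesis
    proof cases
      case 1
      then have "(\<Psi> ^^ j) x < (\<Psi> ^^ j) y" using iterate_strict_mono by (simp add: strict_mono_less)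
      then show ?thesis using step[OF assms 1, of j] 1 by (simp del: funpow.simps)
    next
      case 2
      then have "(\<Psi> ^^ j) y < (\<Psi> ^^ j) x" using iterate_strict_mono by (simp add: strict_mono_less)
      then show ?thesis using step[OF assms(2,1) 2, of j] 2 by (simp del: funpow.simps)
    qed simp
  qed
  have "(\<Sum>j=1..k. \<bar>(\<Psi> ^^ j) x - (\<Psi> ^^ j) y\<bar>)
      \<le> (\<Sum>j=1..k. exp L / (1 - mid) * \<bar>x - y\<bar> * (u j - u (Suc j)))"
    by (intro sum_mono abs_step)
  also have "\<dots> = exp L / (1 - mid) * \<bar>x - y\<bar> * (\<Sum>j=1..k. u j - u (Suc j))"
    by (simp add: sum_distrib_left del: funpow.simps)
  also have "\<dots> \<le> exp L / (1 - mid) * \<bar>x - y\<bar>"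
    using tele[of k] mid by (intro mult_left_le) auto
  finally show ?thesis .
qed

end

section \<open>Distortion of inverse branches\<close>

context expanding_lift
begin

text \<open>For \<open>d\<close> equal to 0 or 1 these are the inverse branches on the unit
  interval, and \<open>d\<close> is also their fixed point. Digits are reals, so that they can be
  added to points and the other digit is \<open>1 - d\<close>.\<close>

definition \<psi> :: "real \<Rightarrow> real \<Rightarrow> real" where
  "\<psi> d x = \<Psi> (x + d)"

definition half :: "real \<Rightarrow> real set" where
  "half d = {\<Psi> d..\<Psi> (d + 1)}"

lemma \<psi>_0_iterate: "(\<psi> 0 ^^ k) x = (\<Psi> ^^ k) x"
  by (induction k) (simp_all add: \<psi>_def)

lemma strict_branch: "strict_mono (\<psi> d)"
  by (simp add: strict_mono_def \<psi>_def)

lemma strict_branch_iterate: "strict_mono (\<psi> d ^^ k)"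
  using strict_branch[of d] by (induction k) (auto simp: strict_mono_def)

lemma branch_less_iff [simp]:
  "(\<psi> d ^^ k) x < (\<psi> d ^^ k) y \<longleftrightarrow> x < y" "(\<psi> d ^^ k) x \<le> (\<psi> d ^^ k) y \<longleftrightarrow> x \<le> y"
  using strict_branch_iterate[where d = d and k = k] by (simp_all add: strict_mono_less strict_mono_less_eq)

lemma branch_in_half: "x \<in> {0..1} \<Longrightarrow> \<psi> d x \<in> half d"
  by (simp add: \<psi>_def half_def)

lemma half_subset: "d \<in> {0, 1} \<Longrightarrow> half d \<subseteq> {0..1}"
  using mid by (auto simp: half_def)

lemma branch_iterate_unit: "d \<in> {0, 1} \<Longrightarrow> x \<in> {0..1} \<Longrightarrow> (\<psi> d ^^ k) x \<in> {0..1}"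
proof (induction k)
  case (Suc k)
  then show ?case using branch_in_half[of "(\<psi> d ^^ k) x" d] half_subset[of d] by (auto simp del: insert_iff)
qed simp

lemma branch_iterate_in_half:
  assumes "d \<in> {0, 1}" "x \<in> {0..1}" "1 \<le> k"
  shows "(\<psi> d ^^ k) x \<in> half d"
proof -
  obtain k' where "k = Suc k'" using assms(3) by (cases k) auto
  then show ?thesis using branch_in_half[OF branch_iterate_unit[OF assms(1,2)]] by simp
qed

lemma nonexpanding_branch_iterate: "\<bar>(\<psi> d ^^ k) x - (\<psi> d ^^ k) y\<bar> \<le> \<bar>x - y\<bar>"
proof (induction k)
  case (Suc k)
  have "\<bar>\<psi> d s - \<psi> d t\<bar> \<le> \<bar>s - t\<bar>" for s t
    using nonexpanding_inverse[of "s + d" "t + d"] by (simp add: \<psi>_def)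
  from this[of "(\<psi> d ^^ k) x" "(\<psi> d ^^ k) y"] show ?case using Suc by simp
qed simp

lemma deriv_branch_iterate:
  "((\<psi> d ^^ k) has_real_derivative exp (- (\<Sum>j=1..k. ln (\<Phi>' ((\<psi> d ^^ j) x))))) (at x)"
proof (induction k)
  case (Suc k)
  have "(\<psi> d has_real_derivative exp (- ln (\<Phi>' (\<psi> d y)))) (at y)" for y
    using deriv_inverse[of "y + d"] unfolding \<psi>_def by (simp add: DERIV_shift)
  from DERIV_chain2[OF this Suc] show ?case
    by (simp add: exp_add[symmetric] add_ac)
qed (simp add: id_def)

lemma ln_deriv_nonneg: "0 \<le> ln (\<Phi>' t)"
  using deriv_ge[of t] by simp

lemma ln_deriv_Ints: "d \<in> \<int> \<Longrightarrow> ln (\<Phi>' t) \<le> L * \<bar>t - d\<bar>"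
  using lip[of t d] deriv_Ints by simp

lemma ln_deriv_le: "ln (\<Phi>' t) \<le> L"
proof -
  have "ln (\<Phi>' t) \<le> L * \<bar>t - of_int \<lfloor>t\<rfloor>\<bar>" by (rule ln_deriv_Ints) simp
  also have "\<dots> \<le> L * 1" using L_nonneg by (intro mult_left_mono) linarith+
  finally show ?thesis by simp
qed

text \<open>Seen from its fixed point 1, the second branch is the first branch of the reflected
  map.\<close>

lemma \<psi>_1_iterate:
  "(\<psi> 1 ^^ k) x = 1 - (expanding_lift.\<Psi> (\<lambda>t. - \<Phi> (- t)) ^^ k) (1 - x)"
proof (induction k)
  case (Suc k)
  interpret R: expanding_lift "\<lambda>t. - \<Phi> (- t)" "\<lambda>t. \<Phi>' (- t)" L by (rule reflect)
  have R: "R.\<Psi> t = - \<Psi> (- t)" for t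
    by (metis R.inverse(2) inverse(1) add.inverse_inverse)
  have "\<psi> 1 (1 - z) = 1 - R.\<Psi> z" for z
    using inverse_shift[of 1 "- z"] by (simp add: R \<psi>_def)
  then show ?case using Suc by simp
qed simp

lemma cylinder_length_lower:
  assumes "d \<in> {0, 1}"
  shows "1 / (1 + L * k) \<le> (\<psi> d ^^ k) 1 - (\<psi> d ^^ k) 0"
proof -
  interpret R: expanding_lift "\<lambda>t. - \<Phi> (- t)" "\<lambda>t. \<Phi>' (- t)" L by (rule reflect)
  show ?thesis using assms u_lower[of k] R.u_lower[of k]
    by (auto simp: \<psi>_0_iterate \<psi>_1_iterate simp del: One_nat_def)
qed

text \<open>The \<open>j\<close>-th iterate moves the whole unit interval to within
  \<open>max (u j) (R.u j)\<close> of the fixed point \<open>d\<close>, where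
  \<open>ln \<Phi>'\<close> vanishes. Hence the bound is uniform in \<open>y\<close>, and points
  deep inside a block cost little.\<close>

lemma branch_ln_deriv_small:
  assumes "\<epsilon> > 0"
  shows "\<exists>J. \<forall>j\<ge>J. \<forall>d\<in>{0, 1}. \<forall>y\<in>{0..1}. ln (\<Phi>' ((\<psi> d ^^ j) y)) \<le> \<epsilon>"
proof -
  interpret R: expanding_lift "\<lambda>t. - \<Phi> (- t)" "\<lambda>t. \<Phi>' (- t)" L by (rule reflect)
  have "(\<lambda>k. L * max (u k) (R.u k)) \<longlonglongrightarrow> L * max 0 0"
    by (intro tendsto_intros u_tendsto_0 R.u_tendsto_0)
  then have "eventually (\<lambda>k. L * max (u k) (R.u k) < \<epsilon>) sequentially"
    using assms by (intro order_tendstoD) auto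
  then obtain J where J: "\<And>j. j \<ge> J \<Longrightarrow> L * max (u j) (R.u j) < \<epsilon>"
    by (auto simp: eventually_sequentially)
  have "ln (\<Phi>' ((\<psi> d ^^ j) y)) \<le> \<epsilon>" if "J \<le> j" "d \<in> {0, 1}" "y \<in> {0..1}" for j d y
  proof -
    have m: "(\<Psi> ^^ j) y \<le> u j" "(R.\<Psi> ^^ j) (1 - y) \<le> R.u j"
      using that(3) iterate_strict_mono[of j] R.iterate_strict_mono[of j]
      by (simp_all add: strict_mono_less_eq)
    have z: "0 \<le> (\<Psi> ^^ j) y" "0 \<le> (R.\<Psi> ^^ j) (1 - y)"
      using iterate_bounds[of y j] R.iterate_bounds[of "1 - y" j] that(3) by auto
    have "\<bar>(\<psi> d ^^ j) y - d\<bar> \<le> max (u j) (R.u j)"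
      using that(2) m z by (auto simp: \<psi>_0_iterate \<psi>_1_iterate)
    then have "L * \<bar>(\<psi> d ^^ j) y - d\<bar> \<le> L * max (u j) (R.u j)"
      using L_nonneg by (rule mult_left_mono)
    moreover have "ln (\<Phi>' ((\<psi> d ^^ j) y)) \<le> L * \<bar>(\<psi> d ^^ j) y - d\<bar>"
      using that(2) by (intro ln_deriv_Ints) auto
    ultimately show ?thesis using J[OF that(1)] by linarith
  qed
  then show ?thesis by blast
qed

text \<open>\<open>half (1 - d)\<close> is a fundamental domain for the branch fixing
  \<open>d\<close>. \<open>B\<close> adds the constants of the map and of its reflection, so that it
  serves both digits and every block length.\<close>

lemma block_sum:
  "\<exists>B\<ge>0. \<forall>d\<in>{0, 1}. \<forall>x\<in>half (1 - d). \<forall>y\<in>half (1 - d). \<forall>k.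
     (\<Sum>j=1..k. \<bar>(\<psi> d ^^ j) x - (\<psi> d ^^ j) y\<bar>) \<le> B * \<bar>x - y\<bar>"
proof -
  interpret R: expanding_lift "\<lambda>t. - \<Phi> (- t)" "\<lambda>t. \<Phi>' (- t)" L by (rule reflect)
  define B where "B = exp L / (1 - mid) + exp L / (1 - R.mid)"
  have B: "0 \<le> exp L / (1 - mid)" "0 \<le> exp L / (1 - R.mid)"
    using mid R.mid by simp_all
  have "(\<Sum>j=1..k. \<bar>(\<psi> d ^^ j) x - (\<psi> d ^^ j) y\<bar>) \<le> B * \<bar>x - y\<bar>"
    if "d \<in> {0, 1}" "x \<in> half (1 - d)" "y \<in> half (1 - d)" for d x y k
  proof -
    from that(1) consider "d = 0" | "d = 1" by auto
    then show ?thesis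
    proof cases
      case 1
      then have "(\<Sum>j=1..k. \<bar>(\<psi> d ^^ j) x - (\<psi> d ^^ j) y\<bar>) \<le> exp L / (1 - mid) * \<bar>x - y\<bar>"
        using fundamental_domain_sum[of x y k] that by (simp add: half_def \<psi>_0_iterate)
      also have "\<dots> \<le> B * \<bar>x - y\<bar>" using B by (intro mult_right_mono) (auto simp: B_def)
      finally show ?thesis .
    next
      case 2
      have mid: "R.mid = 1 - mid"
        using \<psi>_1_iterate[of 1 0] by (simp add: \<psi>_def)
      then have "(\<Sum>j=1..k. \<bar>(R.\<Psi> ^^ j) (1 - x) - (R.\<Psi> ^^ j) (1 - y)\<bar>) \<le> exp L / (1 - R.mid) * \<bar>(1 - x) - (1 - y)\<bar>"
        using that 2 by (intro R.fundamental_domain_sum) (auto simp: half_def)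
      then have "(\<Sum>j=1..k. \<bar>(\<psi> d ^^ j) x - (\<psi> d ^^ j) y\<bar>) \<le> exp L / (1 - R.mid) * \<bar>x - y\<bar>"
        using 2 by (simp add: \<psi>_1_iterate abs_minus_commute)
      also have "\<dots> \<le> B * \<bar>x - y\<bar>" using B by (intro mult_right_mono) (auto simp: B_def)
      finally show ?thesis .
    qed
  qed
  then show ?thesis using B by (intro exI[of _ B]) (auto simp: B_def)
qed

text \<open>At a change of digit both branches take values in the compact interval \<open>K\<close>,
  which stays away from 0 and 1. The minimum of \<open>\<Phi>'\<close> on \<open>K\<close> exceeds
  1, and \<open>q\<close> is its reciprocal.\<close>

lemma block_contraction:
  "\<exists>q. 0 \<le> q \<and> q < 1 \<and> (\<forall>d\<in>{0, 1}. \<forall>x\<in>half (1 - d). \<forall>y\<in>half (1 - d). \<bar>\<psi> d x - \<psi> d y\<bar> \<le> q * \<bar>x - y\<bar>)"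
proof -
  define K where "K = {\<Psi> mid..\<Psi> (mid + 1)}"
  have "mid \<in> K" using mid by (simp add: K_def)
  obtain z where z: "z \<in> K" "\<And>x. x \<in> K \<Longrightarrow> \<Phi>' z \<le> \<Phi>' x"
    using continuous_attains_inf[of K \<Phi>'] continuous_deriv \<open>mid \<in> K\<close> by (auto simp: K_def)
  have "0 < z" "z < 1"
    using z(1) mid inverse_less_iff(1)[of 0 mid] inverse_less_iff(1)[of "mid + 1" 2] by (auto simp: K_def)
  then have "z \<notin> \<int>" by (auto elim!: Ints_cases)
  then have l: "1 < \<Phi>' z" by (rule deriv_gt)
  have *: "\<psi> d y - \<psi> d x \<le> (1 / \<Phi>' z) * (y - x)"
    if "d \<in> {0, 1}" "x \<in> half (1 - d)" "y \<in> half (1 - d)" "x < y" for d x y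
  proof -
    have "\<psi> d x < \<psi> d y" using that(4) by (simp add: \<psi>_def)
    then obtain \<xi> where \<xi>: "\<psi> d x < \<xi>" "\<xi> < \<psi> d y" "\<Phi> (\<psi> d y) - \<Phi> (\<psi> d x) = (\<psi> d y - \<psi> d x) * \<Phi>' \<xi>"
      using MVT_lift by blast
    have "\<Psi> mid \<le> \<psi> d x" "\<psi> d y \<le> \<Psi> (mid + 1)"
      using that mid by (auto simp: \<psi>_def half_def)
    then have "\<xi> \<in> K" using \<xi> by (auto simp: K_def)
    then have "(\<psi> d y - \<psi> d x) * \<Phi>' z \<le> (\<psi> d y - \<psi> d x) * \<Phi>' \<xi>"
      using z(2) \<open>\<psi> d x < \<psi> d y\<close> by (intro mult_left_mono) auto
    then have "(\<psi> d y - \<psi> d x) * \<Phi>' z \<le> y - x" using \<xi>(3) by (simp add: \<psi>_def)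
    then show ?thesis using l by (simp add: field_simps)
  qed
  have "\<bar>\<psi> d x - \<psi> d y\<bar> \<le> (1 / \<Phi>' z) * \<bar>x - y\<bar>"
    if "d \<in> {0, 1}" "x \<in> half (1 - d)" "y \<in> half (1 - d)" for d x y
  proof -
    consider "x < y" | "y < x" | "x = y" by linarith
    then show ?thesis
    proof cases
      case 1
      then have "\<psi> d x < \<psi> d y" by (simp add: \<psi>_def)
      then show ?thesis using *[OF that 1] 1 by simp
    next
      case 2
      then have "\<psi> d y < \<psi> d x" by (simp add: \<psi>_def)
      then show ?thesis using *[OF that(1,3,2) 2] 2 by simp
    qed simp
  qed
  then show ?thesis using l by (intro exI[of _ "1 / \<Phi>' z"]) auto
qed

text \<open>The inverse branches \<open>\<psi>\<^bsub>d\<^sub>1\<^esub> \<circ> \<dots> \<circ> \<psi>\<^bsub>d\<^sub>n\<^esub>\<close>, to be applied to points of \<open>half d\<close> with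
  \<open>d \<noteq> d\<^sub>n\<close>, so that a block of equal digits is completed.\<close>

inductive branch :: "real \<Rightarrow> (real \<Rightarrow> real) \<Rightarrow> bool" where
  branch_id: "d \<in> {0, 1} \<Longrightarrow> branch d id"
| branch_block: "branch d f \<Longrightarrow> 1 \<le> k \<Longrightarrow> branch (1 - d) (f \<circ> (\<psi> d ^^ k))"

lemma branch_digit: "branch d f \<Longrightarrow> d \<in> {0, 1}"
  by (induction rule: branch.induct) auto

text \<open>The induction runs over blocks, not digits, because a single digit need not contract.
  The new block adds a bounded multiple of \<open>\<bar>x - y\<bar>\<close> to the variation of the
  log-derivative, while the earlier ones see the distance shrunk by \<open>q\<close>.\<close>

lemma distortion:
  "\<exists>M\<ge>0. \<forall>d f. branch d f \<longrightarrow>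
     (\<exists>g. (\<forall>x. (f has_real_derivative exp (g x)) (at x)) \<and> (\<forall>x\<in>half d. \<forall>y\<in>half d. \<bar>g x - g y\<bar> \<le> M * \<bar>x - y\<bar>))"
proof -
  obtain B where B: "B \<ge> 0" "\<And>d x y k. d \<in> {0, 1} \<Longrightarrow> x \<in> half (1 - d) \<Longrightarrow> y \<in> half (1 - d) \<Longrightarrow>
     (\<Sum>j=1..k. \<bar>(\<psi> d ^^ j) x - (\<psi> d ^^ j) y\<bar>) \<le> B * \<bar>x - y\<bar>"
    using block_sum by meson
  obtain q where q: "0 \<le> q" "q < 1" "\<And>d x y. d \<in> {0, 1} \<Longrightarrow> x \<in> half (1 - d) \<Longrightarrow> y \<in> half (1 - d) \<Longrightarrow>
     \<bar>\<psi> d x - \<psi> d y\<bar> \<le> q * \<bar>x - y\<bar>"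
    using block_contraction by meson
  \<comment> \<open>The fixed point of \<open>M \<mapsto> M * q + L * B\<close>, the effect of one
    more block on the constant.\<close>
  define M where "M = L * B / (1 - q)"
  have M: "0 \<le> M" "M * q + L * B = M"
    using q B(1) L_nonneg by (simp_all add: M_def field_simps)
  have "\<exists>g. (\<forall>x. (f has_real_derivative exp (g x)) (at x)) \<and> (\<forall>x\<in>half d. \<forall>y\<in>half d. \<bar>g x - g y\<bar> \<le> M * \<bar>x - y\<bar>)"
    if "branch d f" for d f
    using that
  proof (induction rule: branch.induct)
    case (branch_id d)
    show ?case using M by (intro exI[of _ "\<lambda>_. 0"]) (simp add: id_def)
  next
    case (branch_block d f k)
    then obtain g where g: "\<And>x. (f has_real_derivative exp (g x)) (at x)"
      "\<And>x y. x \<in> half d \<Longrightarrow> y \<in> half d \<Longrightarrow> \<bar>g x - g y\<bar> \<le> M * \<bar>x - y\<bar>" by blast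
    have d: "d \<in> {0, 1}" using branch_block(1) by (rule branch_digit)
    define s where "s x = (\<Sum>j=1..k. ln (\<Phi>' ((\<psi> d ^^ j) x)))" for x
    define g' where "g' x = g ((\<psi> d ^^ k) x) - s x" for x
    have "((f \<circ> (\<psi> d ^^ k)) has_real_derivative exp (g' x)) (at x)" for x
      using DERIV_chain2[OF g(1) deriv_branch_iterate] by (simp add: o_def g'_def s_def exp_diff exp_minus field_simps)
    moreover have "\<bar>g' x - g' y\<bar> \<le> M * \<bar>x - y\<bar>" if xy: "x \<in> half (1 - d)" "y \<in> half (1 - d)" for x y
    proof -
      have "1 - d \<in> {0, 1}" using d by auto
      then have unit: "x \<in> {0..1}" "y \<in> {0..1}" using xy half_subset by blast+
      \<comment> \<open>The first of the \<open>k\<close> applications is the contracting one; the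
        other \<open>k - 1\<close> do not expand.\<close>
      have "\<bar>(\<psi> d ^^ k) x - (\<psi> d ^^ k) y\<bar> \<le> \<bar>\<psi> d x - \<psi> d y\<bar>"
        using nonexpanding_branch_iterate[where d = d and k = "k - 1" and x = "\<psi> d x" and y = "\<psi> d y"] branch_block(2)
        by (cases k) (simp_all add: funpow_swap1)
      also have "\<dots> \<le> q * \<bar>x - y\<bar>" using q(3)[OF d xy] .
      finally have 1: "\<bar>g ((\<psi> d ^^ k) x) - g ((\<psi> d ^^ k) y)\<bar> \<le> M * (q * \<bar>x - y\<bar>)"
        using g(2)[of "(\<psi> d ^^ k) x" "(\<psi> d ^^ k) y"] branch_iterate_in_half[OF d _ branch_block(2)] unit M(1)
        by (meson mult_left_mono order_trans)
      have "\<bar>s x - s y\<bar> = \<bar>\<Sum>j=1..k. ln (\<Phi>' ((\<psi> d ^^ j) x)) - ln (\<Phi>' ((\<psi> d ^^ j) y))\<bar>"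
        by (simp add: s_def sum_subtractf)
      also have "\<dots> \<le> (\<Sum>j=1..k. L * \<bar>(\<psi> d ^^ j) x - (\<psi> d ^^ j) y\<bar>)"
        by (rule order_trans[OF sum_abs sum_mono]) (rule lip)
      also have "\<dots> = L * (\<Sum>j=1..k. \<bar>(\<psi> d ^^ j) x - (\<psi> d ^^ j) y\<bar>)"
        by (simp add: sum_distrib_left)
      also have "\<dots> \<le> L * (B * \<bar>x - y\<bar>)"
        using B(2)[OF d xy] L_nonneg by (intro mult_left_mono)
      finally have "\<bar>g' x - g' y\<bar> \<le> M * (q * \<bar>x - y\<bar>) + L * (B * \<bar>x - y\<bar>)"
        using 1 by (simp add: g'_def)
      also have "\<dots> = (M * q + L * B) * \<bar>x - y\<bar>" by (simp add: algebra_simps)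
      finally show ?thesis by (simp add: M)
    qed
    ultimately show ?case by blast
  qed
  then show ?thesis using M(1) by blast
qed

text \<open>For \<open>branch d f\<close> this is the measure of the points with the past coded by
  \<open>f\<close> whose next block has at least \<open>k\<close> digits \<open>d\<close>.\<close>

definition cyl :: "(real \<Rightarrow> real) \<Rightarrow> real \<Rightarrow> nat \<Rightarrow> real" where
  "cyl f d k = f ((\<psi> d ^^ k) 1) - f ((\<psi> d ^^ k) 0)"

text \<open>By the mean value theorem each side is the length of a cylinder times a value of the
  derivative of \<open>f\<close> on \<open>half d\<close>, and two such values differ at most by the
  factor \<open>exp M\<close>. Given the past, the tail of the block length is thus at least of
  order \<open>1 / k\<close>, which is not summable.\<close>

lemma cyl_lower:
  "\<exists>\<kappa>>0. \<forall>d f k. branch d f \<longrightarrow> 1 \<le> k \<longrightarrow> \<kappa> / (1 + L * k) * cyl f d 1 \<le> cyl f d k"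
proof -
  obtain M where M: "M \<ge> 0" "\<And>d f. branch d f \<Longrightarrow>
     (\<exists>g. (\<forall>x. (f has_real_derivative exp (g x)) (at x)) \<and> (\<forall>x\<in>half d. \<forall>y\<in>half d. \<bar>g x - g y\<bar> \<le> M * \<bar>x - y\<bar>))"
    using distortion by blast
  have "exp (- M) / (1 + L * k) * cyl f d 1 \<le> cyl f d k" if br: "branch d f" and k: "1 \<le> k" for d f k
  proof -
    have d: "d \<in> {0, 1}" using br by (rule branch_digit)
    obtain g where g: "\<And>x. (f has_real_derivative exp (g x)) (at x)"
      "\<And>x y. x \<in> half d \<Longrightarrow> y \<in> half d \<Longrightarrow> \<bar>g x - g y\<bar> \<le> M * \<bar>x - y\<bar>"
      using M(2)[OF br] by blast
    have mv: "\<exists>\<xi>\<in>half d. cyl f d k = ((\<psi> d ^^ k) 1 - (\<psi> d ^^ k) 0) * exp (g \<xi>)" if "1 \<le> k" for k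
    proof -
      have "(\<psi> d ^^ k) 0 < (\<psi> d ^^ k) 1" by simp
      from MVT2[OF this g(1)] obtain \<xi> where "(\<psi> d ^^ k) 0 < \<xi>" "\<xi> < (\<psi> d ^^ k) 1"
        "cyl f d k = ((\<psi> d ^^ k) 1 - (\<psi> d ^^ k) 0) * exp (g \<xi>)" unfolding cyl_def by blast
      moreover have "(\<psi> d ^^ k) 0 \<in> half d" "(\<psi> d ^^ k) 1 \<in> half d"
        using branch_iterate_in_half[OF d _ that] by auto
      ultimately show ?thesis unfolding half_def by (intro bexI[of _ \<xi>]) auto
    qed
    obtain \<xi> where \<xi>: "\<xi> \<in> half d" "cyl f d k = ((\<psi> d ^^ k) 1 - (\<psi> d ^^ k) 0) * exp (g \<xi>)"
      using mv[OF k] by blast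
    obtain \<eta> where \<eta>: "\<eta> \<in> half d" "cyl f d 1 = ((\<psi> d ^^ 1) 1 - (\<psi> d ^^ 1) 0) * exp (g \<eta>)"
      using mv[of 1] by blast
    have unit: "\<xi> \<in> {0..1}" "\<eta> \<in> {0..1}" using \<xi> \<eta> half_subset[OF d] by auto
    have "(\<psi> d ^^ 1) 1 - (\<psi> d ^^ 1) 0 \<le> 1"
      using branch_iterate_unit[OF d, of 0 1] branch_iterate_unit[OF d, of 1 1] by simp
    then have 1: "cyl f d 1 \<le> exp (g \<eta>)" using \<eta>(2) by (simp add: mult_left_le_one_le mult.commute)
    have "M * \<bar>\<eta> - \<xi>\<bar> \<le> M * 1" using unit M(1) by (intro mult_left_mono) auto
    then have "- M + g \<eta> \<le> g \<xi>" using g(2)[OF \<eta>(1) \<xi>(1)] by linarith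
    then have "exp (- M) * exp (g \<eta>) \<le> exp (g \<xi>)" by (simp flip: exp_add)
    with 1 have 2: "exp (- M) * cyl f d 1 \<le> exp (g \<xi>)"
      by (meson exp_ge_zero mult_left_mono order_trans)
    have "exp (- M) / (1 + L * k) * cyl f d 1 = 1 / (1 + L * k) * (exp (- M) * cyl f d 1)" by simp
    also have "\<dots> \<le> 1 / (1 + L * k) * exp (g \<xi>)" using 2 L_nonneg by (intro mult_left_mono) auto
    also have "\<dots> \<le> cyl f d k" unfolding \<xi>(2) using cylinder_length_lower[OF d, of k]
      by (intro mult_right_mono) auto
    finally show ?thesis .
  qed
  then show ?thesis by (intro exI[of _ "exp (- M)"]) auto
qed

end

section \<open>Frequency of digit changes\<close>

text \<open>With \<open>p\<close> as tail of a block length the sum is its Laplace transform, cut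
  off at \<open>n\<close>. The truncated mean of the block grows like a harmonic sum and exceeds any
  \<open>A\<close>. At a scale \<open>t\<close> matched to the truncation, \<open>1 - t * A\<close>
  then bounds the transform relative to \<open>p 1\<close>, with the same \<open>t\<close> for every
  \<open>p\<close>.\<close>

lemma exp_weights_contract:
  fixes \<kappa> L A :: real
  assumes "\<kappa> > 0" "L \<ge> 0" "A > 0"
  shows "\<exists>t>0. \<forall>p :: nat \<Rightarrow> real. (\<forall>k\<ge>1. 0 \<le> p (Suc k) \<and> p (Suc k) \<le> p k \<and> \<kappa> / (1 + L * k) * p 1 \<le> p k) \<longrightarrow>
     (\<forall>n. (\<Sum>k=1..n. exp (- t * k) * (p k - p (Suc k))) \<le> exp (- t * A) * p 1)"
proof -
  \<comment> \<open>The factor \<open>exp 1\<close> pays for the smallest weight up to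
    \<open>N\<close> and \<open>(1 + L) / \<kappa>\<close> for the tail bound; the summand 1 is the
    first harmonic term, which the sums below omit.\<close>
  obtain N where N: "harm N \<ge> 1 + exp 1 * A * (1 + L) / \<kappa>" "1 \<le> N"
  proof -
    have "eventually (\<lambda>n. (harm n :: real) \<ge> 1 + exp 1 * A * (1 + L) / \<kappa>) sequentially"
      using harm_at_top by (simp add: filterlim_at_top)
    moreover have "eventually (\<lambda>n::nat. n \<ge> 1) sequentially" by (rule eventually_ge_at_top)
    ultimately have "eventually (\<lambda>n. (harm n :: real) \<ge> 1 + exp 1 * A * (1 + L) / \<kappa> \<and> n \<ge> 1) sequentially"
      by (rule eventually_conj)
    then show ?thesis using that by (auto simp: eventually_sequentially)
  qed
  \<comment> \<open>At this scale the weights stay above \<open>exp (- 1)\<close> up to index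
    \<open>N\<close>, so each of their decrements is at least \<open>exp (- 1) * t\<close>.\<close>
  define t where "t = 1 / real N"
  have t: "t > 0" "t * N = 1" using N(2) by (simp_all add: t_def)
  \<comment> \<open>Freezing the weight from \<open>N\<close> on only increases it, and it
    corresponds to truncating the block length at \<open>N\<close>.\<close>
  define w where "w k = exp (- t * min k N)" for k :: nat
  have "(\<Sum>k=1..n. exp (- t * k) * (p k - p (Suc k))) \<le> exp (- t * A) * p 1"
    if p: "\<And>k. k \<ge> 1 \<Longrightarrow> 0 \<le> p (Suc k) \<and> p (Suc k) \<le> p k \<and> \<kappa> / (1 + L * k) * p 1 \<le> p k"
    for p :: "nat \<Rightarrow> real" and n
  proof -
    define m where "m = max n N"
    have m: "1 \<le> m" "n \<le> m" "N \<le> m" using N(2) by (auto simp: m_def)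
    have p1: "0 \<le> p 1" using p[of 1] by linarith
    have w_step: "0 \<le> w k - w (Suc k)" for k
      using t(1) by (simp add: w_def)
    have w_diff: "exp (- 1) * t \<le> w k - w (Suc k)" if "Suc k \<le> N" for k
    proof -
      have "w k = exp (- t * Suc k) * exp t"
        using that by (simp add: w_def distrib_left flip: exp_add)
      then have "w k - w (Suc k) = exp (- t * Suc k) * (exp t - 1)"
        using that by (simp add: w_def right_diff_distrib)
      moreover have "t * Suc k \<le> 1" using that t by (metis mult_left_mono less_imp_le of_nat_le_iff)
      then have "exp (- 1) \<le> exp (- t * Suc k)" by simp
      moreover have "t \<le> exp t - 1" using exp_ge_add_one_self[of t] by linarith
      ultimately show ?thesis using t(1) by (simp only:) (intro mult_mono, auto)
    qed
    \<comment> \<open>Summation by parts brings in the tails themselves, for which the lower bound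
      is known. Equality is lost only in replacing \<open>w 1\<close> by 1.\<close>
    have abel: "(\<Sum>k=1..m. w k * (p k - p (Suc k)))
        \<le> p 1 - w m * p (Suc m) - (\<Sum>k=1..<m. (w k - w (Suc k)) * p (Suc k))"
      using m(1)
    proof (induction m rule: nat_induct_at_least)
      case base
      have "w 1 * p 1 \<le> 1 * p 1" using p1 t(1) by (intro mult_right_mono) (simp_all add: w_def)
      then show ?case by (simp add: right_diff_distrib)
    next
      case (Suc m)
      then show ?case by (simp add: algebra_simps)
    qed
    have "exp (- 1) * t * (\<kappa> / (1 + L)) * (harm N - 1) * p 1 \<le> (\<Sum>k=1..<N. (w k - w (Suc k)) * p (Suc k))"
    proof -
      have "harm N - 1 = (\<Sum>k=1..<N. inverse (real (Suc k)))"
        using N(2)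
      proof (induction N rule: nat_induct_at_least)
        case (Suc n)
        then show ?case by (simp add: harm_Suc)
      qed (simp add: harm_def)
      then have "exp (- 1) * t * (\<kappa> / (1 + L)) * (harm N - 1) * p 1
          = (\<Sum>k=1..<N. exp (- 1) * t * (\<kappa> / (1 + L) * inverse (real (Suc k)) * p 1))"
        by (simp add: sum_distrib_left sum_distrib_right sum_divide_distrib mult_ac)
      also have "\<dots> \<le> (\<Sum>k=1..<N. (w k - w (Suc k)) * p (Suc k))"
      proof (rule sum_mono)
        fix k assume k: "k \<in> {1..<N}"
        have "1 + L * Suc k \<le> (1 + L) * Suc k" by (simp add: algebra_simps)
        then have "1 / ((1 + L) * Suc k) \<le> 1 / (1 + L * Suc k)"
          using assms(2) by (intro divide_left_mono) (auto intro!: mult_pos_pos add_pos_nonneg)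
        then have "\<kappa> * (1 / ((1 + L) * Suc k)) * p 1 \<le> \<kappa> * (1 / (1 + L * Suc k)) * p 1"
          using assms(1) p1 by (intro mult_right_mono mult_left_mono) auto
        also have "\<dots> \<le> p (Suc k)" using p[of "Suc k"] by simp
        finally have "\<kappa> / (1 + L) * inverse (real (Suc k)) * p 1 \<le> p (Suc k)"
          by (simp add: inverse_eq_divide)
        moreover have "0 \<le> \<kappa> / (1 + L) * inverse (real (Suc k)) * p 1"
          using assms p1 by (intro mult_nonneg_nonneg divide_nonneg_nonneg) auto
        ultimately show "exp (- 1) * t * (\<kappa> / (1 + L) * inverse (real (Suc k)) * p 1) \<le> (w k - w (Suc k)) * p (Suc k)"
          using w_diff[of k] k w_step[of k] by (intro mult_mono) auto
      qed
      finally show ?thesis .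
    qed
    also have "\<dots> \<le> (\<Sum>k=1..<m. (w k - w (Suc k)) * p (Suc k))"
    proof (rule sum_mono2)
      fix k assume "k \<in> {1..<m} - {1..<N}"
      then show "0 \<le> (w k - w (Suc k)) * p (Suc k)" using w_step[of k] p[of k] by auto
    qed (use m in auto)
    finally have low: "exp (- 1) * t * (\<kappa> / (1 + L)) * (harm N - 1) * p 1
        \<le> (\<Sum>k=1..<m. (w k - w (Suc k)) * p (Suc k))" .
    have "A \<le> exp (- 1) * (\<kappa> / (1 + L)) * (harm N - 1)"
    proof -
      have "A = exp (- 1) * (\<kappa> / (1 + L)) * (exp 1 * A * (1 + L) / \<kappa>)"
        using assms add_pos_nonneg[of 1 L] by (simp add: exp_minus)
      also have "\<dots> \<le> exp (- 1) * (\<kappa> / (1 + L)) * (harm N - 1)"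
        using assms N(1) by (intro mult_left_mono) auto
      finally show ?thesis .
    qed
    then have "t * p 1 * A \<le> t * p 1 * (exp (- 1) * (\<kappa> / (1 + L)) * (harm N - 1))"
      using t(1) p1 by (intro mult_left_mono) auto
    with low have low': "t * A * p 1 \<le> (\<Sum>k=1..<m. (w k - w (Suc k)) * p (Suc k))"
      by (simp add: mult_ac)
    have "(\<Sum>k=1..n. exp (- t * k) * (p k - p (Suc k))) \<le> (\<Sum>k=1..n. w k * (p k - p (Suc k)))"
    proof (rule sum_mono)
      fix k assume "k \<in> {1..n}"
      then have "0 \<le> p k - p (Suc k)" using p[of k] by simp
      moreover have "exp (- t * k) \<le> w k" using t(1) by (simp add: w_def)
      ultimately show "exp (- t * k) * (p k - p (Suc k)) \<le> w k * (p k - p (Suc k))"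
        by (rule mult_right_mono[rotated])
    qed
    also have "\<dots> \<le> (\<Sum>k=1..m. w k * (p k - p (Suc k)))"
    proof (rule sum_mono2)
      fix k assume "k \<in> {1..m} - {1..n}"
      then show "0 \<le> w k * (p k - p (Suc k))" using p[of k] by (auto simp: w_def)
    qed (use m in auto)
    also have "\<dots> \<le> p 1 - t * A * p 1"
    proof -
      have "0 \<le> w m * p (Suc m)" using p[of m] m(1) by (simp add: w_def)
      then show ?thesis using abel low' by linarith
    qed
    also have "\<dots> = (1 + - t * A) * p 1" by (simp add: algebra_simps)
    also have "\<dots> \<le> exp (- t * A) * p 1"
      using p1 exp_ge_add_one_self[of "- t * A"] by (intro mult_right_mono) auto
    finally show ?thesis .
  qed
  then show ?thesis using t(1) by blast
qed

context expanding_lift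
begin

text \<open>\<open>switching m n d\<close> consists of the points of \<open>half d\<close> whose digit changes at least \<open>m\<close> times within \<open>n\<close>
  steps.\<close>

primrec switching :: "nat \<Rightarrow> nat \<Rightarrow> real \<Rightarrow> real set" where
  "switching 0 n d = half d"
| "switching (Suc m) n d = (\<Union>k\<in>{1..n}. (\<psi> d ^^ k) ` switching m (n - k) (1 - d))"

lemma continuous_branch_iterate: "continuous_on X (\<psi> d ^^ k)"
  using deriv_branch_iterate by (meson DERIV_isCont continuous_at_imp_continuous_on)

text \<open>Compactness makes the images of these sets under continuous branches measurable.\<close>

lemma compact_switching: "compact (switching m n d)"
proof (induction m arbitrary: n d)
  case (Suc m)
  then show ?case
    by (auto intro!: compact_UN compact_continuous_image continuous_branch_iterate)
qed (simp add: half_def)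

lemma switching_subset: "d \<in> {0, 1} \<Longrightarrow> switching m n d \<subseteq> half d"
proof (induction m arbitrary: n d)
  case (Suc m)
  have d': "1 - d \<in> {0, 1}" using Suc.prems by auto
  have "(\<psi> d ^^ k) z \<in> half d" if "1 \<le> k" "z \<in> switching m (n - k) (1 - d)" for k z
    using branch_iterate_in_half[OF Suc.prems _ that(1)] Suc.IH[OF d'] half_subset[OF d'] that(2) by blast
  then show ?case by auto
qed simp

lemma switching_antimono_Suc: "d \<in> {0, 1} \<Longrightarrow> switching (Suc m) n d \<subseteq> switching m n d"
proof (induction m arbitrary: n d)
  case 0
  then show ?case using switching_subset[of d "Suc 0" n] by simp
next
  case (Suc m)
  have d': "1 - d \<in> {0, 1}" using Suc.prems by auto
  have "switching (Suc (Suc m)) n d = (\<Union>k\<in>{1..n}. (\<psi> d ^^ k) ` switching (Suc m) (n - k) (1 - d))"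
    by (rule switching.simps(2))
  also have "\<dots> \<subseteq> (\<Union>k\<in>{1..n}. (\<psi> d ^^ k) ` switching m (n - k) (1 - d))"
    by (intro UN_mono image_mono subset_refl Suc.IH d')
  also have "\<dots> = switching (Suc m) n d" by (rule switching.simps(2)[symmetric])
  finally show ?case .
qed

lemma switching_antimono: "m \<le> m' \<Longrightarrow> d \<in> {0, 1} \<Longrightarrow> switching m' n d \<subseteq> switching m n d"
  by (induction m' rule: dec_induct) (use switching_antimono_Suc in blast)+

lemma branch_strict_mono: "branch d f \<Longrightarrow> strict_mono f"
proof (induction rule: branch.induct)
  case (branch_block d f k)
  then show ?case by (simp add: strict_mono_def)
qed (simp add: strict_mono_def)

lemma branch_continuous: "branch d f \<Longrightarrow> continuous_on X f"
proof (induction arbitrary: X rule: branch.induct)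
  case (branch_block d f k)
  then show ?case using continuous_branch_iterate by (intro continuous_on_compose) auto
qed (simp add: id_def)

text \<open>The cylinders of \<open>k\<close> and of \<open>k + 1\<close> digits share the endpoint
  \<open>d\<close>. What remains between them is the set where the block has exactly
  \<open>k\<close> digits, so the left side is the point mass of the tail
  \<open>cyl f d\<close>.\<close>

lemma cyl_block:
  assumes "d \<in> {0, 1}"
  shows "cyl (f \<circ> (\<psi> d ^^ k)) (1 - d) 1 = cyl f d k - cyl f d (Suc k)"
proof -
  have fixed: "(\<psi> d ^^ k) d = d" for k
    using assms by (induction k) (auto simp: \<psi>_def)
  show ?thesis
    using assms fixed[of k] fixed[of "Suc k"] by (auto simp: cyl_def funpow_swap1 \<psi>_def)
qed

text \<open>Chernoff bound by induction on the number of changes, for all pasts \<open>f\<close> at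
  once since a completed block joins the past. A block of length \<open>k\<close> leaves
  \<open>n - k\<close> steps and so contributes \<open>exp (- t * k)\<close>; summed over
  \<open>k\<close> this gains \<open>exp (- t * A)\<close>.\<close>

lemma measure_switching:
  assumes "A > 0"
  shows "\<exists>t>0. \<forall>m n d f. branch d f \<longrightarrow> measure lborel (f ` switching m n d) \<le> exp (t * (n - A * m)) * cyl f d 1"
proof -
  obtain \<kappa> where \<kappa>: "\<kappa> > 0" "\<And>d f k. branch d f \<Longrightarrow> 1 \<le> k \<Longrightarrow> \<kappa> / (1 + L * k) * cyl f d 1 \<le> cyl f d k"
    using cyl_lower by blast
  obtain t where t: "t > 0" "\<And>p n. (\<And>k. k \<ge> 1 \<Longrightarrow> 0 \<le> p (Suc k) \<and> p (Suc k) \<le> p k \<and> \<kappa> / (1 + L * k) * p 1 \<le> p k) \<Longrightarrow>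
     (\<Sum>k=1..n. exp (- t * k) * (p k - p (Suc k))) \<le> exp (- t * A) * p 1"
    using exp_weights_contract[OF \<kappa>(1) L_nonneg assms] by blast
  have "measure lborel (f ` switching m n d) \<le> exp (t * (n - A * m)) * cyl f d 1" if "branch d f" for m n d f
    using that
  proof (induction m arbitrary: n d f)
    case 0
    have le: "f (\<Psi> d) \<le> f (\<Psi> (d + 1))"
      using branch_strict_mono[OF 0] by (simp add: strict_mono_less_eq)
    have "f ` switching 0 n d \<subseteq> {f (\<Psi> d)..f (\<Psi> (d + 1))}"
      using branch_strict_mono[OF 0] by (auto simp: half_def strict_mono_less_eq)
    moreover have "f ` switching 0 n d \<in> sets lborel"
      using compact_continuous_image[OF branch_continuous[OF 0] compact_switching] by (simp add: borel_compact del: switching.simps)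
    ultimately have "measure lborel (f ` switching 0 n d) \<le> measure lborel {f (\<Psi> d)..f (\<Psi> (d + 1))}"
      by (intro measure_mono_fmeasurable fmeasurable_compact) auto
    also have "\<dots> = cyl f d 1" using le by (simp add: cyl_def \<psi>_def add.commute)
    also have "\<dots> \<le> exp (t * n) * cyl f d 1"
    proof -
      have "0 \<le> cyl f d 1" using le by (simp add: cyl_def \<psi>_def add.commute)
      moreover have "1 \<le> exp (t * n)" using t(1) by simp
      ultimately show ?thesis using mult_right_mono[of 1] by fastforce
    qed
    finally show ?case by simp
  next
    case (Suc m)
    have d: "d \<in> {0, 1}" using Suc.prems by (rule branch_digit)
    have "f ` switching (Suc m) n d = (\<Union>k\<in>{1..n}. (f \<circ> (\<psi> d ^^ k)) ` switching m (n - k) (1 - d))"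
      by (simp add: image_UN image_comp)
    then have "measure lborel (f ` switching (Suc m) n d) \<le> (\<Sum>k\<in>{1..n}. measure lborel ((f \<circ> (\<psi> d ^^ k)) ` switching m (n - k) (1 - d)))"
    proof (simp only:, intro measure_UNION_le)
      fix k
      show "(f \<circ> (\<psi> d ^^ k)) ` switching m (n - k) (1 - d) \<in> sets lborel"
        using compact_continuous_image[OF continuous_on_compose[OF continuous_branch_iterate branch_continuous[OF Suc.prems]] compact_switching]
        by (metis borel_compact sets_lborel)
    qed simp
    also have "\<dots> \<le> (\<Sum>k\<in>{1..n}. exp (t * (n - A * m)) * (exp (- t * k) * (cyl f d k - cyl f d (Suc k))))"
    proof (rule sum_mono)
      fix k assume k: "k \<in> {1..n}"
      have "measure lborel ((f \<circ> (\<psi> d ^^ k)) ` switching m (n - k) (1 - d))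
          \<le> exp (t * (real (n - k) - A * m)) * cyl (f \<circ> (\<psi> d ^^ k)) (1 - d) 1"
        using k by (intro Suc.IH branch_block[OF Suc.prems]) auto
      also have "\<dots> = exp (t * (n - A * m)) * (exp (- t * k) * (cyl f d k - cyl f d (Suc k)))"
        unfolding cyl_block[OF d] using k by (simp add: of_nat_diff algebra_simps flip: exp_add)
      finally show "measure lborel ((f \<circ> (\<psi> d ^^ k)) ` switching m (n - k) (1 - d))
          \<le> exp (t * (n - A * m)) * (exp (- t * k) * (cyl f d k - cyl f d (Suc k)))" .
    qed
    also have "\<dots> = exp (t * (n - A * m)) * (\<Sum>k\<in>{1..n}. exp (- t * k) * (cyl f d k - cyl f d (Suc k)))"
      by (simp add: sum_distrib_left)
    also have "\<dots> \<le> exp (t * (n - A * m)) * (exp (- t * A) * cyl f d 1)"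
    proof (intro mult_left_mono t(2) conjI)
      fix k :: nat assume k: "k \<ge> 1"
      have s: "f x \<le> f y \<longleftrightarrow> x \<le> y" for x y
        using branch_strict_mono[OF Suc.prems] by (simp add: strict_mono_less_eq)
      show "0 \<le> cyl f d (Suc k)" by (simp add: cyl_def s del: funpow.simps)
      have "0 \<le> \<psi> d 0" "\<psi> d 1 \<le> 1"
        using branch_in_half[of 0 d] branch_in_half[of 1 d] half_subset[OF d] by auto
      then show "cyl f d (Suc k) \<le> cyl f d k"
        unfolding cyl_def by (intro diff_mono) (simp_all add: s funpow_swap1)
      show "\<kappa> / (1 + L * k) * cyl f d 1 \<le> cyl f d k" by (rule \<kappa>(2)[OF Suc.prems k])
    qed simp
    also have "\<dots> = exp (t * (n - A * Suc m)) * cyl f d 1"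
      by (simp add: algebra_simps flip: exp_add)
    finally show ?case .
  qed
  then show ?thesis using t(1) by blast
qed

section \<open>Logarithmic derivative of the iterates and digit changes\<close>

definition log_deriv :: "nat \<Rightarrow> real \<Rightarrow> real" where
  "log_deriv n x = (\<Sum>i<n. ln (\<Phi>' ((\<Phi> ^^ i) x)))"

lemma log_deriv_Suc: "log_deriv (Suc n) x = ln (\<Phi>' x) + log_deriv n (\<Phi> x)"
  unfolding log_deriv_def sum.lessThan_Suc_shift by (simp add: funpow_swap1)

lemma iterate_shift_Ints: "n \<in> \<int> \<Longrightarrow> (\<Phi> ^^ i) (x + n) = (\<Phi> ^^ i) x + 2 ^ i * n"
proof (induction i)
  case (Suc i)
  have "(2::real) ^ i * n \<in> \<int>" using Suc.prems by (intro Ints_mult Ints_power) auto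
  then show ?case using Suc shift_Ints[of "2 ^ i * n" "(\<Phi> ^^ i) x"] by simp
qed simp

lemma log_deriv_shift_Ints: "n \<in> \<int> \<Longrightarrow> log_deriv k (x + n) = log_deriv k x"
  unfolding log_deriv_def
proof (intro sum.cong refl)
  fix i assume "n \<in> \<int>"
  moreover from this have "(2::real) ^ i * n \<in> \<int>" by (intro Ints_mult Ints_power) auto
  ultimately show "ln (\<Phi>' ((\<Phi> ^^ i) (x + n))) = ln (\<Phi>' ((\<Phi> ^^ i) x))"
    by (simp add: iterate_shift_Ints deriv_shift_Ints)
qed

lemma log_deriv_mono: "k \<le> n \<Longrightarrow> log_deriv k x \<le> log_deriv n x"
  unfolding log_deriv_def by (intro sum_mono2) (auto simp: ln_deriv_nonneg)

lemma log_deriv_branch: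
  assumes "d \<in> \<int>"
  shows "log_deriv (k + n) ((\<psi> d ^^ k) y) = (\<Sum>j=1..k. ln (\<Phi>' ((\<psi> d ^^ j) y))) + log_deriv n y"
proof (induction k)
  case (Suc k)
  have "log_deriv (Suc (k + n)) (\<psi> d ((\<psi> d ^^ k) y)) = ln (\<Phi>' (\<psi> d ((\<psi> d ^^ k) y))) + log_deriv (k + n) ((\<psi> d ^^ k) y)"
    unfolding log_deriv_Suc using log_deriv_shift_Ints[OF assms] by (simp add: \<psi>_def)
  then show ?case using Suc by simp
qed simp

text \<open>Either the initial block of digits \<open>d\<close> ends after \<open>k\<close> of them,
  or it fills all \<open>n\<close>. The alternatives may overlap, as \<open>mid\<close> belongs to
  both halves.\<close>

lemma block_cases:
  assumes d: "d \<in> {0, 1}" and x: "x \<in> half d"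
  shows "(\<exists>k\<in>{1..n}. \<exists>z\<in>half (1 - d). x = (\<psi> d ^^ k) z) \<or> (\<exists>z\<in>{0..1}. x = (\<psi> d ^^ n) z)"
proof (induction n)
  case 0
  then show ?case using x half_subset[OF d] by auto
next
  case (Suc n)
  have step: "\<exists>w\<in>{0..1}. z = \<psi> d w" if "z \<in> half d" for z
  proof (intro bexI)
    show "z = \<psi> d (\<Phi> z - d)" by (simp add: \<psi>_def)
    have "\<Phi> (\<Psi> d) \<le> \<Phi> z" "\<Phi> z \<le> \<Phi> (\<Psi> (d + 1))"
      using that strict by (simp_all only: half_def strict_mono_less_eq atLeastAtMost_iff)
    then show "\<Phi> z - d \<in> {0..1}" by simp
  qed
  from Suc show ?case
  proof
    assume "\<exists>k\<in>{1..n}. \<exists>z\<in>half (1 - d). x = (\<psi> d ^^ k) z"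
    then show ?thesis by fastforce
  next
    assume "\<exists>z\<in>{0..1}. x = (\<psi> d ^^ n) z"
    then obtain z where z: "z \<in> {0..1}" "x = (\<psi> d ^^ n) z" by blast
    have "z \<in> half d \<or> (n \<ge> 1 \<and> z \<in> half (1 - d))"
    proof (cases n)
      case 0
      then show ?thesis using z x by simp
    next
      case (Suc k)
      have union: "half d \<union> half (1 - d) = {0..1}" using d mid by (auto simp: half_def)
      have "z \<in> half d \<union> half (1 - d)" unfolding union by (rule z(1))
      then show ?thesis unfolding Suc by simp
    qed
    then show ?thesis
    proof
      assume "z \<in> half d"
      then obtain w where "w \<in> {0..1}" "z = \<psi> d w" using step by blast
      then show ?thesis using z(2) by (intro disjI2 bexI[of _ w]) (simp_all add: funpow_swap1)
    next
      assume "n \<ge> 1 \<and> z \<in> half (1 - d)"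
      then show ?thesis using z(2) by (intro disjI1 bexI[of _ n]) auto
    qed
  qed
qed

text \<open>In a block, \<open>j\<close> counts the steps left until its end. Only the last few
  points are away from the fixed point, so each block costs a constant besides
  \<open>\<epsilon>\<close> per step. The 1 added to \<open>m\<close> accounts for the final,
  incomplete block.\<close>

lemma log_deriv_le_digit_changes:
  fixes \<epsilon> :: real
  assumes "\<epsilon> > 0"
  shows "\<exists>R::real. 0 \<le> R \<and> (\<forall>n. \<forall>d\<in>{0, 1}. \<forall>x\<in>half d. \<exists>m. x \<in> switching m n d \<and> log_deriv n x \<le> \<epsilon> * n + R * (real m + 1))"
proof -
  obtain J where J: "\<And>j d y. j \<ge> J \<Longrightarrow> d \<in> {0, 1} \<Longrightarrow> y \<in> {0..1} \<Longrightarrow> ln (\<Phi>' ((\<psi> d ^^ j) y)) \<le> \<epsilon>"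
    using branch_ln_deriv_small[OF assms] by meson
  \<comment> \<open>Fewer than \<open>J\<close> points of a block can exceed
    \<open>\<epsilon>\<close>, each by at most \<open>L\<close>.\<close>
  define R where "R = L * J"
  have block: "(\<Sum>j=1..k. ln (\<Phi>' ((\<psi> d ^^ j) y))) \<le> \<epsilon> * k + R" if "d \<in> {0, 1}" "y \<in> {0..1}" for k d y
  proof -
    have "(\<Sum>j=1..k. ln (\<Phi>' ((\<psi> d ^^ j) y))) \<le> (\<Sum>j=1..k. \<epsilon> + (if j < J then L else 0))"
    proof (rule sum_mono)
      fix j
      show "ln (\<Phi>' ((\<psi> d ^^ j) y)) \<le> \<epsilon> + (if j < J then L else 0)"
        using J[OF _ that, of j] ln_deriv_le[of "(\<psi> d ^^ j) y"] assms by (auto simp: not_less)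
    qed
    also have "\<dots> = \<epsilon> * k + (\<Sum>j\<in>{1..k} \<inter> {..<J}. L)"
      by (simp add: sum.distrib sum.If_cases lessThan_def)
    also have "\<dots> \<le> \<epsilon> * k + (\<Sum>j\<in>{..<J}. L)"
      using L_nonneg by (intro add_left_mono sum_mono2) auto
    finally show ?thesis by (simp add: R_def mult.commute)
  qed
  have "\<exists>m. x \<in> switching m n d \<and> log_deriv n x \<le> \<epsilon> * n + R * (real m + 1)" if "d \<in> {0, 1}" "x \<in> half d" for n d x
    using that
  proof (induction n arbitrary: d x rule: less_induct)
    case (less n)
    have dI: "d \<in> \<int>" using less.prems(1) by auto
    from block_cases[OF less.prems, of n] show ?case
    proof
      assume "\<exists>k\<in>{1..n}. \<exists>z\<in>half (1 - d). x = (\<psi> d ^^ k) z"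
      then obtain k z where k: "1 \<le> k" "k \<le> n" "z \<in> half (1 - d)" "x = (\<psi> d ^^ k) z" by auto
      have d': "1 - d \<in> {0, 1}" using less.prems(1) by auto
      obtain m where m: "z \<in> switching m (n - k) (1 - d)" "log_deriv (n - k) z \<le> \<epsilon> * real (n - k) + R * (real m + 1)"
        using less.IH[OF _ d' k(3), of "n - k"] k by auto
      have "x \<in> switching (Suc m) n d" using k m(1) by auto
      moreover have "log_deriv n x = (\<Sum>j=1..k. ln (\<Phi>' ((\<psi> d ^^ j) z))) + log_deriv (n - k) z"
        using log_deriv_branch[OF dI, of k "n - k" z] k by simp
      then have "log_deriv n x \<le> (\<epsilon> * k + R) + (\<epsilon> * real (n - k) + R * (real m + 1))"
        using block[OF less.prems(1), of z k] half_subset[OF d'] k(3) m(2) by auto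
      then have "log_deriv n x \<le> \<epsilon> * n + R * (real (Suc m) + 1)"
        using k(2) by (simp add: of_nat_diff algebra_simps)
      ultimately show ?thesis by blast
    next
      assume "\<exists>z\<in>{0..1}. x = (\<psi> d ^^ n) z"
      then obtain z where z: "z \<in> {0..1}" "x = (\<psi> d ^^ n) z" by blast
      have "log_deriv n x \<le> \<epsilon> * n + R"
        using log_deriv_branch[OF dI, of n 0 z] block[OF less.prems(1) z(1), of n] z(2) by (simp add: log_deriv_def)
      then show ?thesis using less.prems(2) by (intro exI[of _ 0]) simp
    qed
  qed
  moreover have "R \<ge> 0" using L_nonneg by (simp add: R_def)
  ultimately show ?thesis by blast
qed

lemma continuous_iterate: "continuous_on UNIV (\<Phi> ^^ i)"
  by (induction i) (auto simp: id_def intro: continuous_on_compose2[OF continuous])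

lemma continuous_log_deriv: "continuous_on X (log_deriv n)"
proof -
  have "continuous_on UNIV (\<lambda>x. ln (\<Phi>' ((\<Phi> ^^ i) x)))" for i
    using continuous_on_compose2[OF continuous_ln_deriv continuous_iterate] by blast
  then have "continuous_on UNIV (log_deriv n)" unfolding log_deriv_def by (intro continuous_on_sum)
  then show ?thesis using continuous_on_subset by blast
qed

theorem summable_large_log_deriv:
  fixes \<epsilon> :: real
  assumes "\<epsilon> > 0"
  shows "summable (\<lambda>n. measure lborel {x \<in> {0..1}. log_deriv n x > \<epsilon> * n})"
proof -
  obtain R where R: "R \<ge> 0" "\<And>n d x. d \<in> {0, 1} \<Longrightarrow> x \<in> half d \<Longrightarrow> \<exists>m. x \<in> switching m n d \<and> log_deriv n x \<le> \<epsilon> / 2 * n + R * (real m + 1)"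
    using log_deriv_le_digit_changes[OF half_gt_zero[OF assms]] by meson
  \<comment> \<open>A sum above \<open>\<epsilon> * n\<close> forces \<open>R * (m + 1)\<close>
    above half of that, hence at least \<open>\<delta> * n - 1\<close> changes. \<open>R + 1\<close>
    keeps the denominator positive.\<close>
  define \<delta> where "\<delta> = \<epsilon> / (2 * (R + 1))"
  have \<delta>: "\<delta> > 0" using assms R(1) by (simp add: \<delta>_def)
  \<comment> \<open>With \<open>A = 2 / \<delta>\<close>, at least \<open>\<delta> * n - 1\<close>
    changes bring the exponent down to \<open>t * (2 / \<delta> - n)\<close>, which decays
    geometrically.\<close>
  obtain t where t: "t > 0" "\<And>m n d f. branch d f \<Longrightarrow> measure lborel (f ` switching m n d) \<le> exp (t * (n - (2 / \<delta>) * m)) * cyl f d 1"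
    using measure_switching[of "2 / \<delta>"] \<delta> by auto
  have bound: "measure lborel {x \<in> {0..1}. log_deriv n x > \<epsilon> * n} \<le> 2 * exp (t * (2 / \<delta>)) * exp (- t) ^ n" for n :: nat
  proof -
    define M where "M = nat \<lceil>\<delta> * n - 1\<rceil>"
    have M: "\<delta> * n - 1 \<le> M" by (simp add: M_def) linarith
    have sub: "{x \<in> {0..1}. log_deriv n x > \<epsilon> * n} \<subseteq> switching M n 0 \<union> switching M n 1"
    proof
      fix x assume x: "x \<in> {x \<in> {0..1}. log_deriv n x > \<epsilon> * n}"
      have "half 0 \<union> half 1 = {0..1}" using mid by (auto simp: half_def)
      then obtain d where d: "d \<in> {0, 1}" "x \<in> half d" using x by blast
      obtain m where m: "x \<in> switching m n d" "log_deriv n x \<le> \<epsilon> / 2 * n + R * (real m + 1)" using R(2)[OF d] by blast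
      have "\<epsilon> / 2 * n \<le> R * (real m + 1)" using x m(2) by simp
      also have "\<dots> \<le> (R + 1) * (real m + 1)" by (intro mult_right_mono) auto
      finally have "\<delta> * n \<le> real m + 1" using R(1) by (simp add: \<delta>_def field_simps)
      then have "M \<le> m" unfolding M_def by linarith
      then have "x \<in> switching M n d" using m(1) switching_antimono[OF _ d(1)] by blast
      then show "x \<in> switching M n 0 \<union> switching M n 1" using d(1) by auto
    qed
    have fm: "switching M n d \<in> fmeasurable lborel" for d
      using compact_switching[of M n d] by (simp add: fmeasurable_compact)
    have meas: "measure lborel (switching M n d) \<le> exp (t * (2 / \<delta>)) * exp (- t) ^ n" if "d \<in> {0, 1}" for d
    proof -
      have "cyl id d 1 \<le> 1"
        using branch_iterate_unit[OF that, of 0 1] branch_iterate_unit[OF that, of 1 1] by (simp add: cyl_def)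
      moreover have "measure lborel (id ` switching M n d) \<le> exp (t * (n - (2 / \<delta>) * M)) * cyl id d 1"
        by (rule t(2)[OF branch_id[OF that]])
      moreover have "exp (t * (n - (2 / \<delta>) * M)) * cyl id d 1 \<le> exp (t * (n - (2 / \<delta>) * M))"
        using \<open>cyl id d 1 \<le> 1\<close> by (intro mult_left_le) auto
      ultimately have "measure lborel (switching M n d) \<le> exp (t * (n - (2 / \<delta>) * M))"
        unfolding image_id id_apply by linarith
      also have "\<dots> \<le> exp (t * (2 / \<delta>) - t * n)"
      proof -
        have "(2 / \<delta>) * (\<delta> * n - 1) \<le> (2 / \<delta>) * M" using M \<delta> by (intro mult_left_mono) auto
        then have "n - (2 / \<delta>) * M \<le> 2 / \<delta> - n" using \<delta> by (simp add: field_simps)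
        then have "t * (n - (2 / \<delta>) * M) \<le> t * (2 / \<delta> - n)" using t(1) by (intro mult_left_mono) auto
        then show ?thesis by (simp add: right_diff_distrib)
      qed
      also have "\<dots> = exp (t * (2 / \<delta>)) * exp (- t) ^ n"
        by (simp add: exp_diff exp_minus exp_of_nat_mult[symmetric] field_simps)
      finally show ?thesis .
    qed
    have "measure lborel {x \<in> {0..1}. log_deriv n x > \<epsilon> * n} \<le> measure lborel (switching M n 0 \<union> switching M n 1)"
    proof (rule measure_mono_fmeasurable[OF sub])
      show "{x \<in> {0..1}. log_deriv n x > \<epsilon> * n} \<in> sets lborel"
        using borel_measurable_continuous_onI[OF continuous_log_deriv[of UNIV n]] by measurable
      show "switching M n 0 \<union> switching M n 1 \<in> fmeasurable lborel" using fm by blast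
    qed
    also have "\<dots> \<le> measure lborel (switching M n 0) + measure lborel (switching M n 1)"
      using fm by (intro measure_Un_le) (auto simp: fmeasurable_def)
    also have "\<dots> \<le> 2 * (exp (t * (2 / \<delta>)) * exp (- t) ^ n)"
      using meas[of 0] meas[of 1] by simp
    finally show ?thesis by simp
  qed
  have "summable (\<lambda>n. 2 * exp (t * (2 / \<delta>)) * exp (- t) ^ n)"
    using t(1) by (intro summable_mult summable_geometric) simp
  then show ?thesis by (rule summable_comparison_test') (use bound in auto)
qed

end

section \<open>Conjugacy to the doubling map\<close>

lemma continuous_Ints_constant:
  fixes d :: "real \<Rightarrow> real"
  assumes cont: "continuous_on UNIV d" and int: "\<And>t. d t \<in> \<int>"
  shows "d s = d t"
proof -
  have "d constant_on UNIV"
  proof (rule continuous_discrete_range_constant[OF connected_UNIV cont])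
    fix x :: real
    have "1 \<le> norm (d y - d x)" if "d y \<noteq> d x" for y
      using Ints_nonzero_abs_ge1[OF Ints_diff[OF int int]] that by simp
    then show "\<exists>e>0. \<forall>y. y \<in> UNIV \<and> d y \<noteq> d x \<longrightarrow> e \<le> norm (d y - d x)"
      by (intro exI[of _ 1]) auto
  qed
  then show ?thesis by (auto simp: constant_on_def)
qed

context expanding_lift
begin

text \<open>No factor above 1 works near the integers, but for intervals of length at least
  \<open>l\<close> the gain is bounded below, by compactness of one period.\<close>

lemma uniform_expansion:
  assumes "l > 0"
  shows "\<exists>\<eta>>0. \<forall>x y. x + l \<le> y \<longrightarrow> (y - x) + \<eta> \<le> \<Phi> y - \<Phi> x"
proof -
  define g where "g x = \<Phi> (x + l) - \<Phi> x - l" for x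
  have "continuous_on {0..1} g"
    unfolding g_def by (intro continuous_intros continuous_on_compose2[OF continuous[of UNIV]]) (auto intro: continuous)
  then have "\<exists>z\<in>{0..1}. \<forall>y\<in>{0..1}. g z \<le> g y" by (intro continuous_attains_inf) auto
  then obtain z where z: "\<And>x. x \<in> {0..1} \<Longrightarrow> g z \<le> g x" by blast
  have "g z > 0" using expands[of z "z + l"] assms by (simp add: g_def)
  moreover have "(y - x) + g z \<le> \<Phi> y - \<Phi> x" if "x + l \<le> y" for x y
  proof -
    have "g (frac x + of_int \<lfloor>x\<rfloor>) = g (frac x)"
      using shift_Ints[of "of_int \<lfloor>x\<rfloor>" "frac x"] shift_Ints[of "of_int \<lfloor>x\<rfloor>" "frac x + l"]
      by (simp add: g_def add_ac)
    then have "g z \<le> g x" using z[of "frac x"] by (simp add: frac_def frac_ge_0 less_imp_le[OF frac_lt_1, unfolded frac_def])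
    moreover have "y - (x + l) \<le> \<Phi> y - \<Phi> (x + l)" using nonexpanding_set[OF that] .
    ultimately show ?thesis by (simp add: g_def)
  qed
  ultimately show ?thesis by blast
qed

lemma iterate_mono: "s \<le> t \<Longrightarrow> (\<Phi> ^^ n) s \<le> (\<Phi> ^^ n) t"
  using strict by (induction n) (auto simp: strict_mono_less_eq)

text \<open>\<open>H\<close> is the limit of \<open>(\<Phi> ^^ n) t / 2 ^ n\<close>. The difference
  \<open>\<Phi> t - 2 * t\<close> is periodic, hence bounded, and the telescoping series converges
  uniformly. This yields a monotone semiconjugacy; its injectivity is where expansion is
  needed.\<close>

lemma linearization:
  "\<exists>H :: real \<Rightarrow> real. strict_mono H \<and> surj H \<and> (\<forall>t. H (t + 1) = H t + 1) \<and> (\<forall>t. H (\<Phi> t) = 2 * H t)"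
proof -
  define D where "D t = \<Phi> t - 2 * t" for t
  have D: "\<bar>D t\<bar> \<le> 2" for t
  proof -
    have "D (frac t + of_int \<lfloor>t\<rfloor>) = D (frac t)"
      using shift_Ints[of "of_int \<lfloor>t\<rfloor>" "frac t"] by (simp add: D_def)
    moreover have "\<Phi> 0 \<le> \<Phi> (frac t)" "\<Phi> (frac t) \<le> \<Phi> (0 + 1)"
      using strict by (simp_all add: strict_mono_less_eq frac_ge_0 less_imp_le[OF frac_lt_1])
    then have "\<bar>D (frac t)\<bar> \<le> 2"
      unfolding D_def shift zero abs_le_iff using frac_ge_0[of t] frac_lt_1[of t] by linarith
    ultimately show ?thesis by (simp add: frac_def)
  qed
  define f where "f i t = D ((\<Phi> ^^ i) t) / 2 ^ Suc i" for i t
  define H where "H t = t + (\<Sum>i. f i t)" for t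
  have unif: "uniform_limit UNIV (\<lambda>n t. \<Sum>i<n. f i t) (\<lambda>t. \<Sum>i. f i t) sequentially"
  proof (rule Weierstrass_m_test)
    show "norm (f i t) \<le> (1 / 2) ^ i" for i t
      using D[of "(\<Phi> ^^ i) t"] by (simp add: f_def power_divide field_simps)
    show "summable (\<lambda>i. (1 / 2 :: real) ^ i)" by (rule summable_geometric) simp
  qed
  have partial: "t + (\<Sum>i<n. f i t) = (\<Phi> ^^ n) t / 2 ^ n" for n t
    by (induction n) (simp_all add: f_def D_def field_simps)
  have lim: "(\<lambda>n. (\<Phi> ^^ n) t / 2 ^ n) \<longlonglongrightarrow> H t" for t
  proof -
    have "(\<lambda>n. \<Sum>i<n. f i t) \<longlonglongrightarrow> (\<Sum>i. f i t)"
      using tendsto_uniform_limitI[OF unif] by blast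
    then have "(\<lambda>n. t + (\<Sum>i<n. f i t)) \<longlonglongrightarrow> H t"
      unfolding H_def by (intro tendsto_intros)
    then show ?thesis by (simp add: partial)
  qed
  have contf: "continuous_on UNIV (f i)" for i
    unfolding f_def D_def
    by (intro continuous_intros continuous_iterate continuous_on_compose2[OF continuous continuous_iterate]) auto
  have "continuous_on UNIV (\<lambda>t. \<Sum>i. f i t)"
    by (rule uniform_limit_theorem[OF _ unif]) (auto intro!: always_eventually continuous_on_sum contf)
  then have contH: "continuous_on UNIV H"
    unfolding H_def by (intro continuous_intros)
  have double: "H (\<Phi> t) = 2 * H t" for t
  proof -
    have "(\<lambda>n. 2 * ((\<Phi> ^^ Suc n) t / 2 ^ Suc n)) \<longlonglongrightarrow> 2 * H t"
      by (intro tendsto_intros LIMSEQ_Suc[OF lim])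
    then have "(\<lambda>n. (\<Phi> ^^ n) (\<Phi> t) / 2 ^ n) \<longlonglongrightarrow> 2 * H t" by (simp add: funpow_swap1)
    then show ?thesis using lim[of "\<Phi> t"] LIMSEQ_unique by blast
  qed
  have H1: "H (t + 1) = H t + 1" for t
  proof -
    have "(\<lambda>n. (\<Phi> ^^ n) t / 2 ^ n + 1) \<longlonglongrightarrow> H t + 1" by (intro tendsto_intros lim)
    then have "(\<lambda>n. (\<Phi> ^^ n) (t + 1) / 2 ^ n) \<longlonglongrightarrow> H t + 1"
      by (simp add: iterate_shift_Ints add_divide_distrib)
    then show ?thesis using lim[of "t + 1"] LIMSEQ_unique by blast
  qed
  have H_mono: "H s \<le> H t" if "s \<le> t" for s t
    by (rule LIMSEQ_le[OF lim lim]) (use iterate_mono[OF that] in \<open>auto intro!: divide_right_mono\<close>)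
  have "strict_mono H"
  proof (rule strict_monoI, rule ccontr)
    fix a b :: real assume "a < b" "\<not> H a < H b"
    then have eq: "H a = H b" using H_mono[of a b] by simp
    have iter: "H ((\<Phi> ^^ n) t) = 2 ^ n * H t" for n t by (induction n) (simp_all add: double)
    \<comment> \<open>If \<open>H\<close> identified \<open>a\<close> and \<open>b\<close>, it would
      identify all their iterates, which could then never be 1 apart; \<open>grow\<close> shows that
      they separate without bound.\<close>
    have close: "(\<Phi> ^^ n) b < (\<Phi> ^^ n) a + 1" for n
    proof (rule ccontr)
      assume "\<not> (\<Phi> ^^ n) b < (\<Phi> ^^ n) a + 1"
      then have "H ((\<Phi> ^^ n) a) + 1 \<le> H ((\<Phi> ^^ n) b)" using H_mono H1 by (metis not_less)
      then show False by (simp add: iter eq)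
    qed
    obtain \<eta> where \<eta>: "\<eta> > 0" "\<And>x y. x + (b - a) \<le> y \<Longrightarrow> (y - x) + \<eta> \<le> \<Phi> y - \<Phi> x"
      using uniform_expansion[of "b - a"] \<open>a < b\<close> by auto
    have grow: "(b - a) + n * \<eta> \<le> (\<Phi> ^^ n) b - (\<Phi> ^^ n) a" for n
    proof (induction n)
      case (Suc n)
      then have "(\<Phi> ^^ n) a + (b - a) \<le> (\<Phi> ^^ n) b"
        using \<eta>(1) mult_nonneg_nonneg[of "real n" \<eta>] by linarith
      from \<eta>(2)[OF this] show ?case using Suc by (simp add: distrib_right)
    qed simp
    obtain n :: nat where "1 / \<eta> < n" using reals_Archimedean2 by blast
    then have "1 < n * \<eta>" using \<eta>(1) by (simp add: field_simps)
    then show False using grow[of n] close[of n] \<open>a < b\<close> by linarith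
  qed
  moreover have "surj H" by (rule surj_equivariant[OF contH, of 1]) (simp_all add: H1)
  ultimately show ?thesis using H1 double by blast
qed

text \<open>\<open>doubling_conjugacy\<close> is a choice operator, so its properties rest on this
  existence.\<close>

lemma conjugacy_exists:
  assumes "is_lift \<Phi> \<phi>"
  shows "\<exists>h. orientation_preserving_homeo h \<and> h 0 = 0 \<and> h \<circ> doubling = \<phi> \<circ> h"
proof -
  obtain H :: "real \<Rightarrow> real" where H: "strict_mono H" "surj H" "\<And>t. H (t + 1) = H t + 1" "\<And>t. H (\<Phi> t) = 2 * H t"
    using linearization by blast
  define K where "K = inv H"
  have HK: "H (K t) = t" "K (H t) = t" for t
    using H(1,2) by (simp_all add: K_def surj_f_inv_f inv_f_f strict_mono_imp_inj_on)
  have "strict_mono K" using H(1) HK by (metis strict_mono_less strict_monoI)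
  moreover have "surj K" by (metis HK(2) surjI)
  moreover have K1: "K (t + 1) = K t + 1" for t by (metis H(3) HK)
  ultimately have hK: "orientation_preserving_homeo (circle_map K)" by (rule circle_map_homeo)
  have K: "circle_map K (circ t) = circ (K t)" for t using K1 by (rule circle_map_circ)
  have "H 0 = 0" using H(4)[of 0] zero by simp
  then have "K 0 = 0" by (metis HK(2))
  then have "circle_map K 0 = 0" using K[of 0] by simp
  moreover have "(circle_map K \<circ> doubling) x = (\<phi> \<circ> circle_map K) x" for x
  proof -
    obtain t where t: "x = circ t" using circ_surj by blast
    have "K (2 * t) = \<Phi> (K t)" by (metis H(4) HK)
    moreover have "doubling (circ t) = circ (2 * t)" by (simp add: doubling_def flip: circ_add)
    ultimately show ?thesis using assms by (simp add: t K is_lift_def)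
  qed
  ultimately show ?thesis using hK by blast
qed

end

text \<open>\<open>K\<close> lifts the conjugacy that was chosen. Its normalization at 0 makes the
  functional equation exact, not only valid modulo 1.\<close>

locale ghys_sergiescu = expanding_lift +
  fixes \<phi> :: "circle \<Rightarrow> circle" and K :: "real \<Rightarrow> real"
  assumes lift: "is_lift \<Phi> \<phi>"
    and conj_homeo: "orientation_preserving_homeo (doubling_conjugacy \<phi>)"
    and conj_lift: "is_lift K (doubling_conjugacy \<phi>)"
    and strict_K: "strict_mono K"
    and K_0: "K 0 = 0"
    and K_double: "K (2 * t) = \<Phi> (K t)"

text \<open>Any lift of \<open>h\<close> takes an integer value at 0, which can be subtracted. The
  error in the functional equation is then a continuous integer-valued function vanishing at
  0.\<close>

lemma (in expanding_lift) ghys_sergiescu_exists: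
  assumes lift: "is_lift \<Phi> \<phi>"
  shows "\<exists>K. ghys_sergiescu \<Phi> \<Phi>' L \<phi> K"
proof -
  define h where "h = doubling_conjugacy \<phi>"
  have h: "orientation_preserving_homeo h" "h 0 = 0" "h \<circ> doubling = \<phi> \<circ> h"
    using someI_ex[OF conjugacy_exists[OF lift]] by (simp_all add: h_def doubling_conjugacy_def)
  obtain F where F: "is_lift F h" "strict_mono F"
    using h(1) by (auto simp: orientation_preserving_homeo_def)
  have lift_F: "h (circ t) = circ (F t)" for t using F(1) by (simp add: is_lift_def)
  have "F 0 \<in> \<int>" using lift_F[of 0] h(2) by (simp add: circ_eq_0_iff)
  define K where "K t = F t - F 0" for t
  have K_lift: "is_lift K h"
    using F(1) \<open>F 0 \<in> \<int>\<close> by (auto simp: is_lift_def K_def circ_diff intro!: continuous_intros)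
  have cK: "continuous_on X K" for X using K_lift continuous_on_subset by (auto simp: is_lift_def)
  have hK: "h (circ t) = circ (K t)" for t using K_lift by (simp add: is_lift_def)
  have phi: "\<phi> (circ t) = circ (\<Phi> t)" for t using lift by (simp add: is_lift_def)
  have "K (2 * t) - \<Phi> (K t) \<in> \<int>" for t
  proof -
    have "h (doubling (circ t)) = \<phi> (h (circ t))" using h(3) by (metis comp_apply)
    moreover have "doubling (circ t) = circ (2 * t)" by (simp add: doubling_def flip: circ_add)
    ultimately have "circ (K (2 * t)) = circ (\<Phi> (K t))" by (simp only: hK phi)
    then show ?thesis by (simp only: circ_eq_iff)
  qed
  moreover have "continuous_on UNIV (\<lambda>t. K (2 * t) - \<Phi> (K t))"
  proof (rule continuous_on_diff)
    show "continuous_on UNIV (\<lambda>t. K (2 * t))"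
      by (rule continuous_on_compose2[OF cK[of UNIV]]) (auto intro!: continuous_intros)
    show "continuous_on UNIV (\<lambda>t. \<Phi> (K t))"
      by (rule continuous_on_compose2[OF continuous[of UNIV] cK]) auto
  qed
  ultimately have "K (2 * t) - \<Phi> (K t) = K (2 * 0) - \<Phi> (K 0)" for t
    using continuous_Ints_constant[of "\<lambda>t. K (2 * t) - \<Phi> (K t)" t 0] by blast
  then have "K (2 * t) = \<Phi> (K t)" for t by (simp add: K_def zero)
  moreover have "strict_mono K" using F(2) by (simp add: K_def strict_mono_def)
  ultimately have "ghys_sergiescu \<Phi> \<Phi>' L \<phi> K"
    using h(1) K_lift lift by unfold_locales (simp_all add: h_def K_def)
  then show ?thesis by blast
qed

lemma deriv_equivariant:
  fixes F :: "real \<Rightarrow> real"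
  assumes "\<And>t. F field_differentiable (at t)" "\<And>t. F (t + 1) = F t + c"
  shows "deriv F (t + 1) = deriv F t"
proof -
  have D: "(F has_real_derivative deriv F t) (at t)" for t
    using assms(1) by (simp add: DERIV_deriv_iff_field_differentiable)
  have "((\<lambda>s. F (s + 1)) has_real_derivative deriv F (t + 1)) (at t)"
    using D[of "t + 1"] by (simp add: DERIV_shift)
  moreover have "((\<lambda>s. F (s + 1)) has_real_derivative deriv F t) (at t)"
    unfolding assms(2) using D[of t] by (auto intro!: derivative_eq_intros)
  ultimately show ?thesis by (rule DERIV_unique)
qed

text \<open>The second derivative of the lift is continuous and periodic, hence bounded. Dividing by
  the first, which is at least 1, bounds the derivative of its logarithm.\<close>

lemma ghys_sergiescu_map_lift:
  assumes r: "2 \<le> r" and gs: "ghys_sergiescu_map r \<phi>"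
  shows "\<exists>\<Phi> L. is_lift \<Phi> \<phi> \<and> expanding_lift \<Phi> (deriv \<Phi>) L"
proof -
  obtain \<Phi> where lift: "is_lift \<Phi> \<phi>" and \<Phi>: "\<Phi> 0 = 0" "\<And>t. \<Phi> (t + 1) = \<Phi> t + 2" "C_diff r \<Phi>"
    and c0: "circle_deriv \<phi> 0 = 1" and c1: "\<And>x. x \<noteq> 0 \<Longrightarrow> circle_deriv \<phi> x > 1"
    using gs unfolding ghys_sergiescu_map_def by blast
  have lt: "enat 0 < r" "enat 1 < r"
    using r by (metis enat_ord_simps(2) le_less_trans less_le_trans numeral_eq_enat zero_less_numeral one_less_numeral_iff semiring_norm(76))+
  have d0: "\<Phi> field_differentiable (at t)" and d1: "deriv \<Phi> field_differentiable (at t)" for t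
    using \<Phi>(3) lt unfolding C_diff_def by (metis funpow_0, metis One_nat_def funpow.simps(2) funpow_0 comp_apply)
  have c2: "continuous_on UNIV (deriv (deriv \<Phi>))"
    using \<Phi>(3) r unfolding C_diff_def by (auto simp: numeral_eq_enat dest!: spec[of _ 2] simp: numeral_2_eq_2)
  have D0: "(\<Phi> has_real_derivative deriv \<Phi> t) (at t)" for t
    using d0 by (simp add: DERIV_deriv_iff_field_differentiable)
  have D1: "(deriv \<Phi> has_real_derivative deriv (deriv \<Phi>) t) (at t)" for t
    using d1 by (simp add: DERIV_deriv_iff_field_differentiable)
  have cd: "circle_deriv \<phi> (circ t) = deriv \<Phi> t" for t
    by (rule circle_deriv_circ[OF lift D0])
  have e0: "deriv \<Phi> 0 = 1" using cd[of 0] c0 by simp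
  have e1: "1 < deriv \<Phi> t" if "t \<notin> \<int>" for t using cd[of t] c1[of "circ t"] that by (simp add: circ_eq_0_iff)
  have p1: "deriv \<Phi> (t + 1) = deriv \<Phi> t + 0" for t
    using deriv_equivariant[OF d0 \<Phi>(2)] by simp
  have p2: "deriv (deriv \<Phi>) (t + 1) = deriv (deriv \<Phi>) t + 0" for t
    using deriv_equivariant[OF d1 p1] by simp
  have ge: "1 \<le> deriv \<Phi> t" for t
  proof (cases "t \<in> \<int>")
    case True
    then show ?thesis using equivariant_of_int[of "deriv \<Phi>" 0 0] p1 e0 by (elim Ints_cases) simp
  qed (use e1 in force)
  have "compact ((\<lambda>t. deriv (deriv \<Phi>) t) ` {0..1})"
    using c2 by (intro compact_continuous_image) (auto intro: continuous_on_subset)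
  then obtain L where L: "\<And>t. t \<in> {0..1} \<Longrightarrow> \<bar>deriv (deriv \<Phi>) t\<bar> \<le> L"
    by (metis (no_types, lifting) bounded_real compact_imp_bounded imageI)
  have L': "\<bar>deriv (deriv \<Phi>) t\<bar> \<le> L" for t
  proof -
    have "deriv (deriv \<Phi>) (frac t + of_int \<lfloor>t\<rfloor>) = deriv (deriv \<Phi>) (frac t)"
      using equivariant_of_int[of "deriv (deriv \<Phi>)" 0] p2 by simp
    moreover have "frac t \<in> {0..1}" by (simp add: less_imp_le[OF frac_lt_1])
    ultimately show ?thesis using L[of "frac t"] by (simp add: frac_def)
  qed
  have "\<bar>ln (deriv \<Phi> s) - ln (deriv \<Phi> t)\<bar> \<le> L * \<bar>s - t\<bar>" for s t
  proof -
    have "norm (ln (deriv \<Phi> s) - ln (deriv \<Phi> t)) \<le> L * norm (s - t)"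
    proof (rule field_differentiable_bound[OF convex_UNIV])
      fix z
      have pos: "0 < deriv \<Phi> z" using ge[of z] by simp
      show "((\<lambda>s. ln (deriv \<Phi> s)) has_real_derivative deriv (deriv \<Phi>) z / deriv \<Phi> z) (at z within UNIV)"
        using D1[of z] pos by (auto intro!: derivative_eq_intros)
      have "\<bar>deriv (deriv \<Phi>) z\<bar> / deriv \<Phi> z \<le> \<bar>deriv (deriv \<Phi>) z\<bar> / 1"
        using ge[of z] by (intro divide_left_mono) auto
      then show "norm (deriv (deriv \<Phi>) z / deriv \<Phi> z) \<le> L"
        using L'[of z] pos by simp
    qed auto
    then show ?thesis by simp
  qed
  then have "expanding_lift \<Phi> (deriv \<Phi>) L"
    using D0 \<Phi>(1,2) e0 e1 by unfold_locales auto
  then show ?thesis using lift by blast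
qed

lemma ghys_sergiescu_of_map:
  assumes "2 \<le> r" "ghys_sergiescu_map r \<phi>"
  shows "\<exists>\<Phi> \<Phi>' L K. ghys_sergiescu \<Phi> \<Phi>' L \<phi> K"
  using ghys_sergiescu_map_lift[OF assms] expanding_lift.ghys_sergiescu_exists by blast

section \<open>Thompson's group\<close>

definition dyadics :: "real set" where
  "dyadics = {of_int m / 2 ^ k | (m::int) (k::nat). True}"

lemma dyadicsI: "of_int m / 2 ^ k \<in> dyadics"
  unfolding dyadics_def by blast

lemma dyadics_Ints: "t \<in> \<int> \<Longrightarrow> t \<in> dyadics"
  using dyadicsI[of _ 0] by (elim Ints_cases) simp

lemma dyadics_add: "s \<in> dyadics \<Longrightarrow> t \<in> dyadics \<Longrightarrow> s + t \<in> dyadics"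
proof -
  assume "s \<in> dyadics" "t \<in> dyadics"
  then obtain m n :: int and j k :: nat where "s = m / 2 ^ j" "t = n / 2 ^ k"
    by (auto simp: dyadics_def)
  then have "s + t = of_int (m * 2 ^ k + n * 2 ^ j) / 2 ^ (j + k)"
    by (simp add: add_frac_eq power_add)
  then show ?thesis by (simp only: dyadicsI)
qed

lemma dyadics_mult: "s \<in> dyadics \<Longrightarrow> t \<in> dyadics \<Longrightarrow> s * t \<in> dyadics"
proof -
  assume "s \<in> dyadics" "t \<in> dyadics"
  then obtain m n :: int and j k :: nat where "s = m / 2 ^ j" "t = n / 2 ^ k"
    by (auto simp: dyadics_def)
  then have "s * t = of_int (m * n) / 2 ^ (j + k)" by (simp add: power_add)
  then show ?thesis by (simp only: dyadicsI)
qed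

lemma dyadics_diff: "s \<in> dyadics \<Longrightarrow> t \<in> dyadics \<Longrightarrow> s - t \<in> dyadics"
  using dyadics_add[of s "- 1 * t"] dyadics_mult[of "- 1" t] dyadics_Ints[of "- 1"] by simp

lemma dyadics_half_power: "1 / 2 ^ k \<in> dyadics"
  using dyadicsI[of 1 k] by simp

lemma dyadics_add_iff: "q \<in> dyadics \<Longrightarrow> t + q \<in> dyadics \<longleftrightarrow> t \<in> dyadics"
  using dyadics_add[of t q] dyadics_diff[of "t + q" q] by auto

lemma dyadics_scale_iff:
  assumes "c \<in> dyadics" "1 / c \<in> dyadics" "c \<noteq> 0"
  shows "c * t \<in> dyadics \<longleftrightarrow> t \<in> dyadics"
  using dyadics_mult[OF assms(1), of t] dyadics_mult[OF assms(2), of "c * t"] assms(3) by auto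

lemma circ_in_dyadic_iff: "circ t \<in> dyadic \<longleftrightarrow> t \<in> dyadics"
proof
  assume "circ t \<in> dyadic"
  then obtain m :: int and k where "circ t = circ (m / 2 ^ k)" by (auto simp: dyadic_def)
  then obtain n :: int where "t = m / 2 ^ k + n" by (rule circ_eqE)
  then show "t \<in> dyadics" by (simp add: dyadicsI dyadics_Ints dyadics_add)
qed (auto simp: dyadic_def dyadics_def)

lemma dyadics_dense:
  assumes "a < b"
  obtains q where "q \<in> dyadics" "a < q" "q < b"
proof -
  obtain k :: nat where k: "1 / (b - a) < 2 ^ k"
    using real_arch_pow[of 2] by auto
  then have k': "1 < (b - a) * 2 ^ k" using assms by (simp add: field_simps)
  define m where "m = \<lfloor>a * 2 ^ k\<rfloor> + 1"
  have "a * 2 ^ k < m" "m \<le> a * 2 ^ k + 1" unfolding m_def by linarith+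
  then have "a * 2 ^ k < m" "m < b * 2 ^ k" using k' by (simp_all add: left_diff_distrib)
  then have "a < m / 2 ^ k" "m / 2 ^ k < b" by (simp_all add: field_simps)
  then show ?thesis using that dyadicsI by blast
qed

lemma half_power_le:
  fixes c :: real
  assumes "c > 0"
  obtains k :: nat where "1 / 2 ^ k < c"
  using real_arch_pow_inv[OF assms, of "1 / 2"] by (auto simp: power_divide)

text \<open>The positive units of Z[1/2] are the powers of 2: the numerators of \<open>c\<close> and
  \<open>1 / c\<close> multiply to a power of 2, so each divides one.\<close>

lemma dyadic_unit_power:
  assumes "c \<in> dyadics" "1 / c \<in> dyadics" "c > 0"
  obtains e i :: nat where "c = 2 ^ e / 2 ^ i"
proof -
  obtain m :: int and i where c: "c = m / 2 ^ i" using assms(1) by (auto simp: dyadics_def)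
  obtain n :: int and j where c': "1 / c = n / 2 ^ j" using assms(2) by (auto simp: dyadics_def)
  have "(m / 2 ^ i) * (n / 2 ^ j) = 1" using c c' assms(3) by (metis less_irrefl nonzero_mult_div_cancel_left times_divide_eq_right mult.right_neutral divide_self)
  then have "real_of_int (m * n) = real_of_int (2 ^ (i + j))" by (simp add: power_add field_simps)
  then have mn: "m * n = 2 ^ (i + j)" by (simp only: of_int_eq_iff)
  have "m > 0" using c assms(3) by (simp add: zero_less_divide_iff)
  then have "int (nat m) dvd int (2 ^ (i + j))" using mn by (metis dvd_triv_left int_nat_eq less_imp_le of_nat_numeral of_nat_power)
  then have "nat m dvd 2 ^ (i + j)" by (simp only: int_dvd_int_iff)
  then obtain e where "nat m = 2 ^ e" using divides_primepow_nat[OF two_is_prime_nat] by blast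
  then have "m = 2 ^ e" using \<open>m > 0\<close> by (metis int_nat_eq less_imp_le of_nat_numeral of_nat_power)
  then show ?thesis using c that by simp
qed

text \<open>Upgrades relations modulo 1 to local equalities, since integers closer than 1
  coincide.\<close>

lemma eventually_Ints_eq:
  fixes d :: "'a \<Rightarrow> real"
  assumes "(d \<longlongrightarrow> c) A" "c \<in> \<int>" "eventually (\<lambda>s. d s \<in> \<int>) A"
  shows "eventually (\<lambda>s. d s = c) A"
proof -
  have "eventually (\<lambda>s. dist (d s) c < 1) A" using assms(1) by (rule tendstoD) simp
  with assms(3) show ?thesis
  proof eventually_elim
    case (elim s)
    then have "d s - c \<in> \<int>" using assms(2) by (intro Ints_diff)
    then show ?case using elim Ints_nonzero_abs_ge1[of "d s - c"] by (force simp: dist_real_def)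
  qed
qed

section \<open>Lifts of elements of Thompson's group and their linear pieces\<close>

locale thompson_lift =
  fixes f :: "circle \<Rightarrow> circle" and F :: "real \<Rightarrow> real"
  assumes T: "f \<in> thompson_T" and lift: "is_lift F f" and strict: "strict_mono F"
begin

lemma circ_lift: "f (circ t) = circ (F t)"
  using lift by (simp add: is_lift_def)

lemma homeo: "orientation_preserving_homeo f"
  using T by (simp add: thompson_T_def)

lemma inj: "inj f"
  using homeo by (metis orientation_preserving_homeo_def homeomorphism_apply1 UNIV_I inj_onI)

lemma shift: "F (t + 1) = F t + 1"
  using homeo_lift_shift[OF homeo lift strict] .

lemma cont: "continuous_on X F"
  using lift continuous_on_subset by (auto simp: is_lift_def)

lemma dyadics_iff: "F t \<in> dyadics \<longleftrightarrow> t \<in> dyadics"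
proof -
  have "f ` dyadic = dyadic" using T by (auto simp: thompson_T_def bij_betw_def)
  then have "f (circ t) \<in> dyadic \<longleftrightarrow> circ t \<in> dyadic"
    using inj by (metis inj_image_mem_iff)
  then show ?thesis by (simp add: circ_lift circ_in_dyadic_iff)
qed

lemma locally_affine:
  assumes "circ t \<notin> break_points f"
  shows "\<exists>a. eventually (\<lambda>s. F s = F t + a * (s - t)) (nhds t)"
proof -
  obtain a \<epsilon> where a: "\<epsilon> > 0" "\<And>s. \<bar>s\<bar> < \<epsilon> \<Longrightarrow> f (circ t + circ s) = f (circ t) + circ (a * s)"
    using assms by (auto simp: break_points_def)
  define d where "d s = F s - (F t + a * (s - t))" for s
  have "d s \<in> \<int>" if "dist s t < \<epsilon>" for s
  proof -
    have "circ (F s) = circ (F t + a * (s - t))"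
      using a(2)[of "s - t"] that by (simp add: dist_real_def circ_lift flip: circ_add)
    then show ?thesis by (simp add: circ_eq_iff d_def)
  qed
  then have "eventually (\<lambda>s. d s \<in> \<int>) (nhds t)"
    using a(1) unfolding eventually_nhds_metric by blast
  moreover have "isCont d t"
    using cont[of UNIV] unfolding d_def by (intro continuous_intros) (simp add: continuous_on_eq_continuous_at)
  then have "(d \<longlongrightarrow> d t) (nhds t)" by (simp add: isCont_def tendsto_at_iff_tendsto_nhds)
  moreover have "d t = 0" by (simp add: d_def)
  ultimately have "eventually (\<lambda>s. d s = 0) (nhds t)" by (intro eventually_Ints_eq) auto
  then show ?thesis by (intro exI[of _ a]) (simp add: d_def)
qed

text \<open>The slope is locally constant inside, hence constant by connectedness, and continuity
  extends the formula to the ends. The closed interval matters because 0 may be an end that is a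
  break point.\<close>

lemma affine_piece:
  assumes "p < q" and br: "\<And>s. p < s \<Longrightarrow> s < q \<Longrightarrow> circ s \<notin> break_points f"
  obtains c where "c > 0" "\<And>s t. s \<in> {p..q} \<Longrightarrow> t \<in> {p..q} \<Longrightarrow> F s = F t + c * (s - t)"
proof -
  have loc: "\<exists>a. eventually (\<lambda>t. (F has_real_derivative a) (at t)) (nhds s)" if "s \<in> {p<..<q}" for s
  proof -
    have "circ s \<notin> break_points f" using br that by simp
    then obtain a where a: "eventually (\<lambda>u. F u = F s + a * (u - s)) (nhds s)"
      using locally_affine by blast
    then have "eventually (\<lambda>t. eventually (\<lambda>u. F u = F s + a * (u - s)) (nhds t)) (nhds s)"
      by (simp add: eventually_eventually)
    then have "eventually (\<lambda>t. (F has_real_derivative a) (at t)) (nhds s)"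
    proof eventually_elim
      case (elim t)
      have "((\<lambda>u. F s + a * (u - s)) has_real_derivative a) (at t)"
        by (auto intro!: derivative_eq_intros)
      then show ?case using DERIV_cong_ev[OF refl elim refl] by blast
    qed
    then show ?thesis by blast
  qed
  define m where "m = (p + q) / 2"
  define c where "c = deriv F m"
  have m: "m \<in> {p<..<q}" using assms(1) by (simp add: m_def)
  have const: "deriv F s = c" if "s \<in> {p<..<q}" for s
    unfolding c_def
  proof (rule connected_local_const[OF _ that m])
    show "connected {p<..<q}" by simp
    show "\<forall>s\<in>{p<..<q}. eventually (\<lambda>t. deriv F s = deriv F t) (at s within {p<..<q})"
    proof
      fix s assume "s \<in> {p<..<q}"
      then obtain a where a: "eventually (\<lambda>t. (F has_real_derivative a) (at t)) (nhds s)" using loc by blast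
      then have "deriv F s = a" using eventually_nhds_x_imp_x DERIV_imp_deriv by blast
      moreover have "eventually (\<lambda>t. deriv F t = a) (nhds s)"
        using a by eventually_elim (rule DERIV_imp_deriv)
      ultimately show "eventually (\<lambda>t. deriv F s = deriv F t) (at s within {p<..<q})"
        unfolding eventually_at_filter by (auto elim: eventually_mono)
    qed
  qed
  have D: "(F has_real_derivative c) (at s)" if "s \<in> {p<..<q}" for s
  proof -
    from loc[OF that] obtain a where "(F has_real_derivative a) (at s)"
      using eventually_nhds_x_imp_x by blast
    then show ?thesis using const[OF that] DERIV_imp_deriv by metis
  qed
  have zero: "F s - c * s = F p - c * p" if "s \<in> {p..q}" for s
  proof (rule DERIV_isconst2[OF assms(1)])
    show "continuous_on {p..q} (\<lambda>s. F s - c * s)" by (intro continuous_intros cont)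
    show "((\<lambda>s. F s - c * s) has_real_derivative 0) (at x)" if "p < x" "x < q" for x
      using D[of x] that by (auto intro!: derivative_eq_intros)
  qed (use that in auto)
  have eq: "F s = F t + c * (s - t)" if "s \<in> {p..q}" "t \<in> {p..q}" for s t
    using zero[OF that(1)] zero[OF that(2)] by (simp add: algebra_simps)
  moreover have "c > 0"
  proof -
    have "F p < F q" using assms(1) strict by (simp add: strict_mono_less)
    then have "0 < c * (q - p)" using eq[of q p] assms(1) by simp
    then show ?thesis using assms(1) by (simp add: zero_less_mult_iff)
  qed
  ultimately show ?thesis using that by blast
qed

text \<open>The relation says that on the circle the piece is a branch of the \<open>k\<close>-fold
  inverse doubling after the \<open>l\<close>-fold doubling, without choosing the branch. The slope
  is a power of 2 because it and its inverse are dyadic.\<close>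

lemma dyadic_piece:
  assumes "p < q" and br: "\<And>s. p < s \<Longrightarrow> s < q \<Longrightarrow> circ s \<notin> break_points f"
  shows "\<exists>k l. \<forall>s\<in>{p..q}. 2 ^ k * F s - 2 ^ l * s \<in> \<int>"
proof -
  obtain c where c: "c > 0" and aff: "\<And>s t. s \<in> {p..q} \<Longrightarrow> t \<in> {p..q} \<Longrightarrow> F s = F t + c * (s - t)"
    using affine_piece[OF assms] by blast
  obtain a where a: "a \<in> dyadics" "p < a" "a < q" using dyadics_dense[OF assms(1)] by blast
  have Fa: "F a \<in> dyadics" using a by (simp add: dyadics_iff)
  \<comment> \<open>A small dyadic step in the domain has a dyadic image.\<close>
  have "c \<in> dyadics"
  proof -
    obtain k :: nat where k: "1 / 2 ^ k < q - a" using half_power_le[of "q - a"] a by auto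
    have "0 < 1 / (2::real) ^ k" by simp
    then have "a + 1 / 2 ^ k \<in> {p..q}" unfolding atLeastAtMost_iff using a k by linarith
    then have "F (a + 1 / 2 ^ k) = F a + c * (1 / 2 ^ k)" using aff[of "a + 1 / 2 ^ k" a] a by simp
    moreover have "F (a + 1 / 2 ^ k) \<in> dyadics" using a by (simp add: dyadics_iff dyadics_add dyadics_half_power)
    ultimately have "c * (1 / 2 ^ k) \<in> dyadics" using Fa dyadics_diff[of "F (a + 1 / 2 ^ k)" "F a"] by simp
    moreover have "(2::real) ^ k \<in> dyadics" by (rule dyadics_Ints) simp
    ultimately have "c * (1 / 2 ^ k) * 2 ^ k \<in> dyadics" by (rule dyadics_mult)
    then show ?thesis by simp
  qed
  \<comment> \<open>Conversely, a small dyadic step in the range has a dyadic preimage.\<close>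
  moreover have "1 / c \<in> dyadics"
  proof -
    obtain k :: nat where k: "1 / 2 ^ k < c * (q - a)" using half_power_le[of "c * (q - a)"] a c by auto
    define z where "z = a + 1 / (c * 2 ^ k)"
    have "z < q" using k c by (simp add: z_def field_simps)
    moreover have "a < z" using c by (simp add: z_def)
    ultimately have "F z = F a + c * (z - a)" using a by (intro aff) auto
    also have "c * (z - a) = 1 / 2 ^ k" using c by (simp add: z_def)
    finally have "F z = F a + 1 / 2 ^ k" .
    then have "F z \<in> dyadics" using Fa by (simp add: dyadics_add dyadics_half_power)
    then have "z - a \<in> dyadics" using a by (simp add: dyadics_iff dyadics_diff)
    moreover have "(2::real) ^ k \<in> dyadics" by (rule dyadics_Ints) simp
    ultimately have "(z - a) * 2 ^ k \<in> dyadics" by (rule dyadics_mult)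
    then show ?thesis by (simp add: z_def)
  qed
  ultimately obtain e i where ei: "c = 2 ^ e / 2 ^ i" using c dyadic_unit_power by blast
  obtain A u where A: "a = of_int A / 2 ^ u" using a(1) by (auto simp: dyadics_def)
  obtain B v where B: "F a = of_int B / 2 ^ v" using Fa by (auto simp: dyadics_def)
  \<comment> \<open>The surplus \<open>u + v\<close> in both exponents clears the denominators of
    \<open>a\<close> and \<open>F a\<close>.\<close>
  have "2 ^ (i + u + v) * F s - 2 ^ (e + u + v) * s \<in> \<int>" if "s \<in> {p..q}" for s
  proof -
    have Fs: "F s = of_int B / 2 ^ v + c * (s - a)" using aff[OF that, of a] a B by simp
    have "2 ^ (i + u + v) * F s - 2 ^ (e + u + v) * s = 2 ^ (i + u) * of_int B - 2 ^ (e + v) * of_int A"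
      by (simp add: Fs A ei power_add field_simps)
    also have "\<dots> \<in> \<int>" by (intro Ints_diff Ints_mult Ints_power) auto
    finally show ?thesis .
  qed
  then show ?thesis by blast
qed

lemma finite_breaks: "finite {s \<in> {0..1}. circ s \<in> break_points f}"
proof -
  have inj: "inj_on circ {0..<1}"
  proof (rule inj_onI)
    fix s t :: real assume *: "s \<in> {0..<1}" "t \<in> {0..<1}" "circ s = circ t"
    then show "s = t" using Ints_nonzero_abs_ge1[of "s - t"] by (force simp: circ_eq_iff)
  qed
  have "finite (circ -` break_points f \<inter> {0..<1})"
    using T inj by (intro finite_vimage_IntI) (auto simp: thompson_T_def)
  moreover have "{s \<in> {0..1}. circ s \<in> break_points f} \<subseteq> insert 1 (circ -` break_points f \<inter> {0..<1})"
    by auto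
  ultimately show ?thesis using finite_subset by blast
qed

lemma break_dyadics: "circ s \<in> break_points f \<Longrightarrow> s \<in> dyadics"
  using T by (auto simp: thompson_T_def simp flip: circ_in_dyadic_iff)

text \<open>One exponent \<open>l\<close> serves for all points, since there are finitely many pieces and both
  exponents can be raised together.\<close>

lemma uniform_exponent:
  "\<exists>l. \<forall>s. s \<notin> dyadics \<longrightarrow> (\<exists>k. eventually (\<lambda>t. 2 ^ k * F t - 2 ^ l * t \<in> \<int>) (nhds s))"
proof -
  \<comment> \<open>The points 0 and 1 give every point of the open unit interval a neighbour in
    \<open>B\<close> on either side.\<close>
  define B where "B = insert 0 (insert 1 {s \<in> {0..1}. circ s \<in> break_points f})"
  have finB: "finite B" using finite_breaks by (simp add: B_def)
  define Q where "Q l p q \<longleftrightarrow> (\<exists>k. \<forall>s\<in>{p..q}. 2 ^ k * F s - 2 ^ l * s \<in> \<int>)" for l :: nat and p q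
  have Q_mono: "Q l' p q" if "Q l p q" "l \<le> l'" for l l' p q
  proof -
    from that(1) obtain k where k: "\<And>s. s \<in> {p..q} \<Longrightarrow> 2 ^ k * F s - 2 ^ l * s \<in> \<int>"
      unfolding Q_def by blast
    have "2 ^ (k + (l' - l)) * F s - 2 ^ l' * s \<in> \<int>" if "s \<in> {p..q}" for s
    proof -
      have "2 ^ (k + (l' - l)) * F s - 2 ^ l' * s = 2 ^ (l' - l) * (2 ^ k * F s - 2 ^ l * s)"
        using \<open>l \<le> l'\<close> by (simp add: power_add algebra_simps flip: power_add)
      also have "\<dots> \<in> \<int>" using k[OF that] by (intro Ints_mult Ints_power) auto
      finally show ?thesis .
    qed
    then show ?thesis unfolding Q_def by blast
  qed
  define ok where "ok = {(p, q) \<in> B \<times> B. \<exists>l. Q l p q}"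
  have "finite ok" using finB by (auto simp: ok_def intro: finite_subset[of _ "B \<times> B"])
  have "\<forall>z\<in>ok. \<exists>l. Q l (fst z) (snd z)" by (auto simp: ok_def)
  then obtain l where l: "\<And>z. z \<in> ok \<Longrightarrow> Q (l z) (fst z) (snd z)" by metis
  define M where "M = Max (insert 0 (l ` ok))"
  have M: "Q M p q" if "(p, q) \<in> ok" for p q
    using Q_mono[OF l[OF that]] \<open>finite ok\<close> that by (auto simp: M_def)
  have "\<exists>k. eventually (\<lambda>t. 2 ^ k * F t - 2 ^ M * t \<in> \<int>) (nhds s)" if "s \<notin> dyadics" for s
  proof -
    define n :: real where "n = of_int \<lfloor>s\<rfloor>"
    define x where "x = s - n"
    have n: "n \<in> \<int>" by (simp add: n_def)
    have x: "x \<notin> dyadics" using that dyadics_add_iff[OF dyadics_Ints[OF n], of x] by (simp add: x_def)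
    have x01: "0 \<le> x" "x < 1" unfolding x_def n_def by linarith+
    moreover have "x \<noteq> 0" using x dyadics_Ints[of 0] by auto
    ultimately have x01: "0 < x" "x < 1" by auto
    have xb: "x \<notin> B" using x x01 break_dyadics by (auto simp: B_def)
    define p where "p = Max {b \<in> B. b < x}"
    define q where "q = Min {b \<in> B. x < b}"
    have p: "p \<in> {b \<in> B. b < x}" unfolding p_def
      using finB x01 by (intro Max_in) (auto simp: B_def)
    have q: "q \<in> {b \<in> B. x < b}" unfolding q_def
      using finB x01 by (intro Min_in) (auto simp: B_def)
    have pq: "p < x" "x < q" "0 \<le> p" "q \<le> 1" using p q by (auto simp: B_def)
    have nobreak: "circ u \<notin> break_points f" if u: "p < u" "u < q" for u
    proof
      assume "circ u \<in> break_points f"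
      then have "u \<in> B" using u pq by (auto simp: B_def)
      then have "u \<noteq> x" using xb by auto
      then consider "u < x" | "x < u" by linarith
      then show False
      proof cases
        case 1
        then have "u \<le> p" unfolding p_def using \<open>u \<in> B\<close> finB by (intro Max_ge) auto
        then show False using u by simp
      next
        case 2
        then have "q \<le> u" unfolding q_def using \<open>u \<in> B\<close> finB by (intro Min_le) auto
        then show False using u by simp
      qed
    qed
    have "\<exists>k l. \<forall>s\<in>{p..q}. 2 ^ k * F s - 2 ^ l * s \<in> \<int>"
      using pq by (intro dyadic_piece nobreak) auto
    then have "(p, q) \<in> ok" using p q by (auto simp: ok_def Q_def)
    from M[OF this] obtain k where k: "\<And>u. u \<in> {p..q} \<Longrightarrow> 2 ^ k * F u - 2 ^ M * u \<in> \<int>"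
      unfolding Q_def by blast
    have "eventually (\<lambda>t. t \<in> {p + n<..<q + n}) (nhds s)"
      using pq by (intro eventually_nhds_in_open) (auto simp: x_def)
    then have "eventually (\<lambda>t. 2 ^ k * F t - 2 ^ M * t \<in> \<int>) (nhds s)"
    proof eventually_elim
      case (elim t)
      have "F t = F (t - n) + n" using equivariant_of_int[of F 1 "t - n" "\<lfloor>s\<rfloor>"] shift by (simp add: n_def)
      then have "2 ^ k * F t - 2 ^ M * t = (2 ^ k * F (t - n) - 2 ^ M * (t - n)) + (2 ^ k * n - 2 ^ M * n)"
        by (simp add: algebra_simps)
      also have "\<dots> \<in> \<int>" using elim n by (intro Ints_add Ints_diff k Ints_mult Ints_power) auto
      finally show ?case .
    qed
    then show ?thesis by blast
  qed
  then show ?thesis by blast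
qed

text \<open>Zero may be a break point, so its two sides get separate exponents. All other break
  points keep a positive distance, by finiteness.\<close>

lemma pieces_at_0:
  "\<exists>e>0. (\<exists>k l. \<forall>s\<in>{0..e}. 2 ^ k * F s - 2 ^ l * s \<in> \<int>) \<and> (\<exists>k l. \<forall>s\<in>{- e..0}. 2 ^ k * F s - 2 ^ l * s \<in> \<int>)"
proof -
  have "finite (break_points f - {0})" using T by (simp add: thompson_T_def)
  then have "open (- (break_points f - {0}))" using finite_imp_closed open_Compl by blast
  then have "eventually (\<lambda>x. x \<in> - (break_points f - {0})) (nhds (circ 0))"
    by (intro eventually_nhds_in_open) auto
  then obtain e where e: "e > 0" "\<And>s. dist s 0 < e \<Longrightarrow> circ s \<notin> break_points f - {0}"
    unfolding nhds_circ eventually_filtermap eventually_nhds_metric by auto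
  define d where "d = min e 1"
  have d: "d > 0" using e by (simp add: d_def)
  have nb: "circ s \<notin> break_points f" if "0 < \<bar>s\<bar>" "\<bar>s\<bar> < d" for s
  proof -
    have "circ s \<noteq> 0" using that Ints_nonzero_abs_ge1[of s] by (auto simp: circ_eq_0_iff d_def)
    then show ?thesis using e(2)[of s] that by (auto simp: d_def dist_real_def)
  qed
  have "\<exists>k l. \<forall>s\<in>{0..d}. 2 ^ k * F s - 2 ^ l * s \<in> \<int>" "\<exists>k l. \<forall>s\<in>{- d..0}. 2 ^ k * F s - 2 ^ l * s \<in> \<int>"
    by (rule dyadic_piece; use d nb in auto)+
  then show ?thesis using d by blast
qed

end

text \<open>\<open>B\<close> may exceed the set of break points, so candidates can be listed without
  checking that the slope really changes there.\<close>

lemma thompson_TI: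
  assumes strict: "strict_mono F" and surj: "surj F" and F1: "\<And>t. F (t + 1) = F t + 1"
    and dy: "\<And>t. F t \<in> dyadics \<longleftrightarrow> t \<in> dyadics"
    and B: "finite B" "B \<subseteq> dyadics"
    and aff: "\<And>t. t \<in> {0..<1} \<Longrightarrow> t \<notin> B \<Longrightarrow> \<exists>a c. eventually (\<lambda>s. F s = a * s + c) (nhds t)"
  shows "circle_map F \<in> thompson_T"
proof -
  have circ: "circle_map F (circ t) = circ (F t)" for t by (rule circle_map_circ[of F, OF F1])
  have dyadic_iff: "circle_map F x \<in> dyadic \<longleftrightarrow> x \<in> dyadic" for x
    using circ_surj[of x] dy by (auto simp: circ circ_in_dyadic_iff)
  have homeo: "orientation_preserving_homeo (circle_map F)"
    by (rule circle_map_homeo(1)[OF strict surj F1])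
  then obtain g where g: "homeomorphism UNIV UNIV (circle_map F) g"
    by (auto simp: orientation_preserving_homeo_def)
  have inj: "inj (circle_map F)" using g by (metis homeomorphism_apply1 UNIV_I inj_onI)
  have "circle_map F ` dyadic = dyadic"
    using dyadic_iff homeomorphism_apply2[OF g] by (auto simp: image_iff) (metis UNIV_I)
  then have bij: "bij_betw (circle_map F) dyadic dyadic"
    using inj by (auto simp: bij_betw_def intro: inj_on_subset)
  have br: "break_points (circle_map F) \<subseteq> circ ` B"
  proof
    fix x assume x: "x \<in> break_points (circle_map F)"
    obtain t where t: "t \<in> {0..<1}" "x = circ t" using circ_representative by blast
    have "t \<in> B"
    proof (rule ccontr)
      assume "t \<notin> B"
      then obtain a c where "eventually (\<lambda>s. F s = a * s + c) (nhds t)" using aff t by blast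
      then obtain e where e: "e > 0" "\<And>s. dist s t < e \<Longrightarrow> F s = a * s + c"
        by (auto simp: eventually_nhds_metric)
      have "circle_map F (x + circ s) = circle_map F x + circ (a * s)" if "\<bar>s\<bar> < e" for s
        using e(2)[of "t + s"] e(2)[of t] e(1) that
        by (simp add: t circ dist_real_def algebra_simps flip: circ_add)
      then show False using x e(1) by (auto simp: break_points_def)
    qed
    then show "x \<in> circ ` B" using t by blast
  qed
  moreover have "circ ` B \<subseteq> dyadic" using B(2) by (auto simp: circ_in_dyadic_iff)
  ultimately have "finite (break_points (circle_map F))" "break_points (circle_map F) \<subseteq> dyadic"
    using B(1) finite_subset by blast+
  then show ?thesis using homeo bij dyadic_iff by (auto simp: thompson_T_def)
qed

section \<open>Explicit elements of Thompson's group\<close>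

lemma rotation_in_T:
  assumes "a \<in> dyadics"
  shows "circle_map (\<lambda>t. t + a) \<in> thompson_T"
proof (rule thompson_TI[where B = "{}"])
  show "strict_mono (\<lambda>t. t + a)" by (simp add: strict_mono_def)
  show "surj (\<lambda>t. t + a)" by (metis diff_add_cancel surjI)
  show "\<exists>b c. eventually (\<lambda>s. s + a = b * s + c) (nhds t)" for t
    by (intro exI[of _ 1] exI[of _ a]) simp
qed (auto simp: dyadics_add_iff[OF assms])

text \<open>The standard generator A of Thompson's group F on the unit interval, with slopes 1/2, 1
  and 2.\<close>

definition thompson_A0 :: "real \<Rightarrow> real" where
  "thompson_A0 u = (if u \<le> 1/2 then u / 2 else if u \<le> 3/4 then u - 1/4 else 2 * u - 1)"

definition thompson_A :: "real \<Rightarrow> real" where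
  "thompson_A t = of_int \<lfloor>t\<rfloor> + thompson_A0 (frac t)"

lemma thompson_A0_bounds: "u \<in> {0..<1} \<Longrightarrow> thompson_A0 u \<in> {0..<1}"
  by (auto simp: thompson_A0_def)

lemma thompson_A_strict: "strict_mono thompson_A"
proof (rule strict_monoI)
  fix s t :: real assume st: "s < t"
  show "thompson_A s < thompson_A t"
  proof (cases "\<lfloor>s\<rfloor> = \<lfloor>t\<rfloor>")
    case True
    then have "frac s < frac t" using st by (simp add: frac_def)
    then show ?thesis using True by (auto simp: thompson_A_def thompson_A0_def)
  next
    case False
    then have "\<lfloor>s\<rfloor> < \<lfloor>t\<rfloor>" using floor_mono[of s t] st by simp
    then have "real_of_int \<lfloor>s\<rfloor> + 1 \<le> of_int \<lfloor>t\<rfloor>" by linarith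
    moreover have "thompson_A0 (frac s) < 1" "0 \<le> thompson_A0 (frac t)"
      using thompson_A0_bounds[of "frac s"] thompson_A0_bounds[of "frac t"] by (auto simp: frac_lt_1)
    ultimately show ?thesis by (simp add: thompson_A_def)
  qed
qed

lemma thompson_A_shift: "thompson_A (t + 1) = thompson_A t + 1"
  by (simp add: thompson_A_def frac_def)

lemma thompson_A_unit: "u \<in> {0..<1} \<Longrightarrow> thompson_A (of_int n + u) = of_int n + thompson_A0 u"
proof -
  assume "u \<in> {0..<1}"
  then have "\<lfloor>of_int n + u\<rfloor> = n" by (intro floor_unique) auto
  then show ?thesis by (simp add: thompson_A_def frac_def)
qed

lemma thompson_A_surj: "surj thompson_A"
proof -
  have "\<exists>t. thompson_A t = v" for v
  proof -
    define w where "w = frac v"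
    define u where "u = (if w \<le> 1/4 then 2 * w else if w \<le> 1/2 then w + 1/4 else w / 2 + 1 / 2)"
    have w: "0 \<le> w" "w < 1" "v = of_int \<lfloor>v\<rfloor> + w"
      unfolding w_def by (simp_all add: frac_lt_1) (simp add: frac_def)
    have "u \<in> {0..<1}" "thompson_A0 u = w" using w by (auto simp: u_def thompson_A0_def)
    then show ?thesis using thompson_A_unit[of u "\<lfloor>v\<rfloor>"] w(3) by metis
  qed
  then show ?thesis by (metis surjI)
qed

lemma thompson_A_dyadics: "thompson_A t \<in> dyadics \<longleftrightarrow> t \<in> dyadics"
proof -
  have half: "u / 2 \<in> dyadics \<longleftrightarrow> u \<in> dyadics" "2 * u \<in> dyadics \<longleftrightarrow> u \<in> dyadics" for u
    using dyadics_scale_iff[of "1/2" u] dyadics_scale_iff[of 2 u] dyadics_half_power[of 1] dyadics_Ints[of 2] by auto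
  have quarter: "u - 1/4 \<in> dyadics \<longleftrightarrow> u \<in> dyadics" for u
    using dyadics_add_iff[of "1/4" "u - 1/4"] dyadics_half_power[of 2] by simp
  have one: "u - 1 \<in> dyadics \<longleftrightarrow> u \<in> dyadics" for u
    using dyadics_add_iff[of 1 "u - 1"] dyadics_Ints[of 1] by simp
  have "thompson_A0 u \<in> dyadics \<longleftrightarrow> u \<in> dyadics" for u
    by (simp add: thompson_A0_def half quarter one)
  moreover have n: "of_int \<lfloor>t\<rfloor> \<in> dyadics" by (rule dyadics_Ints) simp
  have "frac t \<in> dyadics \<longleftrightarrow> t \<in> dyadics"
    using dyadics_add_iff[OF n, of "frac t"] by (simp add: frac_def)
  moreover have "thompson_A t \<in> dyadics \<longleftrightarrow> thompson_A0 (frac t) \<in> dyadics"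
    using dyadics_add_iff[OF n, of "thompson_A0 (frac t)"] by (simp add: thompson_A_def add.commute)
  ultimately show ?thesis by simp
qed

lemma thompson_A_affine:
  fixes n :: int
  shows "t \<in> {n<..<n + 1/2} \<Longrightarrow> eventually (\<lambda>s. thompson_A s = 1/2 * s + of_int n / 2) (nhds t)"
    and "t \<in> {n + 1/2<..<n + 3/4} \<Longrightarrow> eventually (\<lambda>s. thompson_A s = 1 * s + - 1/4) (nhds t)"
    and "t \<in> {n + 3/4<..<n + 1} \<Longrightarrow> eventually (\<lambda>s. thompson_A s = 2 * s + (- 1 - of_int n)) (nhds t)"
proof -
  have A: "thompson_A s = of_int n + thompson_A0 (s - of_int n)" if "s \<in> {real_of_int n..<n + 1}" for s
    using thompson_A_unit[of "s - of_int n" n] that by auto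
  show "eventually (\<lambda>s. thompson_A s = 1/2 * s + of_int n / 2) (nhds t)" if "t \<in> {n<..<n + 1/2}"
    using eventually_nhds_in_open[OF open_greaterThanLessThan that]
    by eventually_elim (simp add: A thompson_A0_def field_simps)
  show "eventually (\<lambda>s. thompson_A s = 1 * s + - 1/4) (nhds t)" if "t \<in> {n + 1/2<..<n + 3/4}"
    using eventually_nhds_in_open[OF open_greaterThanLessThan that]
    by eventually_elim (simp add: A thompson_A0_def field_simps)
  show "eventually (\<lambda>s. thompson_A s = 2 * s + (- 1 - of_int n)) (nhds t)" if "t \<in> {n + 3/4<..<n + 1}"
    using eventually_nhds_in_open[OF open_greaterThanLessThan that]
    by eventually_elim (simp add: A thompson_A0_def field_simps)
qed

text \<open>A dyadic rotation moves the piece of \<open>thompson_A\<close> of slope \<open>2\<close> to any given point.\<close>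

lemma thompson_doubling:
  "\<exists>F n. circle_map F \<in> thompson_T \<and> is_lift F (circle_map F) \<and> strict_mono F \<and> n \<in> \<int> \<and>
     eventually (\<lambda>s. F s = 2 * s + n) (nhds t)"
proof -
  \<comment> \<open>This puts \<open>t + a\<close> into the interval from 3/4 to 1, where
    \<open>thompson_A\<close> has slope 2.\<close>
  obtain a where a: "a \<in> dyadics" "3/4 - t < a" "a < 1 - t"
    using dyadics_dense[of "3/4 - t" "1 - t"] by auto
  \<comment> \<open>Near \<open>t\<close> the first term is \<open>2 * s + 2 * a - 1\<close>.
    Subtracting \<open>2 * a\<close> leaves an integer constant, so that \<open>F\<close> induces
    the doubling map itself.\<close>
  define F where "F s = thompson_A (s + a) - 2 * a" for s
  have a2: "2 * a \<in> dyadics" using a(1) dyadics_mult dyadics_Ints[of 2] by auto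
  have strict: "strict_mono F" using thompson_A_strict by (simp add: F_def strict_mono_def)
  have surj: "surj F"
  proof -
    have "\<exists>s. F s = v" for v
    proof -
      obtain w where "thompson_A w = v + 2 * a" using thompson_A_surj by (metis surjD)
      then show ?thesis by (intro exI[of _ "w - a"]) (simp add: F_def)
    qed
    then show ?thesis by (metis surjI)
  qed
  have F1: "F (s + 1) = F s + 1" for s using thompson_A_shift[of "s + a"] by (simp add: F_def add_ac)
  define B where "B = {s \<in> {0..<1}. frac (s + a) \<in> {0, 1/2, 3/4}}"
  have Bd: "B \<subseteq> dyadics"
  proof
    fix s assume "s \<in> B"
    then have "frac (s + a) \<in> {0, 1/2, 3/4}" unfolding B_def by blast
    moreover have "{0, 1/2, 3/4} \<subseteq> dyadics"
      using dyadics_Ints[of 0] dyadics_half_power[of 1] dyadicsI[of 3 2] by simp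
    ultimately have "frac (s + a) \<in> dyadics" by blast
    then have "frac (s + a) + (of_int \<lfloor>s + a\<rfloor> - a) \<in> dyadics"
      using a(1) by (intro dyadics_add dyadics_diff) (auto intro: dyadics_Ints)
    then show "s \<in> dyadics" by (simp add: frac_def)
  qed
  have "finite B"
  proof (rule finite_subset)
    show "B \<subseteq> (\<lambda>(m, q). of_int m + q - a) ` ({\<lfloor>a\<rfloor>..\<lfloor>a\<rfloor> + 1} \<times> {0, 1/2, 3/4})"
    proof
      fix s assume s: "s \<in> B"
      then have "\<lfloor>a\<rfloor> \<le> \<lfloor>s + a\<rfloor>" "\<lfloor>s + a\<rfloor> \<le> \<lfloor>a\<rfloor> + 1" by (auto simp: B_def) linarith+
      moreover have "s = of_int \<lfloor>s + a\<rfloor> + frac (s + a) - a" by (simp add: frac_def)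
      ultimately show "s \<in> (\<lambda>(m, q). of_int m + q - a) ` ({\<lfloor>a\<rfloor>..\<lfloor>a\<rfloor> + 1} \<times> {0, 1/2, 3/4})"
        using s by (intro image_eqI[of _ _ "(\<lfloor>s + a\<rfloor>, frac (s + a))"]) (auto simp: B_def)
    qed
  qed simp
  have shift_ev: "\<exists>b c. eventually (\<lambda>s. F s = b * s + c) (nhds s)"
    if "eventually (\<lambda>s. thompson_A s = b * s + c) (nhds (s + a))" for s b c
  proof -
    have "filterlim (\<lambda>s. s + a) (nhds (s + a)) (nhds s)"
      by (intro tendsto_intros filterlim_ident)
    from eventually_compose_filterlim[OF that this]
    have "eventually (\<lambda>s. F s = b * s + (b * a + c - 2 * a)) (nhds s)"
      by eventually_elim (simp add: F_def algebra_simps)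
    then show ?thesis by blast
  qed
  have "circle_map F \<in> thompson_T"
  proof (rule thompson_TI[OF strict surj F1 _ \<open>finite B\<close> Bd])
    show "F s \<in> dyadics \<longleftrightarrow> s \<in> dyadics" for s
      using dyadics_add_iff[OF a2, of "F s"] by (simp add: F_def thompson_A_dyadics dyadics_add_iff[OF a(1)])
    fix s assume s: "s \<in> {0..<1}" "s \<notin> B"
    define m where "m = \<lfloor>s + a\<rfloor>"
    have "frac (s + a) \<notin> {0, 1/2, 3/4}" using s by (auto simp: B_def)
    then have ne: "s + a \<noteq> m" "s + a \<noteq> m + 1/2" "s + a \<noteq> m + 3/4" by (auto simp: m_def frac_def)
    moreover have "m \<le> s + a" "s + a < m + 1" unfolding m_def by linarith+
    ultimately consider "s + a \<in> {m<..<m + 1/2}" | "s + a \<in> {m + 1/2<..<m + 3/4}" | "s + a \<in> {m + 3/4<..<m + 1}"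
      by force
    then show "\<exists>b c. eventually (\<lambda>s. F s = b * s + c) (nhds s)"
    proof cases
      case 1
      then show ?thesis by (intro shift_ev[OF thompson_A_affine(1)])
    next
      case 2
      then show ?thesis by (intro shift_ev[OF thompson_A_affine(2)])
    next
      case 3
      then show ?thesis by (intro shift_ev[OF thompson_A_affine(3)])
    qed
  qed
  moreover have "is_lift F (circle_map F)" by (rule circle_map_homeo(2)[OF strict surj F1])
  moreover have "eventually (\<lambda>s. F s = 2 * s + (- 1)) (nhds t)"
  proof -
    have lim: "filterlim (\<lambda>s. s + a) (nhds (t + a)) (nhds t)"
      by (intro tendsto_intros filterlim_ident)
    have "eventually (\<lambda>s. thompson_A s = 2 * s + (- 1 - of_int 0)) (nhds (t + a))"
      using a by (intro thompson_A_affine(3)) auto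
    from eventually_compose_filterlim[OF this lim] show ?thesis
      by eventually_elim (simp add: F_def)
  qed
  ultimately show ?thesis using strict by (intro exI[of _ F] exI[of _ "- 1"]) auto
qed

section \<open>The action\<close>

context ghys_sergiescu
begin

abbreviation "h \<equiv> doubling_conjugacy \<phi>"

lemma phi_circ: "\<phi> (circ t) = circ (\<Phi> t)"
  using lift by (simp add: is_lift_def)

lemma h_circ: "h (circ t) = circ (K t)"
  using conj_lift by (simp add: is_lift_def)

lemma K_shift: "K (t + 1) = K t + 1"
  by (rule homeo_lift_shift[OF conj_homeo conj_lift strict_K])

lemma K_shift_Ints: "n \<in> \<int> \<Longrightarrow> K (t + n) = K t + n"
  using equivariant_of_int[of K 1] K_shift by (elim Ints_cases) auto

lemma continuous_K: "continuous_on X K"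
  using conj_lift continuous_on_subset by (auto simp: is_lift_def)

lemma surj_K: "surj K"
  by (rule surj_equivariant[OF continuous_K, of 1]) (simp_all add: K_shift)

definition H where "H = inv K"

lemma HK [simp]: "H (K t) = t" "K (H t) = t"
  using strict_K surj_K by (simp_all add: H_def surj_f_inv_f inv_f_f strict_mono_imp_inj_on)

lemma strict_H: "strict_mono H"
  using strict_K HK(2) by (metis strict_mono_less strict_monoI)

lemma continuous_H: "continuous_on X H"
proof -
  have "surj H" by (metis HK(1) surjI)
  then show ?thesis using continuous_strict_mono_surj[OF strict_H] continuous_on_subset by blast
qed

lemma H_0: "H 0 = 0"
  by (metis HK(1) K_0)

lemma h_homeomorphism: "homeomorphism UNIV UNIV h (inv h)"
proof -
  obtain g where g: "homeomorphism UNIV UNIV h g"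
    using conj_homeo by (auto simp: orientation_preserving_homeo_def)
  then have "inv h = g"
    by (intro inv_unique_comp) (auto simp: fun_eq_iff homeomorphism_apply1 homeomorphism_apply2)
  then show ?thesis using g by simp
qed

lemma inv_h [simp]: "inv h (h x) = x" "h (inv h x) = x"
  using homeomorphism_apply1[OF h_homeomorphism, of x] homeomorphism_apply2[OF h_homeomorphism, of x] by simp_all

lemma inv_h_circ: "inv h (circ t) = circ (H t)"
  by (metis HK(2) h_circ inv_h(1))

lemma K_double_iterate: "K (2 ^ k * t) = (\<Phi> ^^ k) (K t)"
proof (induction k)
  case (Suc k)
  have "K (2 ^ Suc k * t) = K (2 * (2 ^ k * t))" by (simp add: mult.assoc)
  then show ?case using Suc by (simp only: K_double) simp
qed simp

lemma phi_iterate: "(\<phi> ^^ k) (circ t) = circ ((\<Phi> ^^ k) t)"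
  by (induction k) (simp_all add: phi_circ)

lemma gs_action_lift:
  assumes "is_lift F f"
  shows "is_lift (\<lambda>t. K (F (H t))) (gs_action \<phi> f)"
proof -
  have "continuous_on UNIV F" "\<And>t. f (circ t) = circ (F t)"
    using assms by (simp_all add: is_lift_def)
  moreover from this(1) have "continuous_on UNIV (\<lambda>t. K (F (H t)))"
    by (intro continuous_on_compose2[OF continuous_K[of UNIV]] continuous_on_compose2[OF _ continuous_H]) auto
  ultimately show ?thesis by (simp add: is_lift_def gs_action_def inv_h_circ h_circ)
qed

section \<open>Derivatives of local branches\<close>

lemma deriv_lift_iterate: "((\<Phi> ^^ k) has_real_derivative exp (log_deriv k t)) (at t)"
proof (induction k)
  case 0
  show ?case by (simp add: log_deriv_def id_def)
next
  case (Suc k)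
  have "((\<lambda>t. \<Phi> ((\<Phi> ^^ k) t)) has_real_derivative \<Phi>' ((\<Phi> ^^ k) t) * exp (log_deriv k t)) (at t)"
    by (rule DERIV_chain2[OF deriv Suc])
  moreover have "\<Phi>' ((\<Phi> ^^ k) t) = exp (ln (\<Phi>' ((\<Phi> ^^ k) t)))"
    using deriv_ge[of "(\<Phi> ^^ k) t"] by simp
  ultimately show ?case by (simp add: log_deriv_def exp_add mult.commute)
qed

lemma inverse_iterate: "(\<Psi> ^^ k) ((\<Phi> ^^ k) t) = t"
  by (induction k arbitrary: t) (simp_all add: funpow_swap1)

lemma deriv_inverse_iterate: "((\<Psi> ^^ k) has_real_derivative exp (- log_deriv k t)) (at ((\<Phi> ^^ k) t))"
proof -
  have "log_deriv k t = (\<Sum>j=1..k. ln (\<Phi>' ((\<Psi> ^^ j) ((\<Phi> ^^ k) t))))"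
    using log_deriv_branch[of 0 k 0 "(\<Phi> ^^ k) t"] by (simp add: \<psi>_0_iterate inverse_iterate log_deriv_def)
  then show ?thesis using deriv_iterate[of k "(\<Phi> ^^ k) t"] by simp
qed

text \<open>Applying \<open>\<Psi> ^^ k\<close> solves the relation for \<open>G\<close>. The set
  \<open>X\<close> allows one-sided derivatives, needed at 0.\<close>

lemma deriv_of_local_branch:
  assumes "eventually (\<lambda>s. (\<Phi> ^^ k) (G s) = (\<Phi> ^^ l) s + n) (at t within X)"
    and "(\<Phi> ^^ k) (G t) = (\<Phi> ^^ l) t + n"
  shows "(G has_real_derivative exp (log_deriv l t - log_deriv k (G t))) (at t within X)"
proof -
  have "((\<lambda>s. (\<Phi> ^^ l) s + n) has_real_derivative exp (log_deriv l t)) (at t within X)"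
    using has_field_derivative_at_within[OF deriv_lift_iterate] by (auto intro!: derivative_eq_intros)
  moreover have "((\<Psi> ^^ k) has_real_derivative exp (- log_deriv k (G t))) (at ((\<Phi> ^^ l) t + n))"
    using deriv_inverse_iterate[of k "G t"] by (simp add: assms(2))
  ultimately have "((\<lambda>s. (\<Psi> ^^ k) ((\<Phi> ^^ l) s + n)) has_real_derivative exp (- log_deriv k (G t)) * exp (log_deriv l t)) (at t within X)"
    by (rule DERIV_chain2[rotated])
  then have D: "((\<lambda>s. (\<Psi> ^^ k) ((\<Phi> ^^ l) s + n)) has_real_derivative exp (log_deriv l t - log_deriv k (G t))) (at t within X)"
    by (simp add: exp_diff exp_minus field_simps)
  have "eventually (\<lambda>s. G s = (\<Psi> ^^ k) ((\<Phi> ^^ l) s + n)) (at t within X)"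
    using assms(1) by eventually_elim (metis inverse_iterate)
  moreover have "G t = (\<Psi> ^^ k) ((\<Phi> ^^ l) t + n)" using assms(2) by (metis inverse_iterate)
  ultimately show ?thesis using D by (rule has_field_derivative_cong_eventually[THEN iffD2])
qed

lemma log_deriv_nonneg: "0 \<le> log_deriv k t"
  by (simp add: log_deriv_def sum_nonneg ln_deriv_nonneg)

lemma iterate_Ints: "n \<in> \<int> \<Longrightarrow> (\<Phi> ^^ k) n \<in> \<int>"
proof (induction k)
  case (Suc k)
  then show ?case using shift_Ints[of "(\<Phi> ^^ k) n" 0] by (simp add: zero)
qed simp

lemma log_deriv_Ints: "n \<in> \<int> \<Longrightarrow> log_deriv k n = 0"
  by (simp add: log_deriv_def deriv_Ints iterate_Ints)

text \<open>Once an orbit reaches an integer it stays in the integers, where the derivative is 1.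
  This reconciles different exponents on the two sides of 0.\<close>

lemma log_deriv_stable:
  assumes "(\<Phi> ^^ k) t \<in> \<int>" "(\<Phi> ^^ j) t \<in> \<int>"
  shows "log_deriv k t = log_deriv j t"
proof -
  have *: "log_deriv (k + i) t = log_deriv k t" if "(\<Phi> ^^ k) t \<in> \<int>" for k i
  proof (induction i)
    case (Suc i)
    have "(\<Phi> ^^ (k + i)) t = (\<Phi> ^^ i) ((\<Phi> ^^ k) t)" by (metis add.commute comp_apply funpow_add)
    then have "(\<Phi> ^^ (k + i)) t \<in> \<int>" using iterate_Ints[OF that] by simp
    then show ?case using Suc by (simp add: log_deriv_def deriv_Ints)
  qed simp
  show ?thesis
    using *[OF assms(1), of "j - k"] *[OF assms(2), of "k - j"] by (cases "k \<le> j") auto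
qed

text \<open>\<open>K\<close> carries multiplication by 2 to \<open>\<Phi>\<close> and commutes with
  integer translations, so a linear piece and its conjugate have the same exponents.\<close>

lemma K_exponents:
  assumes "2 ^ k * y - 2 ^ l * s = n" "n \<in> \<int>"
  shows "(\<Phi> ^^ k) (K y) = (\<Phi> ^^ l) (K s) + n"
proof -
  have "(\<Phi> ^^ k) (K y) = K (2 ^ l * s + n)"
    using assms(1) by (simp add: algebra_simps flip: K_double_iterate)
  also have "\<dots> = (\<Phi> ^^ l) (K s) + n" by (simp add: K_shift_Ints[OF assms(2)] K_double_iterate)
  finally show ?thesis .
qed

lemma gs_groupE:
  assumes "g \<in> gs_group \<phi>"
  obtains f F where "thompson_lift f F" "g = gs_action \<phi> f"
  using assms by (auto simp: gs_group_def thompson_lift_def thompson_T_def orientation_preserving_homeo_def)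

lemma deriv_of_branch:
  assumes cont: "isCont G t"
    and ev: "eventually (\<lambda>s. (\<Phi> ^^ k) (G s) - (\<Phi> ^^ l) s \<in> \<int>) (at t within X)"
    and at: "(\<Phi> ^^ k) (G t) - (\<Phi> ^^ l) t \<in> \<int>"
  shows "(G has_real_derivative exp (log_deriv l t - log_deriv k (G t))) (at t within X)"
proof -
  define d where "d s = (\<Phi> ^^ k) (G s) - (\<Phi> ^^ l) s" for s
  have it: "isCont (\<Phi> ^^ j) s" for j s by (rule DERIV_isCont[OF deriv_lift_iterate])
  have "isCont d t" unfolding d_def
    by (intro continuous_diff it isCont_o2[OF cont it])
  then have "(d \<longlongrightarrow> d t) (at t within X)"
    by (metis continuous_at_imp_continuous_at_within continuous_within)
  moreover have "d t \<in> \<int>" "eventually (\<lambda>s. d s \<in> \<int>) (at t within X)"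
    using ev at by (simp_all add: d_def)
  ultimately have "eventually (\<lambda>s. d s = d t) (at t within X)" by (rule eventually_Ints_eq)
  then have "eventually (\<lambda>s. (\<Phi> ^^ k) (G s) = (\<Phi> ^^ l) s + d t) (at t within X)"
    by eventually_elim (simp add: d_def)
  then show ?thesis by (rule deriv_of_local_branch) (simp add: d_def)
qed

text \<open>\<open>circle_deriv\<close> is a definite description, so a two-sided derivative has to
  be produced first. The two one-sided derivatives come from possibly different exponents and are
  then shown to agree.\<close>

lemma zero_in_NE: "0 \<in> NE (gs_group \<phi>)"
proof -
  have "circle_deriv g 0 \<le> 1" if "g \<in> gs_group \<phi>" for g
  proof -
    obtain f F where fF: "thompson_lift f F" and g: "g = gs_action \<phi> f"
      using gs_groupE[OF \<open>g \<in> gs_group \<phi>\<close>] by blast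
    interpret f: thompson_lift f F by (rule fF)
    define G where "G t = K (F (H t))" for t
    have lift_G: "is_lift G g" unfolding G_def g by (rule gs_action_lift[OF f.lift])
    then have contG: "isCont G 0" by (simp add: is_lift_def continuous_on_eq_continuous_at)
    have exps: "(\<Phi> ^^ k) (G t) - (\<Phi> ^^ l) t \<in> \<int>" if "2 ^ k * F (H t) - 2 ^ l * H t \<in> \<int>" for k l t
      using K_exponents[OF refl that] that by (simp add: G_def)
    obtain e where e: "e > 0"
      and right: "\<exists>k l. \<forall>s\<in>{0..e}. 2 ^ k * F s - 2 ^ l * s \<in> \<int>"
      and left: "\<exists>k l. \<forall>s\<in>{- e..0}. 2 ^ k * F s - 2 ^ l * s \<in> \<int>"
      using f.pieces_at_0 by blast
    have "(H \<longlongrightarrow> H 0) (nhds 0)"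
      using continuous_H[of UNIV] by (simp add: continuous_on_eq_continuous_at isCont_def tendsto_at_iff_tendsto_nhds)
    then have "eventually (\<lambda>s. dist (H s) 0 < e) (nhds 0)"
      unfolding H_0 using e by (rule tendstoD)
    then have near: "eventually (\<lambda>s. \<bar>H s\<bar> < e) (at 0 within X)" for X
      unfolding eventually_at_filter by eventually_elim simp
    have sgn: "0 \<le> H s \<longleftrightarrow> 0 \<le> s" "H s \<le> 0 \<longleftrightarrow> s \<le> 0" for s
      using strict_mono_less_eq[OF strict_H, of 0 s] strict_mono_less_eq[OF strict_H, of s 0] by (simp_all add: H_0)
    obtain k l where kl: "\<And>s. s \<in> {0..e} \<Longrightarrow> 2 ^ k * F s - 2 ^ l * s \<in> \<int>" using right by blast
    obtain k' l' where kl': "\<And>s. s \<in> {- e..0} \<Longrightarrow> 2 ^ k' * F s - 2 ^ l' * s \<in> \<int>" using left by blast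
    have at0: "(\<Phi> ^^ k) (G 0) - (\<Phi> ^^ l) 0 \<in> \<int>" "(\<Phi> ^^ k') (G 0) - (\<Phi> ^^ l') 0 \<in> \<int>"
      using e kl[of 0] kl'[of 0] by (auto intro!: exps simp: H_0)
    \<comment> \<open>Since \<open>\<Phi>\<close> maps integers to integers, both \<open>k\<close>
      and \<open>k'\<close> steps bring \<open>G 0\<close> to an integer, as
      \<open>log_deriv_stable\<close> requires.\<close>
    have in_Ints: "(\<Phi> ^^ k) (G 0) \<in> \<int>" "(\<Phi> ^^ k') (G 0) \<in> \<int>"
      using Ints_add[OF at0(1) iterate_Ints[of 0 l]] Ints_add[OF at0(2) iterate_Ints[of 0 l']] by simp_all
    have "eventually (\<lambda>s. s \<in> {0..}) (at (0::real) within {0..})"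
      by (simp add: eventually_at_filter)
    with near have "eventually (\<lambda>s. (\<Phi> ^^ k) (G s) - (\<Phi> ^^ l) s \<in> \<int>) (at 0 within {0..})"
      by eventually_elim (auto intro!: exps kl simp: sgn)
    then have "(G has_real_derivative exp (log_deriv l 0 - log_deriv k (G 0))) (at 0 within {0..})"
      by (rule deriv_of_branch[OF contG _ at0(1)])
    then have r: "(G has_real_derivative exp (- log_deriv k (G 0))) (at 0 within {0..})"
      by (simp add: log_deriv_Ints)
    have "eventually (\<lambda>s. s \<in> {..0}) (at (0::real) within {..0})"
      by (simp add: eventually_at_filter)
    with near have "eventually (\<lambda>s. (\<Phi> ^^ k') (G s) - (\<Phi> ^^ l') s \<in> \<int>) (at 0 within {..0})"
      by eventually_elim (auto intro!: exps kl' simp: sgn)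
    then have "(G has_real_derivative exp (log_deriv l' 0 - log_deriv k' (G 0))) (at 0 within {..0})"
      by (rule deriv_of_branch[OF contG _ at0(2)])
    then have "(G has_real_derivative exp (- log_deriv k (G 0))) (at 0 within {..0})"
      by (simp add: log_deriv_Ints log_deriv_stable[OF in_Ints])
    with r have "((\<lambda>s. (G s - G 0) / (s - 0)) \<longlongrightarrow> exp (- log_deriv k (G 0))) (at 0 within {0..} \<union> {..0})"
      unfolding at_within_union has_field_derivative_iff by (rule filterlim_sup)
    moreover have "{0..} \<union> {..0} = (UNIV :: real set)" by auto
    ultimately have "circle_deriv g (circ 0) = exp (- log_deriv k (G 0))"
      by (intro circle_deriv_circ[OF lift_G]) (simp add: has_field_derivative_iff)
    then show ?thesis using log_deriv_nonneg[of k "G 0"] by simp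
  qed
  then show ?thesis by (simp add: NE_def)
qed

lemma local_doubling:
  "\<exists>g\<in>gs_group \<phi>. \<exists>G. \<exists>n\<in>\<int>. is_lift G g \<and> eventually (\<lambda>s. G s = \<Phi> s + n) (nhds t)"
proof -
  obtain F n where F: "circle_map F \<in> thompson_T" "is_lift F (circle_map F)" "n \<in> \<int>"
    "eventually (\<lambda>s. F s = 2 * s + n) (nhds (H t))"
    using thompson_doubling[of "H t"] by blast
  have "filterlim H (nhds (H t)) (nhds t)"
    using continuous_H[of UNIV] by (simp add: continuous_on_eq_continuous_at isCont_def tendsto_at_iff_tendsto_nhds)
  from eventually_compose_filterlim[OF F(4) this]
  have "eventually (\<lambda>s. K (F (H s)) = \<Phi> s + n) (nhds t)"
    by eventually_elim (simp add: K_shift_Ints[OF F(3)] K_double)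
  then show ?thesis using F gs_action_lift[OF F(2)]
    by (intro bexI[of _ "gs_action \<phi> (circle_map F)"]) (auto simp: gs_group_def)
qed

lemma NE_eq: "NE (gs_group \<phi>) = {0}"
proof -
  have "x = 0" if x: "x \<in> NE (gs_group \<phi>)" for x
  proof (rule ccontr)
    assume "x \<noteq> 0"
    obtain t where t: "x = circ t" using circ_surj by blast
    then have "t \<notin> \<int>" using \<open>x \<noteq> 0\<close> by auto
    obtain g G n where g: "g \<in> gs_group \<phi>" "is_lift G g" "eventually (\<lambda>s. G s = \<Phi> s + n) (nhds t)"
      using local_doubling by blast
    have "((\<lambda>s. \<Phi> s + n) has_real_derivative \<Phi>' t) (at t)"
      using deriv by (auto intro!: derivative_eq_intros)
    then have "(G has_real_derivative \<Phi>' t) (at t)" using DERIV_cong_ev[OF refl g(3) refl] by blast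
    then have "circle_deriv g x = \<Phi>' t" unfolding t by (rule circle_deriv_circ[OF g(2)])
    moreover have "circle_deriv g x \<le> 1" using x g(1) by (simp add: NE_def)
    ultimately show False using deriv_gt[OF \<open>t \<notin> \<int>\<close>] by simp
  qed
  then show ?thesis using zero_in_NE by auto
qed

lemma parabolic_element:
  "\<exists>g\<in>gs_group \<phi>. g 0 = 0 \<and> (\<exists>\<epsilon>>0. \<forall>s. 0 < \<bar>s\<bar> \<and> \<bar>s\<bar> < \<epsilon> \<longrightarrow> g (circ s) \<noteq> circ s)"
proof -
  obtain g G n where g: "g \<in> gs_group \<phi>" "is_lift G g" "n \<in> \<int>" "eventually (\<lambda>s. G s = \<Phi> s + n) (nhds 0)"
    using local_doubling by blast
  obtain e where e: "e > 0" "\<And>s. dist s 0 < e \<Longrightarrow> G s = \<Phi> s + n"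
    using g(4) by (auto simp: eventually_nhds_metric)
  have g_circ: "g (circ s) = circ (\<Phi> s)" if "\<bar>s\<bar> < e" for s
    using e(2)[of s] that g(2,3) by (simp add: is_lift_def circ_add)
  have "g 0 = 0" using g_circ[of 0] e(1) zero by simp
  moreover have "g (circ s) \<noteq> circ s" if s: "0 < \<bar>s\<bar>" "\<bar>s\<bar> < min e 1" for s
  proof
    assume "g (circ s) = circ s"
    then have "\<Phi> s - s \<in> \<int>" using g_circ[of s] s by (simp add: circ_eq_iff)
    moreover have "\<Phi> 1 = 2" "\<Phi> (- 1) = - 2" using shift[of 0] shift[of "- 1"] zero by simp_all
    \<comment> \<open>Strict expansion between \<open>s\<close> and 0 gives the lower bound; between
      \<open>s\<close> and 1 or -1, on the side of \<open>s\<close>, it gives the upper bound. The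
      displacement is therefore no integer.\<close>
    then have "0 < \<bar>\<Phi> s - s\<bar>" "\<bar>\<Phi> s - s\<bar> < 1"
      using expands[of 0 s] expands[of s 0] expands[of s 1] expands[of "- 1" s] s zero by linarith+
    ultimately show False using Ints_nonzero_abs_ge1[of "\<Phi> s - s"] by auto
  qed
  ultimately show ?thesis using g(1) e(1) by (intro bexI[of _ g] conjI exI[of _ "min e 1"]) auto
qed

lemma zero_isolated_fixed_point: "\<exists>g\<in>gs_group \<phi>. 0 isolated_in {y. g y = y}"
proof -
  obtain g \<epsilon> where g: "g \<in> gs_group \<phi>" "g 0 = 0" "\<epsilon> > 0"
    "\<And>s. 0 < \<bar>s\<bar> \<Longrightarrow> \<bar>s\<bar> < \<epsilon> \<Longrightarrow> g (circ s) \<noteq> circ s"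
    using parabolic_element by blast
  have "g (circ s) = circ s \<longrightarrow> circ s = 0" if "dist s 0 < \<epsilon>" for s
    using g(4)[of s] that by (cases "s = 0") auto
  then have "eventually (\<lambda>x. g x = x \<longrightarrow> x = 0) (nhds (circ 0))"
    unfolding nhds_circ eventually_filtermap eventually_nhds_metric using g(3) by blast
  then obtain T where "open T" "0 \<in> T" "\<And>x. x \<in> T \<Longrightarrow> g x = x \<Longrightarrow> x = 0"
    by (auto simp: eventually_nhds)
  then have "0 isolated_in {y. g y = y}"
    unfolding isolated_in_def using g(2) by (intro conjI exI[of _ T]) auto
  then show ?thesis using g(1) by blast
qed

text \<open>The conjugated dyadic rotations already have dense orbits: \<open>f\<close> is
  continuous onto the circle and the dyadics are dense in the line.\<close>

lemma minimal: "acts_minimally (gs_group \<phi>)"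
  unfolding acts_minimally_def
proof
  fix x
  obtain t where t: "x = circ t" using circ_surj by blast
  define f where "f a = circ (K (H t + a))" for a
  have "f a \<in> (\<lambda>g. g x) ` gs_group \<phi>" if "a \<in> dyadics" for a
  proof -
    have "circle_map (\<lambda>s. s + a) (circ s) = circ (s + a)" for s by (rule circle_map_circ) simp
    then have "f a = gs_action \<phi> (circle_map (\<lambda>s. s + a)) x"
      by (simp add: gs_action_def t inv_h_circ h_circ f_def)
    moreover have "gs_action \<phi> (circle_map (\<lambda>s. s + a)) \<in> gs_group \<phi>"
      unfolding gs_group_def using rotation_in_T[OF that] by (rule imageI)
    ultimately show ?thesis by (rule image_eqI)
  qed
  then have "closure (f ` dyadics) \<subseteq> closure ((\<lambda>g. g x) ` gs_group \<phi>)" by (intro closure_mono) auto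
  moreover have "closure dyadics = (UNIV :: real set)"
  proof -
    have "s \<in> closure dyadics" for s :: real
      unfolding closure_approachable
    proof (intro allI impI)
      fix e :: real assume "e > 0"
      then obtain q where "q \<in> dyadics" "s < q" "q < s + e" using dyadics_dense[of s "s + e"] by auto
      then show "\<exists>q\<in>dyadics. dist q s < e" by (intro bexI[of _ q]) (auto simp: dist_real_def)
    qed
    then show ?thesis by auto
  qed
  moreover have "continuous_on UNIV f" unfolding f_def
    by (intro continuous_on_compose2[OF continuous_circ[of UNIV]] continuous_on_compose2[OF continuous_K[of UNIV]] continuous_intros) auto
  ultimately have "f ` UNIV \<subseteq> closure ((\<lambda>g. g x) ` gs_group \<phi>)"
    using continuous_image_closure_subset[of UNIV f dyadics] by auto
  moreover have "f ` UNIV = UNIV"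
  proof -
    have "y \<in> range f" for y
    proof -
      obtain s where s: "y = circ s" using circ_surj by blast
      have "f (H s - H t) = y" by (simp add: f_def s)
      then show ?thesis by blast
    qed
    then show ?thesis by blast
  qed
  ultimately show "closure ((\<lambda>g. g x) ` gs_group \<phi>) = UNIV" by blast
qed

lemma property_star: "property_star (gs_group \<phi>)"
proof -
  obtain g \<epsilon> where g: "g \<in> gs_group \<phi>" "g 0 = 0" "\<epsilon> > 0"
    "\<And>s. 0 < \<bar>s\<bar> \<Longrightarrow> \<bar>s\<bar> < \<epsilon> \<Longrightarrow> g (circ s) \<noteq> circ s"
    using parabolic_element by blast
  have "g (0 + circ s) \<noteq> 0 + circ s \<and> g (0 - circ s) \<noteq> 0 - circ s" if "0 < s" "s < \<epsilon>" for s
    using g(4)[of s] g(4)[of "- s"] that by (simp add: circ_uminus)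
  then show ?thesis unfolding property_star_def NE_eq
    using minimal g(1-3) by blast
qed

text \<open>A branch-free form of \<open>g = \<phi>^-k o \<phi>^l\<close> near \<open>x\<close>,
  stable under raising both exponents and under composition.\<close>

definition local_branch :: "nat \<Rightarrow> nat \<Rightarrow> (circle \<Rightarrow> circle) \<Rightarrow> circle \<Rightarrow> bool" where
  "local_branch k l g x \<longleftrightarrow> eventually (\<lambda>y. (\<phi> ^^ k) (g y) = (\<phi> ^^ l) y) (nhds x)"

lemma local_branch_raise: "local_branch k l g x \<Longrightarrow> local_branch (k + j) (l + j) g x"
  unfolding local_branch_def by (erule eventually_mono) (simp add: funpow_add add.commute[of _ j])

lemma gs_group_continuous:
  assumes "g \<in> gs_group \<phi>"
  shows "continuous_on UNIV g" "\<exists>G. is_lift G g"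
proof -
  obtain f F where fF: "thompson_lift f F" and g: "g = gs_action \<phi> f"
    using gs_groupE[OF assms] by blast
  interpret f: thompson_lift f F by (rule fF)
  show ex: "\<exists>G. is_lift G g" using gs_action_lift[OF f.lift] unfolding g by blast
  then obtain G where "continuous_on UNIV G" "\<And>t. g (circ t) = circ (G t)" by (auto simp: is_lift_def)
  then show "continuous_on UNIV g"
    by (auto simp: continuous_circle_iff intro: continuous_on_compose2[OF continuous_circ[of UNIV]])
qed

text \<open>The preorbit of 0 under \<open>\<phi>\<close> is invariant, so a word applied to a point
  outside it meets only points where every generator is a local branch.\<close>

lemma gs_group_dyadic:
  assumes "g \<in> gs_group \<phi>"
  shows "g x \<in> h ` dyadic \<longleftrightarrow> x \<in> h ` dyadic"
proof -
  obtain f F where fF: "thompson_lift f F" and g: "g = gs_action \<phi> f"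
    using gs_groupE[OF assms] by blast
  interpret f: thompson_lift f F by (rule fF)
  have mem: "y \<in> h ` dyadic \<longleftrightarrow> inv h y \<in> dyadic" for y by (metis image_iff inv_h)
  obtain t where t: "inv h x = circ t" using circ_surj by blast
  have "inv h (g x) = circ (F t)" by (simp add: g gs_action_def t f.circ_lift)
  then show ?thesis unfolding mem by (simp add: t circ_in_dyadic_iff f.dyadics_iff)
qed

lemma gs_group_local_branch:
  assumes "g \<in> gs_group \<phi>"
  shows "\<exists>l. \<forall>x. x \<notin> h ` dyadic \<longrightarrow> (\<exists>k. local_branch k l g x)"
proof -
  obtain f F where fF: "thompson_lift f F" and g: "g = gs_action \<phi> f"
    using gs_groupE[OF assms] by blast
  interpret f: thompson_lift f F by (rule fF)
  obtain l where l: "\<And>s. s \<notin> dyadics \<Longrightarrow> \<exists>k. eventually (\<lambda>t. 2 ^ k * F t - 2 ^ l * t \<in> \<int>) (nhds s)"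
    using f.uniform_exponent by blast
  have "\<exists>k. local_branch k l g x" if x: "x \<notin> h ` dyadic" for x
  proof -
    obtain t where t: "x = circ t" using circ_surj by blast
    have "x = h (circ (H t))" by (simp add: t h_circ)
    then have "H t \<notin> dyadics" using x circ_in_dyadic_iff by blast
    then obtain k where k: "eventually (\<lambda>t. 2 ^ k * F t - 2 ^ l * t \<in> \<int>) (nhds (H t))" using l by blast
    have "filterlim H (nhds (H t)) (nhds t)"
      using continuous_H[of UNIV] by (simp add: continuous_on_eq_continuous_at isCont_def tendsto_at_iff_tendsto_nhds)
    from eventually_compose_filterlim[OF k this]
    have "eventually (\<lambda>s. (\<phi> ^^ k) (g (circ s)) = (\<phi> ^^ l) (circ s)) (nhds t)"
    proof eventually_elim
      case (elim s)
      have "g (circ s) = circ (K (F (H s)))" using gs_action_lift[OF f.lift] by (simp add: g is_lift_def)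
      then show ?case using K_exponents[OF refl elim] elim by (simp add: phi_iterate circ_add)
    qed
    then show ?thesis unfolding local_branch_def t nhds_circ eventually_filtermap by blast
  qed
  then show ?thesis by blast
qed

lemma local_branch_deriv:
  assumes "is_lift G g" "local_branch k l g (circ t)"
  shows "circle_deriv g (circ t) = exp (log_deriv l t - log_deriv k (G t))"
proof (rule circle_deriv_circ[OF assms(1)])
  have G: "g (circ s) = circ (G s)" for s using assms(1) by (simp add: is_lift_def)
  have "eventually (\<lambda>s. (\<phi> ^^ k) (g (circ s)) = (\<phi> ^^ l) (circ s)) (nhds t)"
    using assms(2) unfolding local_branch_def nhds_circ eventually_filtermap .
  then have ev: "eventually (\<lambda>s. (\<Phi> ^^ k) (G s) - (\<Phi> ^^ l) s \<in> \<int>) (nhds t)"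
    by eventually_elim (simp add: G phi_iterate circ_eq_iff)
  show "(G has_real_derivative exp (log_deriv l t - log_deriv k (G t))) (at t)"
  proof (rule deriv_of_branch)
    show "isCont G t" using assms(1) by (simp add: is_lift_def continuous_on_eq_continuous_at)
    show "eventually (\<lambda>s. (\<Phi> ^^ k) (G s) - (\<Phi> ^^ l) s \<in> \<int>) (at t)"
      using ev by (simp add: eventually_at_filter eventually_mono)
    show "(\<Phi> ^^ k) (G t) - (\<Phi> ^^ l) t \<in> \<int>" using ev by (rule eventually_nhds_x_imp_x)
  qed
qed

lemma id_in_gs_group: "id \<in> gs_group \<phi>"
proof -
  have "circle_map (\<lambda>t. t + 0) (circ t) = circ (t + 0)" for t by (rule circle_map_circ) simp
  then have "circle_map (\<lambda>t. t + 0) x = x" for x using circ_surj[of x] by auto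
  then have "gs_action \<phi> (circle_map (\<lambda>t. t + 0)) = id"
    by (auto simp: gs_action_def fun_eq_iff)
  moreover have "circle_map (\<lambda>t. t + 0) \<in> thompson_T" by (rule rotation_in_T) (simp add: dyadics_Ints)
  ultimately show ?thesis unfolding gs_group_def by (metis image_eqI)
qed

section \<open>Vanishing growth rate almost everywhere\<close>

definition circle_log_deriv :: "nat \<Rightarrow> circle \<Rightarrow> real" where
  "circle_log_deriv n x = (\<Sum>i<n. ln (circle_deriv \<phi> ((\<phi> ^^ i) x)))"

lemma circle_log_deriv_circ: "circle_log_deriv n (circ t) = log_deriv n t"
  by (simp add: circle_log_deriv_def log_deriv_def phi_iterate circle_deriv_circ[OF lift deriv])

lemma continuous_circle_log_deriv: "continuous_on UNIV (circle_log_deriv n)"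
  by (simp add: continuous_circle_iff circle_log_deriv_circ continuous_log_deriv)

lemma circle_log_deriv_nonneg: "0 \<le> circle_log_deriv n x"
  using circ_surj[of x] by (auto simp: circle_log_deriv_circ log_deriv_nonneg)

lemma measurable_circ_restrict: "circ \<in> measurable (restrict_space lborel {0..<1}) borel"
  by (intro measurable_restrict_space1) simp

lemma AE_circle_log_deriv_le:
  fixes \<epsilon> :: real
  assumes "\<epsilon> > 0"
  shows "AE x in circle_lborel. eventually (\<lambda>n. circle_log_deriv n x \<le> \<epsilon> * n) sequentially"
proof -
  define A where "A n = {x. circle_log_deriv n x > \<epsilon> * n}" for n :: nat
  have openA: "open (A n)" for n
    unfolding A_def by (rule open_Collect_less) (intro continuous_intros continuous_circle_log_deriv)+
  have A: "A n \<in> sets circle_lborel" for n using openA by (simp add: circle_lborel_def)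
  have pre: "circ -` A n \<inter> {0..<1} \<subseteq> {t \<in> {0..1}. log_deriv n t > \<epsilon> * n}" for n
    by (auto simp: A_def circle_log_deriv_circ)
  have meas: "{t \<in> {0..1}. log_deriv n t > \<epsilon> * n} \<in> sets lborel" for n
    using borel_measurable_continuous_onI[OF continuous_log_deriv[of UNIV n]] by measurable
  have fin: "emeasure lborel {t \<in> {0..1}. log_deriv n t > \<epsilon> * n} < \<infinity>" for n
  proof -
    have "emeasure lborel {t \<in> {0..1}. log_deriv n t > \<epsilon> * n} \<le> emeasure lborel {0..1::real}"
      by (intro emeasure_mono) auto
    also have "\<dots> < \<infinity>" by simp
    finally show ?thesis .
  qed
  have preA: "circ -` A n \<inter> {0..<1} \<in> sets lborel" for n
    using measurable_sets[OF measurable_circ, of "A n"] openA by auto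
  have em: "emeasure circle_lborel (A n) = emeasure lborel (circ -` A n \<inter> {0..<1})" for n
    unfolding circle_lborel_def using openA
    by (subst emeasure_distr[OF measurable_circ_restrict]) (auto simp: emeasure_restrict_space space_restrict_space)
  have em_le: "emeasure circle_lborel (A n) \<le> emeasure lborel {t \<in> {0..1}. log_deriv n t > \<epsilon> * n}" for n
    unfolding em by (rule emeasure_mono[OF pre meas])
  have "AE x in circle_lborel. eventually (\<lambda>n. x \<in> space circle_lborel - A n) sequentially"
  proof (rule borel_cantelli_AE1[OF A])
    show "emeasure circle_lborel (A n) < \<infinity>" for n using em_le fin by (rule le_less_trans)
    show "summable (\<lambda>n. measure circle_lborel (A n))"
    proof (rule summable_comparison_test'[OF summable_large_log_deriv[OF assms]])
      fix n
      have "measure circle_lborel (A n) \<le> measure lborel {t \<in> {0..1}. log_deriv n t > \<epsilon> * n}"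
        unfolding measure_def using em_le fin by (intro enn2real_mono) auto
      then show "norm (measure circle_lborel (A n)) \<le> measure lborel {t \<in> {0..1}. log_deriv n t > \<epsilon> * n}" by simp
    qed
  qed
  then show ?thesis
    by (rule AE_mp) (auto simp: A_def not_less elim!: eventually_mono intro!: AE_I2)
qed

lemma AE_circle_log_deriv_average: "AE x in circle_lborel. (\<lambda>n. circle_log_deriv n x / n) \<longlonglongrightarrow> 0"
proof -
  \<comment> \<open>Countably many tolerances suffice, so the exceptional sets unite to a null
    set.\<close>
  have "AE x in circle_lborel. \<forall>j::nat. eventually (\<lambda>n. circle_log_deriv n x \<le> 1 / (real j + 1) * n) sequentially"
    unfolding AE_all_countable by (intro allI AE_circle_log_deriv_le) simp
  then show ?thesis
  proof (rule AE_mp, intro AE_I2 impI)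
    fix x assume x: "\<forall>j::nat. eventually (\<lambda>n. circle_log_deriv n x \<le> 1 / (real j + 1) * n) sequentially"
    show "(\<lambda>n. circle_log_deriv n x / n) \<longlonglongrightarrow> 0"
    proof (rule tendstoI)
      fix e :: real assume "e > 0"
      then obtain j :: nat where j: "inverse (real (Suc j)) < e" using reals_Archimedean by blast
      have "eventually (\<lambda>n. circle_log_deriv n x \<le> 1 / (real j + 1) * n) sequentially" using x by blast
      moreover have "eventually (\<lambda>n::nat. n > 0) sequentially" by (rule eventually_gt_at_top)
      ultimately show "eventually (\<lambda>n. dist (circle_log_deriv n x / n) 0 < e) sequentially"
      proof eventually_elim
        case (elim n)
        then have "circle_log_deriv n x / n \<le> 1 / (real j + 1)" by (simp add: field_simps)
        then show ?case using j circle_log_deriv_nonneg[of n x] by (simp add: inverse_eq_divide add.commute)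
      qed
    qed
  qed
qed

lemma AE_not_dyadic: "AE x in circle_lborel. x \<notin> h ` dyadic"
proof -
  have "countable dyadic"
  proof -
    have "dyadic = (\<lambda>(m::int, k::nat). circ (m / 2 ^ k)) ` UNIV" by (auto simp: dyadic_def)
    then show ?thesis by (metis countableI_type countable_image)
  qed
  then have c: "countable (h ` dyadic)" by simp
  have "AE x in circle_lborel. x \<noteq> y" for y
  proof -
    obtain s where s: "y = circ s" using circ_surj by blast
    have sub: "circ -` {y} \<inter> {0..<1} \<subseteq> (\<lambda>n::int. s + n) ` UNIV"
    proof
      fix t assume "t \<in> circ -` {y} \<inter> {0..<1}"
      then have "circ t = circ s" by (simp add: s)
      then obtain n :: int where "t = s + n" by (rule circ_eqE)
      then show "t \<in> (\<lambda>n::int. s + n) ` UNIV" by simp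
    qed
    have "countable (circ -` {y} \<inter> {0..<1})" by (rule countable_subset[OF sub]) simp
    then have "emeasure lborel (circ -` {y} \<inter> {0..<1}) = 0" by (rule emeasure_lborel_countable)
    then have "emeasure circle_lborel {y} = 0"
      unfolding circle_lborel_def
      by (subst emeasure_distr[OF measurable_circ_restrict]) (auto simp: emeasure_restrict_space space_restrict_space)
    then have "{y} \<in> null_sets circle_lborel" by (simp add: null_sets_def circle_lborel_def)
    from AE_not_in[OF this] show ?thesis by simp
  qed
  then have "AE x in circle_lborel. \<forall>y\<in>h ` dyadic. x \<noteq> y" unfolding AE_ball_countable[OF c] by blast
  then show ?thesis by (rule AE_mp) (auto intro!: AE_I2)
qed

section \<open>Words in the generators and the exponent\<close>

lemma word_Cons: "word (g # ws) = g \<circ> word ws"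
  by (simp add: word_def)

lemma word_gs:
  assumes "set ws \<subseteq> gs_group \<phi>"
  shows "continuous_on UNIV (word ws)" "word ws x \<in> h ` dyadic \<longleftrightarrow> x \<in> h ` dyadic"
  using assms
proof (induction ws)
  case Nil
  { case 1 show ?case by (simp add: word_def id_def) }
  { case 2 show ?case by (simp add: word_def) }
next
  case (Cons g ws)
  { case 1
    then show ?case unfolding word_Cons
      by (intro continuous_on_compose continuous_on_subset[OF gs_group_continuous(1)] Cons.IH) auto }
  { case 2
    then show ?case unfolding word_Cons using Cons.IH(2) gs_group_dyadic[of g] by simp }
qed

text \<open>Powers of \<open>\<phi>\<close> commute, so composing two relations adds their
  exponents, at a forward cost of \<open>C\<close> per letter. The exponent \<open>k\<close> may be
  anything, as the inverse part does not expand.\<close>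

lemma word_local_branch:
  assumes F: "F \<subseteq> gs_group \<phi>"
    and C: "\<And>g x. g \<in> F \<Longrightarrow> x \<notin> h ` dyadic \<Longrightarrow> \<exists>k. local_branch k C g x"
    and ws: "set ws \<subseteq> F" and x: "x \<notin> h ` dyadic"
  shows "\<exists>k. local_branch k (C * length ws) (word ws) x"
  using ws
proof (induction ws)
  case Nil
  show ?case by (intro exI[of _ 0]) (simp add: local_branch_def word_def)
next
  case (Cons g ws)
  have sub: "set ws \<subseteq> gs_group \<phi>" using Cons.prems F by auto
  obtain k where k: "local_branch k (C * length ws) (word ws) x" using Cons by auto
  have "word ws x \<notin> h ` dyadic" using word_gs(2)[OF sub] x by simp
  then obtain k' where "local_branch k' C g (word ws x)" using C[of g "word ws x"] Cons.prems by auto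
  then have k': "eventually (\<lambda>y. (\<phi> ^^ k') (g y) = (\<phi> ^^ C) y) (nhds (word ws x))"
    by (simp add: local_branch_def)
  have "filterlim (word ws) (nhds (word ws x)) (nhds x)"
    using word_gs(1)[OF sub] by (simp add: continuous_on_eq_continuous_at isCont_def tendsto_at_iff_tendsto_nhds)
  from eventually_compose_filterlim[OF k' this] k[unfolded local_branch_def]
  have "eventually (\<lambda>y. (\<phi> ^^ (k + k')) (word (g # ws) y) = (\<phi> ^^ (C * length (g # ws))) y) (nhds x)"
  proof eventually_elim
    case (elim y)
    have comm: "(\<phi> ^^ a) ((\<phi> ^^ b) z) = (\<phi> ^^ b) ((\<phi> ^^ a) z)" for a b z
      by (metis add.commute comp_apply funpow_add)
    have "(\<phi> ^^ (k + k')) (word (g # ws) y) = (\<phi> ^^ k) ((\<phi> ^^ C) (word ws y))"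
      using elim by (simp add: word_Cons funpow_add)
    also have "\<dots> = (\<phi> ^^ C) ((\<phi> ^^ (C * length ws)) y)" using elim comm by metis
    finally show ?case by (simp add: funpow_add)
  qed
  then show ?case unfolding local_branch_def by blast
qed

text \<open>The maximum lies between 0, attained by the identity, and \<open>C\<close> times the
  average of \<open>circle_log_deriv\<close> along the subsequence \<open>C * n\<close>.\<close>

lemma lyapunov_exp_zero:
  assumes fin: "finite F" and gen: "semigroup_generated F = gs_group \<phi>"
    and x: "x \<notin> h ` dyadic" and lim: "(\<lambda>n. circle_log_deriv n x / n) \<longlonglongrightarrow> 0"
  shows "lyapunov_exp F x = 0"
proof -
  have F: "F \<subseteq> gs_group \<phi>"
  proof
    fix g assume "g \<in> F"
    then have "word [g] \<in> semigroup_generated F" unfolding semigroup_generated_def by (intro CollectI exI[of _ "[g]"]) auto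
    then show "g \<in> gs_group \<phi>" by (simp add: gen word_def)
  qed
  obtain l where l: "\<And>g x. g \<in> F \<Longrightarrow> x \<notin> h ` dyadic \<Longrightarrow> \<exists>k. local_branch k (l g) g x"
    using gs_group_local_branch F by (metis subsetD)
  \<comment> \<open>The sum dominates the exponent of every generator, and the successor makes
    \<open>n \<mapsto> C * n\<close> strictly increasing even if all exponents vanish.\<close>
  define C where "C = Suc (sum l F)"
  have C: "\<exists>k. local_branch k C g x" if "g \<in> F" "x \<notin> h ` dyadic" for g x
  proof -
    have "l g \<le> C" using member_le_sum[OF that(1), of l] fin by (simp add: C_def)
    then show ?thesis using l[OF that] local_branch_raise[of _ "l g" g x "C - l g"] by auto
  qed
  obtain t where t: "x = circ t" using circ_surj by blast
  define M where "M n = {1 / real n * ln (circle_deriv g x) | g. g \<in> semigroup_generated F \<and> word_length F g \<le> n}" for n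
  have bounds: "0 \<le> Max (M n) \<and> Max (M n) \<le> 1 / real n * circle_log_deriv (C * n) x" for n
  proof -
    have as_word: "\<exists>ws. set ws \<subseteq> F \<and> length ws \<le> n \<and> g = word ws"
      if "g \<in> semigroup_generated F" "word_length F g \<le> n" for g
    proof -
      have "\<exists>m ws. length ws = m \<and> set ws \<subseteq> F \<and> g = word ws"
        using that(1) by (auto simp: semigroup_generated_def)
      from LeastI_ex[OF this] that(2) show ?thesis unfolding word_length_def by auto
    qed
    have "M n \<subseteq> (\<lambda>ws. 1 / real n * ln (circle_deriv (word ws) x)) ` {ws. set ws \<subseteq> F \<and> length ws \<le> n}"
      using as_word by (fastforce simp: M_def)
    then have finM: "finite (M n)"
      using finite_lists_length_le[OF fin, of n] finite_subset by blast
    have zero: "0 \<in> M n"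
    proof -
      have "is_lift (\<lambda>t. t) id" by (simp add: is_lift_def)
      from circle_deriv_circ[OF this DERIV_ident] have "circle_deriv id x = 1" by (simp add: t)
      moreover have "word_length F id \<le> n"
      proof -
        have "word_length F id \<le> 0" unfolding word_length_def
          by (rule Least_le) (simp add: word_def)
        then show ?thesis by simp
      qed
      ultimately show ?thesis unfolding M_def gen using id_in_gs_group
        by (intro CollectI exI[of _ id]) simp
    qed
    have "m \<le> 1 / real n * circle_log_deriv (C * n) x" if "m \<in> M n" for m
    proof -
      from that obtain g where g: "g \<in> semigroup_generated F" "word_length F g \<le> n" "m = 1 / real n * ln (circle_deriv g x)"
        unfolding M_def by blast
      obtain ws where ws: "set ws \<subseteq> F" "length ws \<le> n" "g = word ws" using as_word[OF g(1,2)] by blast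
      obtain k where k: "local_branch k (C * length ws) g x"
        using word_local_branch[OF F C ws(1) x] ws(3) by blast
      obtain G where "is_lift G g" using gs_group_continuous(2) g(1) gen by blast
      then have "circle_deriv g x = exp (log_deriv (C * length ws) t - log_deriv k (G t))"
        using local_branch_deriv k unfolding t by blast
      \<comment> \<open>The inverse branch enters with a negative sign and is dropped.\<close>
      then have "ln (circle_deriv g x) \<le> log_deriv (C * length ws) t" using log_deriv_nonneg[of k "G t"] by simp
      also have "\<dots> \<le> log_deriv (C * n) t" using ws(2) by (intro log_deriv_mono) simp
      finally show ?thesis unfolding g(3) t circle_log_deriv_circ by (intro mult_left_mono) auto
    qed
    then show ?thesis using zero finM Max_ge[OF finM zero] Max_in[OF finM] by blast
  qed
  have "filterlim (\<lambda>n. C * n) at_top sequentially"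
    by (rule filterlim_subseq) (simp add: strict_mono_def C_def add_less_le_mono)
  from filterlim_compose[OF lim this] have "(\<lambda>n. real C * (circle_log_deriv (C * n) x / real (C * n))) \<longlonglongrightarrow> real C * 0"
    by (intro tendsto_intros)
  moreover have "C > 0" by (simp add: C_def)
  then have "real C * (circle_log_deriv (C * n) x / real (C * n)) = 1 / real n * circle_log_deriv (C * n) x" for n
    by simp
  ultimately have up: "(\<lambda>n. 1 / real n * circle_log_deriv (C * n) x) \<longlonglongrightarrow> 0" by simp
  have "(\<lambda>n. Max (M n)) \<longlonglongrightarrow> 0"
    by (rule tendsto_sandwich[OF _ _ tendsto_const up]) (use bounds in auto)
  then have "(\<lambda>n. ereal (Max (M n))) \<longlonglongrightarrow> ereal 0" by simp
  then have "limsup (\<lambda>n. ereal (Max (M n))) = ereal 0"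
    by (rule lim_imp_Limsup[OF trivial_limit_sequentially])
  then show ?thesis unfolding lyapunov_exp_def M_def by (simp add: zero_ereal_def)
qed

end

theorem theorem2:
  fixes r :: enat and \<phi> :: "circle \<Rightarrow> circle"
  assumes "2 \<le> r" and "ghys_sergiescu_map r \<phi>"
  shows "(\<exists>p. NE (gs_group \<phi>) = {p} \<and>
            (\<exists>g\<in>gs_group \<phi>. p isolated_in {y. g y = y})) \<and>
         property_star (gs_group \<phi>) \<and>
         (\<forall>F. finite F \<and> semigroup_generated F = gs_group \<phi> \<longrightarrow>
            (AE x in circle_lborel. lyapunov_exp F x = 0))"
proof -
  obtain \<Phi> \<Phi>' L K where "ghys_sergiescu \<Phi> \<Phi>' L \<phi> K"
    using ghys_sergiescu_of_map[OF assms] by blast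
  then interpret ghys_sergiescu \<Phi> \<Phi>' L \<phi> K .
  have "AE x in circle_lborel. lyapunov_exp F x = 0"
    if "finite F" "semigroup_generated F = gs_group \<phi>" for F
    using AE_not_dyadic AE_circle_log_deriv_average by eventually_elim (rule lyapunov_exp_zero[OF that])
  then show ?thesis using NE_eq zero_isolated_fixed_point property_star by blast
qed

end
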